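(* Let $R\in(0,1)$ and $\delta\in(0,1)$. Let $(\mathcal{C}_j)_{j\ge1}$ be a sequence of binary Reed–Muller codes with lengths $n_j\to\infty$ and rates $R_j\to R$, and let $H_j$ be a parity-check matrix of $\mathcal{C}_j$ (an $n_j(1-R_j)\times n_j$ binary matrix of full row rank with kernel $\mathcal{C}_j$). Let $Z_j$ be a vector of $n_j$ independent Bernoulli$(\delta)$ bits. If $R>1-h_p(\delta)$, then for every $p\in\{2,3,\dots\}\cup\{\infty\}$, $$\lim_{j\to\infty}D_p\big(P_{H_jZ_j}\,\|\,P_{U_{n_j(1-R_j)}}\big)=0.$$ If $R>(1-2\delta)^2$, then $\lim_{j\to\infty}D\big(P_{H_jZ_j}\,\|\,P_{U_{n_j(1-R_j)}}\big)=0$.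
   Context: The binary Reed–Muller code $\mathrm{RM}(r,\mu)$ is the linear code of length $2^\mu$ consisting of the evaluation vectors, over all points of $\mathbb{F}_2^\mu$, of polynomials in $\mu$ variables over $\mathbb{F}_2$ of degree at most $r$; its rate is $2^{-\mu}\sum_{i\le r}\binom{\mu}{i}$. $h_p(\delta)=\frac{1}{1-p}\log_2(\delta^p+(1-\delta)^p)$ for $p\in(1,\infty)$ and $h_\infty(\delta)=-\log_2\max(\delta,1-\delta)$. $P_{U_N}$ is the uniform distribution on $\mathbb{F}_2^N$. Divergences are in base 2: $D_p(P\|Q)=\frac{1}{p-1}\log_2\sum_xP(x)^pQ(x)^{1-p}$, $D_\infty(P\|Q)=\max_x\log_2\frac{P(x)}{Q(x)}$, and $D=D_1$ is the Kullback–Leibler divergence. *)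

theory Defs
  imports "HOL-Probability.Probability"
begin

text \<open>Binary vectors of length n: functions nat => bool that vanish (are False) outside {0..<n}.
  Addition over F_2 is XOR; True stands for the bit 1.\<close>
definition vecs :: "nat \<Rightarrow> (nat \<Rightarrow> bool) set" where
  "vecs n = {x. \<forall>i. n \<le> i \<longrightarrow> \<not> x i}"

text \<open>Reed--Muller code RM(r,mu): the point of F_2^mu with index i < 2^mu has coordinates
  (bit i 0, ..., bit i (mu-1)). A polynomial over F_2 of degree at most r, as a function on
  F_2^mu, is a sum of monomials prod_{k in S} x_k with card S <= r (x_k^2 = x_k); A is the set of
  monomials occurring.\<close>
definition RM :: "nat \<Rightarrow> nat \<Rightarrow> (nat \<Rightarrow> bool) set" where
  "RM r \<mu> = {c. \<exists>A. A \<subseteq> {S. S \<subseteq> {..<\<mu>} \<and> card S \<le> r} \<and>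
      c = (\<lambda>i. i < 2 ^ \<mu> \<and> odd (card {S \<in> A. \<forall>k\<in>S. bit i k}))}"

definition RM_rate :: "nat \<Rightarrow> nat \<Rightarrow> real" where
  "RM_rate r \<mu> = (\<Sum>i\<le>r. real (\<mu> choose i)) / 2 ^ \<mu>"

definition syndrome :: "nat \<Rightarrow> nat \<Rightarrow> (nat \<Rightarrow> nat \<Rightarrow> bool) \<Rightarrow> (nat \<Rightarrow> bool) \<Rightarrow> (nat \<Rightarrow> bool)" where
  "syndrome m n H x = (\<lambda>i. i < m \<and> odd (card {k. k < n \<and> H i k \<and> x k}))"

text \<open>H is an m x n parity-check matrix of the length-n code C:
  full row rank over F_2 and kernel equal to C.\<close>
definition parity_check :: "nat \<Rightarrow> nat \<Rightarrow> (nat \<Rightarrow> nat \<Rightarrow> bool) \<Rightarrow> (nat \<Rightarrow> bool) set \<Rightarrow> bool" where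
  "parity_check m n H C \<longleftrightarrow>
     (\<forall>T. T \<subseteq> {..<m} \<and> T \<noteq> {} \<longrightarrow> (\<exists>k<n. odd (card {i\<in>T. H i k}))) \<and>
     {x \<in> vecs n. syndrome m n H x = (\<lambda>_. False)} = C"

definition bern_vec :: "nat \<Rightarrow> real \<Rightarrow> (nat \<Rightarrow> bool) pmf" where
  "bern_vec n \<delta> = Pi_pmf {..<n} False (\<lambda>_. bernoulli_pmf \<delta>)"

definition unif_vec :: "nat \<Rightarrow> (nat \<Rightarrow> bool) pmf" where
  "unif_vec m = pmf_of_set (vecs m)"

definition renyi_div :: "real \<Rightarrow> 'a set \<Rightarrow> 'a pmf \<Rightarrow> 'a pmf \<Rightarrow> real" where
  "renyi_div p A P Q = 1 / (p - 1) * log 2 (\<Sum>x\<in>A. pmf P x powr p * pmf Q x powr (1 - p))"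

definition renyi_inf :: "'a set \<Rightarrow> 'a pmf \<Rightarrow> 'a pmf \<Rightarrow> real" where
  "renyi_inf A P Q = log 2 (Max ((\<lambda>x. pmf P x / pmf Q x) ` A))"

definition kl_div :: "'a set \<Rightarrow> 'a pmf \<Rightarrow> 'a pmf \<Rightarrow> real" where
  "kl_div A P Q = (\<Sum>x\<in>A. if pmf P x = 0 then 0 else pmf P x * log 2 (pmf P x / pmf Q x))"

definition hp :: "real \<Rightarrow> real \<Rightarrow> real" where
  "hp p \<delta> = 1 / (1 - p) * log 2 (\<delta> powr p + (1 - \<delta>) powr p)"

definition h_inf :: "real \<Rightarrow> real" where
  "h_inf \<delta> = - log 2 (max \<delta> (1 - \<delta>))"

end

(*
  Let g(x) be 2^m times the probability of the syndrome of x, i.e. the noisy version of the normalised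
  indicator of the code. All three divergences are functionals of g that satisfy, for one coordinate,
  Phi(noisy) <= l Phi(unchanged) + (1 - l) Phi(averaged); this is a two-point inequality followed by
  Hoelder's inequality. Iterating over the coordinates bounds Phi(g) by the mean of Phi over random
  erasures, hence by the expected number of points x of a random set S of density l at which every
  codeword is determined by its values on S - {x}.

  For a Reed-Muller code of rate above l this expectation tends to 0. Counting codewords shows that in
  RM(r-k, mu-k), whose rate is almost the same for k = O(log mu), the origin is undetermined with probability
  at least some eps > 0. Embed F_2^(mu-k) affinely into F_2^mu one dimension at a time, always keeping the
  conditional probability of being undetermined bounded below: each of the at least 2^(k+1) - 1 cosets of
  the current subspace is an independent chance to continue, so all of them fail with probability
  exponentially small in 2^k, which beats the number 2^O(mu^2) of subspaces. A codeword on the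
  embedded subspace extends by 0 to a codeword of RM(r, mu).
*)
theory Submission
  imports Defs "HOL-Real_Asymp.Real_Asymp"
begin

unbundle bit_operations_syntax

section \<open>Product weights on subsets\<close>

text \<open>The exponent l is dictated by the two-point inequality. For the orders p >= 2 and
  infinity it is fixed by a pair with one zero entry, where equality gives l = 1 - h_p(\<delta>).
  For relative entropy that pair would only ask for 1 - h(\<delta>), but there nearly equal pairs
  are the worst case and force l = (1 - 2\<delta>)^2; hence the different threshold. Bounding a
  divergence by a count of determined points requires the probability for one point to be
  o(2^-\<mu>), so merely knowing that it tends to 0 would not suffice. Which frame is good depends
  on S, so no frame can be fixed in advance: failure is estimated for each fixed frame, where the
  patterns on the subspace and on its cosets are independent, and then summed over all frames. The
  quality may drop by \<eta> of order 1/\<mu> at each of at most \<mu> dimensions, and 2^k cosets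
  give a failure probability of about exp(-\<eta> 2^k). Taking 2^k >= \<mu>^4 makes this exp(-c
  \<mu>^3), while the rate changes by only O(k / sqrt \<mu>).\<close>

definition bexp :: "'a set \<Rightarrow> ('a \<Rightarrow> real) \<Rightarrow> ('a set \<Rightarrow> real) \<Rightarrow> real" where
  "bexp I p F = (\<Sum>S\<in>Pow I. (\<Prod>i\<in>I. if i \<in> S then p i else 1 - p i) * F S)"

lemma bexp_empty [simp]: "bexp {} p F = F {}"
  by (simp add: bexp_def)

lemma bexp_insert:
  assumes "finite I" "i \<notin> I"
  shows "bexp (insert i I) p F = p i * bexp I p (\<lambda>S. F (insert i S)) + (1 - p i) * bexp I p F"
proof -
  let ?w = "\<lambda>J S. \<Prod>j\<in>J. if j \<in> S then p j else 1 - p j"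
  have disj: "Pow I \<inter> insert i ` Pow I = {}" and inj: "inj_on (insert i) (Pow I)"
    using assms by (auto intro!: inj_onI)
  have w1: "?w (insert i I) (insert i S) = p i * ?w I S" if "S \<in> Pow I" for S
  proof -
    have "?w I (insert i S) = ?w I S"
      using assms by (intro prod.cong) auto
    then show ?thesis using assms by simp
  qed
  have w2: "?w (insert i I) S = (1 - p i) * ?w I S" if "S \<in> Pow I" for S
    using assms that by auto
  have "bexp (insert i I) p F = (\<Sum>S\<in>Pow I. ?w (insert i I) S * F S)
      + (\<Sum>S\<in>Pow I. ?w (insert i I) (insert i S) * F (insert i S))"
    unfolding bexp_def Pow_insert using assms disj
    by (simp add: sum.union_disjoint sum.reindex[OF inj] o_def del: prod.insert)
  also have "\<dots> = (\<Sum>S\<in>Pow I. (1 - p i) * (?w I S * F S)) + (\<Sum>S\<in>Pow I. p i * (?w I S * F (insert i S)))"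
    using w1 w2 by (intro arg_cong2[of _ _ _ _ "(+)"] sum.cong refl) (simp_all del: prod.insert)
  finally show ?thesis
    by (simp add: bexp_def sum_distrib_left)
qed

lemma bexp_cong:
  assumes "\<And>i. i \<in> I \<Longrightarrow> p i = q i" "\<And>S. S \<subseteq> I \<Longrightarrow> F S = G S"
  shows "bexp I p F = bexp I q G"
  unfolding bexp_def using assms
  by (intro sum.cong refl arg_cong2[of _ _ _ _ "(*)"] prod.cong) auto

lemma bexp_add: "bexp I p (\<lambda>S. F S + G S) = bexp I p F + bexp I p G"
  by (simp add: bexp_def algebra_simps sum.distrib)

lemma bexp_cmult: "bexp I p (\<lambda>S. c * F S) = c * bexp I p F"
  by (simp add: bexp_def algebra_simps sum_distrib_left)

lemma bexp_cmult_right: "bexp I p (\<lambda>S. F S * c) = bexp I p F * c"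
  by (simp add: bexp_def algebra_simps sum_distrib_left)

lemma bexp_diff: "bexp I p (\<lambda>S. F S - G S) = bexp I p F - bexp I p G"
  by (simp add: bexp_def algebra_simps sum_subtractf)

lemma bexp_sum: "bexp I p (\<lambda>S. \<Sum>j\<in>J. F j S) = (\<Sum>j\<in>J. bexp I p (F j))"
  unfolding bexp_def by (simp add: sum_distrib_left sum.swap[of _ J])

lemma bexp_const:
  assumes "finite I" shows "bexp I p (\<lambda>S. c) = c"
  using assms by (induction I) (auto simp: bexp_insert algebra_simps)

lemma bexp_mono:
  assumes "\<And>i. i \<in> I \<Longrightarrow> 0 \<le> p i \<and> p i \<le> 1" "\<And>S. S \<subseteq> I \<Longrightarrow> F S \<le> G S"
  shows "bexp I p F \<le> bexp I p G"
  unfolding bexp_def using assms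
  by (intro sum_mono mult_left_mono prod_nonneg) auto

lemma bexp_nonneg:
  assumes "\<And>i. i \<in> I \<Longrightarrow> 0 \<le> p i \<and> p i \<le> 1" "\<And>S. S \<subseteq> I \<Longrightarrow> 0 \<le> F S"
  shows "0 \<le> bexp I p F"
  unfolding bexp_def using assms
  by (intro sum_nonneg mult_nonneg_nonneg prod_nonneg) auto

lemma bexp_Un:
  assumes "finite I" "finite J" "I \<inter> J = {}"
  shows "bexp (I \<union> J) p F = bexp I p (\<lambda>A. bexp J p (\<lambda>B. F (A \<union> B)))"
  using assms
proof (induction I arbitrary: F)
  case empty
  then show ?case by simp
next
  case (insert i I)
  have "bexp (insert i I \<union> J) p F =
      p i * bexp (I \<union> J) p (\<lambda>S. F (insert i S)) + (1 - p i) * bexp (I \<union> J) p F"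
    using insert.hyps insert.prems bexp_insert[of "I \<union> J" i p F] by simp
  then show ?case
    using insert by (simp add: bexp_insert)
qed

lemma bexp_reindex:
  assumes "inj_on h I"
  shows "bexp (h ` I) p F = bexp I (p \<circ> h) (\<lambda>S. F (h ` S))"
proof -
  have inj: "inj_on (image h) (Pow I)"
    using assms by (simp add: inj_on_image_Pow)
  have "bexp (h ` I) p F = (\<Sum>S\<in>image h ` Pow I. (\<Prod>i\<in>h ` I. if i \<in> S then p i else 1 - p i) * F S)"
    unfolding bexp_def by (simp add: image_Pow_surj)
  also have "\<dots> = (\<Sum>S\<in>Pow I. (\<Prod>i\<in>I. if h i \<in> h ` S then p (h i) else 1 - p (h i)) * F (h ` S))"
    using assms by (simp add: sum.reindex[OF inj] prod.reindex o_def)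
  also have "\<dots> = bexp I (p \<circ> h) (\<lambda>S. F (h ` S))"
    unfolding bexp_def using assms
    by (intro sum.cong refl arg_cong2[of _ _ _ _ "(*)"] prod.cong)
       (auto dest: inj_onD)
  finally show ?thesis .
qed

text \<open>Independence of the patterns on disjoint blocks; the blocks will be the cosets of a
  subspace.\<close>

lemma bexp_blocks:
  assumes "finite J" "\<And>j. j \<in> J \<Longrightarrow> finite (B j)" "disjoint_family_on B J"
  shows "bexp (\<Union>j\<in>J. B j) p (\<lambda>S. \<Prod>j\<in>J. F j (S \<inter> B j)) = (\<Prod>j\<in>J. bexp (B j) p (F j))"
  using assms
proof (induction J)
  case empty
  then show ?case by simp
next
  case (insert i J)
  have disj: "B i \<inter> (\<Union>j\<in>J. B j) = {}" and dj: "disjoint_family_on B J"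
    using insert.hyps insert.prems(2) by (auto simp: disjoint_family_on_def)
  have "bexp (\<Union>j\<in>insert i J. B j) p (\<lambda>S. \<Prod>j\<in>insert i J. F j (S \<inter> B j)) =
     bexp (B i) p (\<lambda>A. bexp (\<Union>j\<in>J. B j) p (\<lambda>C. \<Prod>j\<in>insert i J. F j ((A \<union> C) \<inter> B j)))"
    using insert disj by (simp add: bexp_Un del: prod.insert)
  also have "\<dots> = bexp (B i) p (\<lambda>A. bexp (\<Union>j\<in>J. B j) p (\<lambda>C. F i A * (\<Prod>j\<in>J. F j (C \<inter> B j))))"
  proof (intro bexp_cong refl)
    fix A C assume AC: "A \<subseteq> B i" "C \<subseteq> (\<Union>j\<in>J. B j)"
    have "(A \<union> C) \<inter> B i = A" using AC disj by auto
    moreover have "(A \<union> C) \<inter> B j = C \<inter> B j" if "j \<in> J" for j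
      using AC disj that by auto
    ultimately show "(\<Prod>j\<in>insert i J. F j ((A \<union> C) \<inter> B j)) = F i A * (\<Prod>j\<in>J. F j (C \<inter> B j))"
      using insert.hyps by simp
  qed
  also have "\<dots> = bexp (B i) p (F i) * bexp (\<Union>j\<in>J. B j) p (\<lambda>C. \<Prod>j\<in>J. F j (C \<inter> B j))"
    by (simp add: bexp_cmult bexp_cmult_right)
  also have "\<dots> = bexp (B i) p (F i) * (\<Prod>j\<in>J. bexp (B j) p (F j))"
    using insert dj by simp
  finally show ?case using insert.hyps by simp
qed

lemma bexp_card:
  assumes "finite I" shows "bexp I (\<lambda>_. l) (\<lambda>S. real (card S)) = l * card I"
  using assms
proof (induction I)
  case (insert i I)
  have "bexp I (\<lambda>_. l) (\<lambda>S. real (card (insert i S))) = bexp I (\<lambda>_. l) (\<lambda>S. real (card S) + 1)"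
  proof (rule bexp_cong)
    fix S assume "S \<subseteq> I"
    then have "finite S" "i \<notin> S" using insert.hyps finite_subset by auto
    then show "real (card (insert i S)) = real (card S) + 1" by simp
  qed simp
  then show ?case
    using insert by (simp add: bexp_insert bexp_add bexp_const algebra_simps)
qed simp

lemma bexp_half:
  assumes "finite I"
  shows "bexp I (\<lambda>_. 1/2) F = (\<Sum>S\<in>Pow I. F S) / 2 ^ card I"
proof -
  have "(\<Prod>i\<in>I. if i \<in> S then 1/2 else 1 - 1/2) = (1::real) / 2 ^ card I" for S
    by (simp add: power_one_over[symmetric] if_distrib cong: if_cong)
  then show ?thesis by (simp add: bexp_def sum_divide_distrib)
qed

section \<open>Reed--Muller codes as families of sets\<close>

definition mon :: "nat set \<Rightarrow> nat \<Rightarrow> bool" where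
  "mon S i \<longleftrightarrow> (\<forall>k\<in>S. bit i k)"

text \<open>Codewords are represented by their supports: addition over F_2 becomes
  \<open>sym_diff\<close>, and noise or erasure patterns are sets of the same kind.\<close>

definition RM_set :: "nat \<Rightarrow> nat \<Rightarrow> nat set set" where
  "RM_set r \<mu> = {{i. i < 2 ^ \<mu> \<and> odd (card {S \<in> A. mon S i})} |A.
      A \<subseteq> {S. S \<subseteq> {..<\<mu>} \<and> card S \<le> r}}"

lemma RM_eq_RM_set: "RM r \<mu> = (\<lambda>X i. i \<in> X) ` RM_set r \<mu>"
proof -
  have "RM_set r \<mu> = (\<lambda>A. {i. i < 2 ^ \<mu> \<and> odd (card {S \<in> A. mon S i})}) ` {A. A \<subseteq> {S. S \<subseteq> {..<\<mu>} \<and> card S \<le> r}}"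
    unfolding RM_set_def by blast
  moreover have "RM r \<mu> = (\<lambda>A i. i < 2 ^ \<mu> \<and> odd (card {S \<in> A. mon S i})) ` {A. A \<subseteq> {S. S \<subseteq> {..<\<mu>} \<and> card S \<le> r}}"
    unfolding RM_def mon_def by blast
  ultimately show ?thesis by (simp add: image_image)
qed

lemma finite_monomials: "finite {S. S \<subseteq> {..<\<mu>::nat} \<and> card S \<le> r}"
  by simp

lemma mon_empty [simp]: "mon {} i"
  by (simp add: mon_def)

lemma mon_insert [simp]: "mon (insert k S) i \<longleftrightarrow> bit i k \<and> mon S i"
  by (simp add: mon_def)

lemma odd_card_mon_insert:
  assumes "finite A" "T \<notin> A"
  shows "odd (card {S \<in> insert T A. mon S i}) \<longleftrightarrow> odd (card {S \<in> A. mon S i}) \<noteq> mon T i"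
proof -
  have "{S \<in> insert T A. mon S i} = (if mon T i then insert T {S \<in> A. mon S i} else {S \<in> A. mon S i})"
    by auto
  then show ?thesis using assms by simp
qed

lemma odd_card_sym_diff:
  assumes fin: "finite A" "finite B"
  shows "odd (card (sym_diff A B)) \<longleftrightarrow> odd (card A) \<noteq> odd (card B)"
proof -
  have "card A = card (A - B) + card (A \<inter> B)" "card B = card (B - A) + card (B \<inter> A)"
    using card_Diff_subset_Int[of A B] card_Diff_subset_Int[of B A] fin
      card_mono[OF fin(1), of "A \<inter> B"] card_mono[OF fin(2), of "B \<inter> A"] by auto
  moreover have "card (sym_diff A B) = card (A - B) + card (B - A)"
    using fin by (intro card_Un_disjoint) auto
  moreover have "A \<inter> B = B \<inter> A" by auto
  ultimately show ?thesis by presburger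
qed

lemma odd_card_mon_sym_diff:
  assumes "finite A" "finite B"
  shows "odd (card {S \<in> sym_diff A B. mon S i}) \<longleftrightarrow>
    odd (card {S \<in> A. mon S i}) \<noteq> odd (card {S \<in> B. mon S i})"
proof -
  have "{S \<in> sym_diff A B. mon S i} = sym_diff {S \<in> A. mon S i} {S \<in> B. mon S i}" by auto
  moreover have "finite {S \<in> A. mon S i}" "finite {S \<in> B. mon S i}" using assms by auto
  ultimately show ?thesis by (simp only: odd_card_sym_diff)
qed

lemma RM_set_sub: "c \<in> RM_set r \<mu> \<Longrightarrow> c \<subseteq> {..<2 ^ \<mu>}"
  by (auto simp: RM_set_def)

lemma finite_RM_set [simp]: "finite (RM_set r \<mu>)"
  by (rule finite_subset[of _ "Pow {..<2 ^ \<mu>}"]) (use RM_set_sub in auto)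

lemma RM_set_empty [simp]: "{} \<in> RM_set r \<mu>"
  unfolding RM_set_def by (auto intro!: exI[of _ "{}"])

lemma RM_set_monomial:
  assumes "S \<subseteq> {..<\<mu>}" "card S \<le> r"
  shows "{i. i < 2 ^ \<mu> \<and> mon S i} \<in> RM_set r \<mu>"
proof -
  have "{i. i < 2 ^ \<mu> \<and> mon S i} = {i. i < 2 ^ \<mu> \<and> odd (card {T \<in> {S}. mon T i})}"
    using odd_card_mon_insert[of "{}" S] by simp
  then show ?thesis
    unfolding RM_set_def using assms by blast
qed

lemma RM_set_sym_diff:
  assumes "c \<in> RM_set r \<mu>" "d \<in> RM_set r \<mu>"
  shows "sym_diff c d \<in> RM_set r \<mu>"
proof -
  obtain A B where A: "A \<subseteq> {S. S \<subseteq> {..<\<mu>} \<and> card S \<le> r}"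
      "c = {i. i < 2 ^ \<mu> \<and> odd (card {S \<in> A. mon S i})}"
    and B: "B \<subseteq> {S. S \<subseteq> {..<\<mu>} \<and> card S \<le> r}"
      "d = {i. i < 2 ^ \<mu> \<and> odd (card {S \<in> B. mon S i})}"
    using assms by (auto simp: RM_set_def)
  have "finite A" "finite B"
    using A(1) B(1) finite_monomials finite_subset by blast+
  from odd_card_mon_sym_diff[OF this]
  have "sym_diff c d = {i. i < 2 ^ \<mu> \<and> odd (card {S \<in> sym_diff A B. mon S i})}"
    unfolding A(2) B(2) by blast
  then show ?thesis
    using A(1) B(1) unfolding RM_set_def by blast
qed

text \<open>Monomials span the code, so a property preserved by addition needs checking on single
  monomials only.\<close>

lemma RM_set_induct [consumes 1, case_names empty monomial sym_diff]:
  assumes "c \<in> RM_set r \<mu>"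
    and "P {}"
    and mon: "\<And>S. S \<subseteq> {..<\<mu>} \<Longrightarrow> card S \<le> r \<Longrightarrow> P {i. i < 2 ^ \<mu> \<and> mon S i}"
    and sd: "\<And>c d. c \<in> RM_set r \<mu> \<Longrightarrow> d \<in> RM_set r \<mu> \<Longrightarrow> P c \<Longrightarrow> P d \<Longrightarrow> P (sym_diff c d)"
  shows "P c"
proof -
  obtain A where A: "A \<subseteq> {S. S \<subseteq> {..<\<mu>} \<and> card S \<le> r}"
      "c = {i. i < 2 ^ \<mu> \<and> odd (card {S \<in> A. mon S i})}"
    using assms by (auto simp: RM_set_def)
  have "finite A" using A(1) finite_monomials finite_subset by blast
  then have "P {i. i < 2 ^ \<mu> \<and> odd (card {S \<in> A. mon S i})}"
    using A(1)
  proof (induction A)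
    case empty
    then show ?case using assms(2) by simp
  next
    case (insert T A)
    let ?c = "\<lambda>A. {i. i < 2 ^ \<mu> \<and> odd (card {S \<in> A. mon S i})}"
    let ?m = "{i. i < 2 ^ \<mu> \<and> mon T i}"
    have "?c (insert T A) = sym_diff (?c A) ?m"
      using odd_card_mon_insert[OF insert.hyps] by blast
    moreover have "?c A \<in> RM_set r \<mu>" "?m \<in> RM_set r \<mu>"
      using insert.prems by (auto intro!: RM_set_monomial) (auto simp: RM_set_def)
    ultimately show ?case
      using sd[of "?c A" ?m] mon[of T] insert by auto
  qed
  then show ?thesis using A(2) by simp
qed

lemma RM_set_mono:
  assumes "r \<le> s" shows "RM_set r \<mu> \<subseteq> RM_set s \<mu>"
proof -
  have "{S. S \<subseteq> {..<\<mu>} \<and> card S \<le> r} \<subseteq> {S. S \<subseteq> {..<\<mu>} \<and> card S \<le> s}"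
    using assms by auto
  then show ?thesis
    unfolding RM_set_def by (smt (verit) Collect_mono_iff subset_trans)
qed

text \<open>A monomial times x_j is the monomial of \<open>insert j S\<close>, because x_j^2 = x_j,
  so the degree grows by at most one.\<close>

lemma RM_set_times_coord:
  assumes "c \<in> RM_set r \<mu>" "j < \<mu>"
  shows "{i \<in> c. bit i j} \<in> RM_set (Suc r) \<mu>"
  using assms(1)
proof (induction rule: RM_set_induct)
  case empty
  then show ?case by simp
next
  case (monomial S)
  have "finite S" using monomial finite_subset by blast
  then have "card (insert j S) \<le> Suc r" using monomial by (simp add: card_insert_if)
  then have "{i. i < 2 ^ \<mu> \<and> mon (insert j S) i} \<in> RM_set (Suc r) \<mu>"
    using monomial assms by (intro RM_set_monomial) auto
  moreover have "{i. i < 2 ^ \<mu> \<and> mon (insert j S) i}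
      = {i \<in> {i. i < 2 ^ \<mu> \<and> mon S i}. bit i j}" by auto
  ultimately show ?case by simp
next
  case (sym_diff c d)
  have "{i \<in> sym_diff c d. bit i j} = sym_diff {i \<in> c. bit i j} {i \<in> d. bit i j}" by auto
  then show ?case using sym_diff RM_set_sym_diff by simp
qed

text \<open>Affine maps between the spaces of bit vectors; the vectors of \<open>F\<^sub>2\<^sup>\<mu>\<close> are the numbers below
  \<open>2 ^ \<mu>\<close>, with bitwise exclusive or as addition.\<close>

fun aff :: "nat \<Rightarrow> (nat \<Rightarrow> nat) \<Rightarrow> nat \<Rightarrow> nat \<Rightarrow> nat" where
  "aff a v 0 y = a"
| "aff a v (Suc d) y = (if bit y d then aff a v d y XOR v d else aff a v d y)"

lemma aff_0 [simp]: "aff a v d 0 = a"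
  by (induction d) auto

lemma aff_cong: "(\<And>k. k < d \<Longrightarrow> v k = w k) \<Longrightarrow> aff a v d y = aff a w d y"
  by (induction d) auto

lemma aff_xor: "aff a v d (x XOR y) = aff a v d x XOR aff a v d y XOR a"
proof (induction d)
  case (Suc d)
  then show ?case by (intro bit_eqI) (auto simp: bit_xor_iff)
qed simp

lemma xor_less_power: "(a::nat) < 2 ^ n \<Longrightarrow> b < 2 ^ n \<Longrightarrow> a XOR b < 2 ^ n"
  by (metis take_bit_nat_eq_self_iff take_bit_xor)

lemma aff_less: "a < 2 ^ n \<Longrightarrow> (\<And>k. k < d \<Longrightarrow> v k < 2 ^ n) \<Longrightarrow> aff a v d y < 2 ^ n"
  by (induction d) (auto simp: xor_less_power)

lemma not_bit_less: "(y::nat) < 2 ^ d \<Longrightarrow> d \<le> e \<Longrightarrow> \<not> bit y e"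
  by (metis bit_take_bit_iff not_less take_bit_nat_eq_self)

lemma aff_le_dim:
  assumes "y < 2 ^ d" "d \<le> e" shows "aff a v e y = aff a v d y"
  using assms(2)
proof (induction e rule: dec_induct)
  case (step e)
  then show ?case using not_bit_less[OF assms(1)] by auto
qed simp

lemma xor_block: "y < 2 ^ d \<Longrightarrow> j * 2 ^ d + y = (j * 2 ^ d) XOR (y::nat)"
proof (rule disjunctive_add_eq_xor)
  assume "y < 2 ^ d"
  then have 1: "\<not> bit y k" if "d \<le> k" for k using not_bit_less that by blast
  have 2: "\<not> bit (j * 2 ^ d) k" if "k < d" for k
    using that by (simp add: bit_push_bit_iff flip: push_bit_eq_mult)
  show "j * 2 ^ d AND y = 0"
  proof (rule bit_eqI)
    fix k show "bit (j * 2 ^ d AND y) k = bit (0::nat) k"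
      using 1[of k] 2[of k] by (cases "k < d") (simp_all add: bit_and_iff)
  qed
qed

lemma aff_block:
  assumes "y < 2 ^ d" shows "aff a v e (j * 2 ^ d + y) = aff a v e (j * 2 ^ d) XOR aff a v e y XOR a"
  unfolding xor_block[OF assms] aff_xor ..

lemma aff_Suc_upper:
  assumes "y < 2 ^ d" shows "aff a v (Suc d) (2 ^ d + y) = aff a v d y XOR v d"
proof -
  have e: "2 ^ d + y = 2 ^ d XOR y" using xor_block[OF assms, of 1] by simp
  have "bit (2 ^ d + y) d" unfolding e using not_bit_less[OF assms order_refl]
    by (simp add: bit_xor_iff bit_exp_iff)
  moreover have "aff a v d (2 ^ d) = a"
  proof -
    have "aff a v e (2 ^ d) = a" if "e \<le> d" for e
      using that by (induction e) (auto simp: bit_exp_iff)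
    then show ?thesis by simp
  qed
  ultimately show ?thesis
    by (auto simp: e aff_xor bit_xor_iff intro!: bit_eqI)
qed

text \<open>Completion of an affine frame to a basis: while d < \<mu>, the image has fewer than
  2^\<mu> points, and the direction from \<open>a\<close> to any missed point \<open>z\<close> can
  be added.\<close>

lemma aff_inj_extend:
  assumes "inj_on (aff a v d) {..<2 ^ d}" "d \<le> \<mu>" "a < 2 ^ \<mu>" "\<And>k. k < d \<Longrightarrow> v k < 2 ^ \<mu>"
  shows "\<exists>w. (\<forall>k<d. w k = v k) \<and> (\<forall>k<\<mu>. w k < 2 ^ \<mu>) \<and> inj_on (aff a w \<mu>) {..<2 ^ \<mu>}"
  using assms(2,1,4)
proof (induction d arbitrary: v rule: inc_induct)
  case base
  then show ?case by blast
next
  case (step d)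
  have sub: "aff a v d ` {..<2 ^ d} \<subseteq> {..<2 ^ \<mu>}"
    using aff_less[OF assms(3)] step.prems(2) by blast
  have "card (aff a v d ` {..<2 ^ d}) < card {..<2 ^ \<mu>::nat}"
    using step.prems(1) step.hyps by (simp add: card_image)
  then obtain z where z: "z < 2 ^ \<mu>" "z \<notin> aff a v d ` {..<2 ^ d}"
    using sub by (metis lessThan_iff order_less_irrefl subsetI subset_antisym)
  define u where "u = v(d := z XOR a)"
  have uv: "aff a u d y = aff a v d y" for y
    by (rule aff_cong) (simp add: u_def)
  have low: "aff a u (Suc d) y = aff a v d y" if "y < 2 ^ d" for y
    using that not_bit_less[OF that order_refl] uv by simp
  have upp: "aff a u (Suc d) (2 ^ d + y) = aff a v d y XOR z XOR a" if "y < 2 ^ d" for y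
    using aff_Suc_upper[OF that] uv by (simp add: u_def xor.assoc)
  \<comment> \<open>A collision between the two halves would put \<open>z\<close> into the old
    image, at the point \<open>x XOR y\<close>.\<close>
  have cross: "aff a u (Suc d) x \<noteq> aff a u (Suc d) (2 ^ d + y)" if "x < 2 ^ d" "y < 2 ^ d" for x y
  proof
    assume "aff a u (Suc d) x = aff a u (Suc d) (2 ^ d + y)"
    then have "aff a v d x = aff a v d y XOR z XOR a" using low upp that by simp
    then have "aff a v d (x XOR y) = z"
      by (auto simp: aff_xor bit_xor_iff intro!: bit_eqI)
    moreover have "x XOR y < 2 ^ d" using that xor_less_power by blast
    ultimately show False using z by blast
  qed
  have inj: "inj_on (aff a u (Suc d)) {..<2 ^ Suc d}"
  proof (rule inj_onI)
    fix x y assume xy: "x \<in> {..<2 ^ Suc d}" "y \<in> {..<2 ^ Suc d}"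
      "aff a u (Suc d) x = aff a u (Suc d) y"
    have split: "x < 2 ^ d \<or> (\<exists>x'<2 ^ d. x = 2 ^ d + x')" if "x < 2 ^ Suc d" for x :: nat
      using that by (metis add_less_cancel_left le_add_diff_inverse mult_2 not_less power_Suc)
    have "x' = y'" if "x' < 2 ^ d" "y' < 2 ^ d" "x = 2 ^ d + x'" "y = 2 ^ d + y'" for x' y'
    proof -
      have "aff a v d x' XOR z XOR a = aff a v d y' XOR z XOR a"
        using upp that xy(3) by simp
      then have "aff a v d x' = aff a v d y'"
        by (metis xor.assoc xor.right_neutral xor_self_eq)
      then show ?thesis using step.prems(1) that by (auto dest: inj_onD)
    qed
    moreover have "x = y" if "x < 2 ^ d" "y < 2 ^ d"
      using that low xy(3) step.prems(1) by (auto dest: inj_onD)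
    ultimately show "x = y"
      using split[of x] split[of y] xy cross by (metis lessThan_iff)
  qed
  have "u k < 2 ^ \<mu>" if "k < Suc d" for k
    using that step.prems(2) z(1) xor_less_power[OF z(1) assms(3)] by (auto simp: u_def less_Suc_eq)
  from step.IH[OF inj this] obtain w where
    "\<forall>k<Suc d. w k = u k" "\<forall>k<\<mu>. w k < 2 ^ \<mu>" "inj_on (aff a w \<mu>) {..<2 ^ \<mu>}" by blast
  then show ?case by (intro exI[of _ w]) (auto simp: u_def less_Suc_eq)
qed

lemma RM_set_times_aff:
  assumes "c \<in> RM_set r \<mu>" "d \<le> \<mu>"
  shows "{i \<in> c. bit (aff a v d i) j} \<in> RM_set (Suc r) \<mu>"
  using assms(2)
proof (induction d)
  case 0
  have "c \<in> RM_set (Suc r) \<mu>" using assms(1) RM_set_mono[of r "Suc r"] by auto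
  then show ?case by (cases "bit a j") simp_all
next
  case (Suc d)
  let ?X = "{i \<in> c. bit (aff a v d i) j}"
  have "{i \<in> c. bit (aff a v (Suc d) i) j} = (if bit (v d) j then sym_diff ?X {i \<in> c. bit i d} else ?X)"
    by (auto simp: bit_xor_iff)
  moreover have "{i \<in> c. bit i d} \<in> RM_set (Suc r) \<mu>"
    using RM_set_times_coord[OF assms(1)] Suc.prems by simp
  ultimately show ?case
    using Suc RM_set_sym_diff by auto
qed

text \<open>Each coordinate of an affine map is a polynomial of degree at most 1, so a monomial of
  degree s pulls back to a product of s affine forms.\<close>

lemma RM_set_vimage_aff:
  assumes "c \<in> RM_set r \<mu>" "a < 2 ^ \<mu>" "\<And>k. k < \<mu> \<Longrightarrow> v k < 2 ^ \<mu>"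
  shows "{i. i < 2 ^ \<mu> \<and> aff a v \<mu> i \<in> c} \<in> RM_set r \<mu>"
  using assms(1)
proof (induction rule: RM_set_induct)
  case empty
  then show ?case by simp
next
  case (monomial S)
  have "finite S" using monomial finite_subset by blast
  \<comment> \<open>The degree bound is \<open>card S\<close> rather than \<open>r\<close>, because
    each factor added in the induction raises it by one.\<close>
  then have "{i. i < 2 ^ \<mu> \<and> mon S (aff a v \<mu> i)} \<in> RM_set (card S) \<mu>"
  proof (induction S)
    case empty
    then show ?case using RM_set_monomial[of "{}" \<mu> 0] by simp
  next
    case (insert k S)
    have "{i. i < 2 ^ \<mu> \<and> mon (insert k S) (aff a v \<mu> i)} =
      {i \<in> {i. i < 2 ^ \<mu> \<and> mon S (aff a v \<mu> i)}. bit (aff a v \<mu> i) k}" by auto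
    then show ?case
      using RM_set_times_aff[OF insert.IH order_refl] insert.hyps by simp
  qed
  then have "{i. i < 2 ^ \<mu> \<and> mon S (aff a v \<mu> i)} \<in> RM_set r \<mu>"
    using RM_set_mono[OF monomial(2)] by blast
  moreover have "{i. i < 2 ^ \<mu> \<and> aff a v \<mu> i \<in> {i. i < 2 ^ \<mu> \<and> mon S i}} =
    {i. i < 2 ^ \<mu> \<and> mon S (aff a v \<mu> i)}"
    using aff_less[OF assms(2,3)] by auto
  ultimately show ?case by simp
next
  case (sym_diff c d)
  have "{i. i < 2 ^ \<mu> \<and> aff a v \<mu> i \<in> sym_diff c d} =
    sym_diff {i. i < 2 ^ \<mu> \<and> aff a v \<mu> i \<in> c} {i. i < 2 ^ \<mu> \<and> aff a v \<mu> i \<in> d}" by auto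
  then show ?case using sym_diff RM_set_sym_diff by simp
qed

text \<open>Pulling back along a bijection is an injective map of the finite code into itself, hence
  onto. This spares the construction of the inverse affine map.\<close>

lemma RM_set_vimage_aff_surj:
  assumes "c \<in> RM_set r \<mu>" "a < 2 ^ \<mu>" "\<And>k. k < \<mu> \<Longrightarrow> v k < 2 ^ \<mu>"
    and inj: "inj_on (aff a v \<mu>) {..<2 ^ \<mu>}"
  shows "\<exists>e\<in>RM_set r \<mu>. c = {i. i < 2 ^ \<mu> \<and> aff a v \<mu> i \<in> e}"
proof -
  let ?h = "\<lambda>c. {i. i < 2 ^ \<mu> \<and> aff a v \<mu> i \<in> c}"
  have onto: "aff a v \<mu> ` {..<2 ^ \<mu>} = {..<2 ^ \<mu>}"
    using aff_less[OF assms(2,3)] by (intro endo_inj_surj inj) auto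
  have "inj_on ?h (RM_set r \<mu>)"
  proof (rule inj_onI)
    fix c d assume cd: "c \<in> RM_set r \<mu>" "d \<in> RM_set r \<mu>" "?h c = ?h d"
    have "x \<in> c \<longleftrightarrow> x \<in> d" if x: "x < 2 ^ \<mu>" for x
    proof -
      have "x \<in> aff a v \<mu> ` {..<2 ^ \<mu>}" unfolding onto using x by simp
      then obtain y where "x = aff a v \<mu> y" "y < 2 ^ \<mu>" by auto
      then show ?thesis using cd(3) by blast
    qed
    then show "c = d" using RM_set_sub[OF cd(1)] RM_set_sub[OF cd(2)] by blast
  qed
  moreover have "?h ` RM_set r \<mu> \<subseteq> RM_set r \<mu>"
    using RM_set_vimage_aff[OF _ assms(2,3)] by auto
  ultimately have "?h ` RM_set r \<mu> = RM_set r \<mu>"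
    by (intro endo_inj_surj) auto
  then show ?thesis using assms(1) by blast
qed

text \<open>Extension by 0 to one more variable is multiplication by 1 + x_\<mu>, the indicator of
  the old space; it costs one degree per dimension.\<close>

lemma RM_set_extend:
  assumes "c \<in> RM_set r d"
  shows "c \<in> RM_set (r + k) (d + k)"
proof (induction k)
  case (Suc k)
  have *: "{i. i < 2 ^ \<mu> \<and> mon S i} \<in> RM_set (Suc s) (Suc \<mu>)"
    if "S \<subseteq> {..<\<mu>}" "card S \<le> s" for S s \<mu>
  proof -
    have fin: "finite S" "\<mu> \<notin> S" using that finite_subset by auto
    have "{i. i < 2 ^ Suc \<mu> \<and> mon S i} \<in> RM_set (Suc s) (Suc \<mu>)"
      "{i. i < 2 ^ Suc \<mu> \<and> mon (insert \<mu> S) i} \<in> RM_set (Suc s) (Suc \<mu>)"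
      by (rule RM_set_monomial; use that fin in auto)+
    moreover have "i < 2 ^ \<mu> \<longleftrightarrow> \<not> bit i \<mu>" if "i < 2 ^ Suc \<mu>" for i :: nat
    proof
      assume "\<not> bit i \<mu>"
      then have "take_bit \<mu> i = take_bit (Suc \<mu>) i" by (simp add: take_bit_Suc_from_most)
      also have "\<dots> = i" using that by (simp add: take_bit_nat_eq_self)
      finally show "i < 2 ^ \<mu>" by (metis take_bit_nat_less_exp)
    qed (simp add: not_bit_less)
    then have "{i. i < 2 ^ \<mu> \<and> mon S i} =
      sym_diff {i. i < 2 ^ Suc \<mu> \<and> mon S i} {i. i < 2 ^ Suc \<mu> \<and> mon (insert \<mu> S) i}"
      by auto
    ultimately show ?thesis by (simp only: RM_set_sym_diff)
  qed
  from Suc have "c \<in> RM_set (Suc (r + k)) (Suc (d + k))"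
    by (induction rule: RM_set_induct) (erule (1) * | erule (1) RM_set_sym_diff | simp)+
  then show ?case by simp
qed (use assms in simp)

section \<open>Dimension and rate of Reed-Muller codes\<close>

lemma card_RM_set: "card (RM_set r \<mu>) = 2 ^ (\<Sum>i\<le>r. \<mu> choose i)"
proof -
  let ?M = "{S. S \<subseteq> {..<\<mu>} \<and> card S \<le> r}"
  let ?c = "\<lambda>A. {i. i < 2 ^ \<mu> \<and> odd (card {S \<in> A. mon S i})}"
  have eq: "RM_set r \<mu> = ?c ` Pow ?M"
    unfolding RM_set_def by blast
  have nz: "?c A \<noteq> {}" if A: "A \<subseteq> ?M" "A \<noteq> {}" for A
  proof -
    \<comment> \<open>A monomial of least degree: at the point whose coordinates equal to 1 are
      those in \<open>T\<close>, every other monomial of \<open>A\<close> vanishes, as it is not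
      contained in \<open>T\<close>. So no nonempty sum of monomials is the zero function.\<close>
    obtain T where T: "T \<in> A" "\<And>S. S \<in> A \<Longrightarrow> \<not> card S < card T"
      using ex_has_least_nat[of "\<lambda>S. S \<in> A" _ card] A(2) by (metis ex_in_conv not_less)
    have fin: "finite T" and sub: "T \<subseteq> {..<\<mu>}"
      using A(1) T(1) finite_subset by blast+
    define i :: nat where "i = horner_sum of_bool 2 (map (\<lambda>k. k \<in> T) [0..<\<mu>])"
    have bit: "bit i k \<longleftrightarrow> k \<in> T" for k
      using sub by (auto simp: i_def bit_horner_sum_bit_iff)
    have "take_bit \<mu> i = i"
      using sub by (intro bit_eqI) (auto simp: bit_take_bit_iff bit)
    then have "i < 2 ^ \<mu>" by (metis take_bit_nat_less_exp)
    moreover have "{S \<in> A. mon S i} = {T}"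
    proof -
      have "S = T" if "S \<in> A" "S \<subseteq> T" for S
        using T(2)[OF that(1)] that(2) fin by (meson card_subset_eq card_mono le_less not_less order_antisym)
      then show ?thesis using T(1) by (auto simp: mon_def bit subset_iff)
    qed
    ultimately show ?thesis by auto
  qed
  have "inj_on ?c (Pow ?M)"
  proof (rule inj_onI, rule ccontr)
    fix A B assume AB: "A \<in> Pow ?M" "B \<in> Pow ?M" "?c A = ?c B" "A \<noteq> B"
    have fin: "finite A" "finite B"
      using AB(1,2) by (auto intro: finite_subset[OF _ finite_monomials])
    have "even (card {S \<in> sym_diff A B. mon S i})" if "i < 2 ^ \<mu>" for i
    proof -
      have "i \<in> ?c A \<longleftrightarrow> i \<in> ?c B" by (simp only: AB(3))
      then show ?thesis using odd_card_mon_sym_diff[OF fin, of i] that by simp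
    qed
    then have emp: "?c (sym_diff A B) = {}" by simp
    have "sym_diff A B \<subseteq> ?M" "sym_diff A B \<noteq> {}" using AB(1,2,4) by auto
    from nz[OF this] emp show False by (rule notE)
  qed
  then have "card (RM_set r \<mu>) = 2 ^ card ?M"
    unfolding eq by (simp add: card_image card_Pow)
  also have "?M = (\<Union>i\<in>{..r}. {S. S \<subseteq> {..<\<mu>} \<and> card S = i})" by auto
  also have "card \<dots> = (\<Sum>i\<le>r. card {S. S \<subseteq> {..<\<mu>} \<and> card S = i})"
    by (intro card_UN_disjoint) auto
  also have "\<dots> = (\<Sum>i\<le>r. \<mu> choose i)"
    by (simp add: n_subsets)
  finally show ?thesis .
qed

lemma log_card_RM_set: "log 2 (card (RM_set r \<mu>)) = 2 ^ \<mu> * RM_rate r \<mu>"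
  unfolding card_RM_set RM_rate_def by (simp add: log_nat_power)

text \<open>Passing from C(2m, m) / 4^m to the next such term multiplies by (2m+1)/(2m+2), which is
  at most sqrt((2m+1)/(2m+3)) since (2m+1)(2m+3) <= (2m+2)^2. Odd n reduces to even n by C(2m+2,
  m+1) = 2 C(2m+1, m).\<close>

lemma central_binomial_le: "real (n choose k) / 2 ^ n \<le> 1 / sqrt (real n + 1)"
proof -
  have even: "real (2 * m choose m) / 2 ^ (2 * m) \<le> 1 / sqrt (2 * real m + 1)" for m
  proof (induction m)
    case (Suc m)
    have "Suc m * (2 * Suc m choose Suc m) = 2 * (Suc m * (Suc (2 * m) choose Suc m))"
      using central_binomial_odd[of "Suc (2 * m)"] by simp
    also have "\<dots> = 2 * (Suc (2 * m) * (2 * m choose m))"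
      by (simp only: Suc_times_binomial)
    finally have "real (Suc m) * real (2 * Suc m choose Suc m) = 2 * (real (Suc (2 * m)) * real (2 * m choose m))"
      by (metis of_nat_mult of_nat_numeral)
    then have "real (2 * Suc m choose Suc m) = 2 * (2 * real m + 1) * real (2 * m choose m) / (real m + 1)"
      by (simp add: field_simps del: binomial_Suc_Suc)
    moreover have "2 * a * y / b / (4 * q) = a / (2 * b) * (y / q)" for a b y q :: real
      by simp
    moreover have "(2::real) ^ (2 * Suc m) = 4 * 2 ^ (2 * m)" "2 * real m + 2 = 2 * (real m + 1)"
      by simp_all
    ultimately have "real (2 * Suc m choose Suc m) / 2 ^ (2 * Suc m)
        = (2 * real m + 1) / (2 * real m + 2) * (real (2 * m choose m) / 2 ^ (2 * m))"
      by (simp only:)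
    also have "\<dots> \<le> (2 * real m + 1) / (2 * real m + 2) * (1 / sqrt (2 * real m + 1))"
      using Suc by (intro mult_left_mono) auto
    also have "\<dots> = ((2 * real m + 1) / sqrt (2 * real m + 1)) / (2 * real m + 2)"
      by simp
    also have "\<dots> = sqrt (2 * real m + 1) / (2 * real m + 2)"
      by (simp only: real_div_sqrt)
    also have "\<dots> \<le> 1 / sqrt (2 * real m + 3)"
    proof -
      have "sqrt (2 * real m + 1) * sqrt (2 * real m + 3) = sqrt ((2 * real m + 1) * (2 * real m + 3))"
        by (simp add: real_sqrt_mult)
      also have "\<dots> \<le> sqrt ((2 * real m + 2) ^ 2)"
        by (intro real_sqrt_le_mono) (simp add: power2_eq_square algebra_simps)
      finally have "sqrt (2 * real m + 1) * sqrt (2 * real m + 3) \<le> 2 * real m + 2" by simp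
      then show ?thesis by (simp add: field_simps)
    qed
    finally show ?case by (simp add: algebra_simps del: binomial_Suc_Suc)
  qed simp
  have "real (n choose (n div 2)) / 2 ^ n \<le> 1 / sqrt (real n + 1)"
  proof (cases "even n")
    case True
    then obtain m where "n = 2 * m" by (rule evenE)
    then show ?thesis using even[of m] by simp
  next
    case False
    then obtain m where n: "n = Suc (2 * m)" by (metis odd_two_times_div_two_succ Suc_eq_plus1)
    have "2 * Suc m choose Suc m = 2 * (n choose (n div 2))"
      using central_binomial_odd[of n] n by simp
    then have "real (n choose (n div 2)) / 2 ^ n = real (2 * Suc m choose Suc m) / 2 ^ (2 * Suc m)"
      by (simp add: n del: binomial_Suc_Suc)
    also have "\<dots> \<le> 1 / sqrt (2 * real (Suc m) + 1)"
      by (rule even)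
    also have "\<dots> \<le> 1 / sqrt (real n + 1)"
      by (intro divide_left_mono) (auto simp: n)
    finally show ?thesis .
  qed
  moreover have "real (n choose k) / 2 ^ n \<le> real (n choose (n div 2)) / 2 ^ n"
    using binomial_maximum[of n k] by (intro divide_right_mono) auto
  ultimately show ?thesis by linarith
qed

lemma RM_rate_Suc: "RM_rate (Suc r) (Suc \<mu>) = RM_rate r \<mu> + real (\<mu> choose Suc r) / 2 ^ Suc \<mu>"
proof -
  have "(\<Sum>i\<le>Suc r. Suc \<mu> choose i) = 2 * (\<Sum>i\<le>r. \<mu> choose i) + (\<mu> choose Suc r)"
    by (induction r) auto
  then have "(\<Sum>i\<le>Suc r. real (Suc \<mu> choose i)) = 2 * (\<Sum>i\<le>r. real (\<mu> choose i)) + real (\<mu> choose Suc r)"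
    by (metis (mono_tags, lifting) of_nat_add of_nat_mult of_nat_numeral of_nat_sum sum.cong)
  then show ?thesis
    by (simp add: RM_rate_def field_simps del: sum.atMost_Suc binomial_Suc_Suc)
qed

text \<open>By Pascal's rule, raising degree and number of variables together adds a single binomial
  term to the rate, of order 1/sqrt(\<mu>). So k of order log \<mu> is affordable.\<close>

lemma RM_rate_shift: "RM_rate (r + k) (\<mu> + k) \<le> RM_rate r \<mu> + real k / sqrt (real \<mu> + 1)"
proof (induction k)
  case (Suc k)
  have "real ((\<mu> + k) choose Suc (r + k)) / 2 ^ Suc (\<mu> + k) \<le> real ((\<mu> + k) choose Suc (r + k)) / 2 ^ (\<mu> + k)"
    by (intro divide_left_mono) auto
  also have "\<dots> \<le> 1 / sqrt (real (\<mu> + k) + 1)"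
    by (rule central_binomial_le)
  also have "\<dots> \<le> 1 / sqrt (real \<mu> + 1)"
    by (intro divide_left_mono) auto
  finally have "RM_rate (r + Suc k) (\<mu> + Suc k) \<le> RM_rate (r + k) (\<mu> + k) + 1 / sqrt (real \<mu> + 1)"
    using RM_rate_Suc[of "r + k" "\<mu> + k"] by simp
  then show ?case using Suc by (simp add: add_divide_distrib)
qed simp

text \<open>Excludes small degrees: a rate bounded away from 0 forces r to grow at least like
  sqrt(\<mu>), so that r - k is a genuine degree.\<close>

lemma RM_rate_le: "RM_rate r \<mu> \<le> (real r + 1) / sqrt (real \<mu> + 1)"
proof -
  have "RM_rate r \<mu> = (\<Sum>i\<le>r. real (\<mu> choose i) / 2 ^ \<mu>)"
    by (simp add: RM_rate_def sum_divide_distrib)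
  also have "\<dots> \<le> (\<Sum>i\<le>r. 1 / sqrt (real \<mu> + 1))"
    by (intro sum_mono central_binomial_le)
  finally show ?thesis by (simp add: add.commute)
qed

section \<open>Erasures beyond the capacity of the Reed--Muller code\<close>

text \<open>For a linear code, two codewords agreeing on S - {x} but not at x exist exactly when one
  codeword contains x and vanishes on S - {x}. The value at x itself never counts as seen, whether
  or not x lies in S.\<close>

definition undet :: "nat set set \<Rightarrow> nat \<Rightarrow> nat set \<Rightarrow> bool" where
  "undet C x S \<longleftrightarrow> (\<exists>c\<in>C. x \<in> c \<and> c \<inter> S \<subseteq> {x})"

text \<open>Restriction of codewords to S together with the undetermined points is injective: a
  nonzero codeword vanishing on S makes each point of its support undetermined.\<close>

lemma log_card_code_le:
  assumes "finite I" "C \<subseteq> Pow I" "C \<noteq> {}" "S \<subseteq> I"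
    and sd: "\<And>c d. c \<in> C \<Longrightarrow> d \<in> C \<Longrightarrow> sym_diff c d \<in> C"
  shows "log 2 (card C) \<le> real (card S) + (\<Sum>x\<in>I. of_bool (undet C x S))"
proof -
  let ?U = "{x \<in> I. undet C x S}"
  have fin: "finite S" "finite ?U" using assms(1,4) by (auto intro: finite_subset)
  have "inj_on (\<lambda>c. c \<inter> (S \<union> ?U)) C"
  proof (rule inj_onI, rule ccontr)
    fix c d assume cd: "c \<in> C" "d \<in> C" "c \<inter> (S \<union> ?U) = d \<inter> (S \<union> ?U)" "c \<noteq> d"
    let ?e = "sym_diff c d"
    from cd(4) obtain x where x: "x \<in> ?e" by blast
    have disj: "?e \<inter> (S \<union> ?U) = {}" using cd(3) by blast
    have e: "?e \<in> C" by (intro sd cd)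
    then have "x \<in> I" using x assms(2) by auto
    moreover have "undet C x S"
      unfolding undet_def by (rule bexI[OF _ e]) (use x disj in auto)
    ultimately show False using x disj by auto
  qed
  then have "card C \<le> card (Pow (S \<union> ?U))"
    using fin by (intro card_inj_on_le) auto
  also have "\<dots> \<le> 2 ^ (card S + card ?U)"
    using fin card_Un_le[of S ?U] by (simp add: card_Pow)
  finally have "real (card C) \<le> 2 ^ (card S + card ?U)"
    by (metis of_nat_le_iff of_nat_numeral of_nat_power)
  moreover have "card C > 0"
    using assms finite_subset[of C "Pow I"] by (simp add: card_gt_0_iff)
  ultimately have "log 2 (card C) \<le> log 2 (2 ^ (card S + card ?U))"
    by (subst log_le_cancel_iff) auto
  then show ?thesis
    using assms(1) by (simp add: log_nat_power Int_def)
qed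

lemma aff_powers: "aff a (\<lambda>k. 2 ^ k) d y = a XOR take_bit d y"
proof (induction d)
  case (Suc d)
  then show ?case
    by (intro bit_eqI) (auto simp: bit_xor_iff bit_take_bit_iff bit_exp_iff less_Suc_eq)
qed simp

lemma undet_translate:
  assumes "undet (RM_set r \<mu>) x S" "x < 2 ^ \<mu>"
  shows "undet (RM_set r \<mu>) 0 ((\<lambda>i. i XOR x) ` S)"
proof -
  obtain c where c: "c \<in> RM_set r \<mu>" "x \<in> c" "c \<inter> S \<subseteq> {x}"
    using assms(1) by (auto simp: undet_def)
  \<comment> \<open>With the powers of 2 as directions, \<open>aff\<close> is the translation by
    \<open>x\<close>.\<close>
  let ?c = "{i. i < 2 ^ \<mu> \<and> aff x (\<lambda>k. 2 ^ k) \<mu> i \<in> c}"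
  have mem: "i \<in> ?c \<longleftrightarrow> i < 2 ^ \<mu> \<and> x XOR i \<in> c" for i
    by (auto simp: aff_powers take_bit_nat_eq_self)
  have "?c \<in> RM_set r \<mu>"
    using c(1) assms(2) by (intro RM_set_vimage_aff) auto
  moreover have "0 \<in> ?c"
    unfolding mem using c(2) by simp
  moreover have "?c \<inter> (\<lambda>i. i XOR x) ` S \<subseteq> {0}"
  proof
    fix i assume "i \<in> ?c \<inter> (\<lambda>i. i XOR x) ` S"
    then obtain s where s: "s \<in> S" "i = s XOR x" "x XOR i \<in> c" using mem by blast
    then have "x XOR i = s" by (simp add: xor.commute xor.left_commute)
    then have "s = x" using s c(3) by auto
    then show "i \<in> {0}" using s by simp
  qed
  ultimately show ?thesis unfolding undet_def by (intro bexI[of _ ?c] conjI)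
qed

lemma xor_image_lessThan:
  assumes "(x::nat) < 2 ^ \<mu>"
  shows "inj_on (\<lambda>i. i XOR x) {..<2 ^ \<mu>}" "(\<lambda>i. i XOR x) ` {..<2 ^ \<mu>} = {..<2 ^ \<mu>}"
proof -
  show inj: "inj_on (\<lambda>i. i XOR x) {..<2 ^ \<mu>}"
    by (rule inj_onI) (metis xor.assoc xor.right_neutral xor_self_eq)
  show "(\<lambda>i. i XOR x) ` {..<2 ^ \<mu>} = {..<2 ^ \<mu>}"
    using assms xor_less_power by (intro endo_inj_surj inj) auto
qed

text \<open>The dimension count is averaged over S, whose mean size is l 2^\<mu>; by translation
  invariance all points are undetermined equally often, so the origin carries its share of the
  excess rate.\<close>

lemma undet_zero_prob:
  assumes "0 \<le> l" "l \<le> 1"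
  shows "RM_rate r \<mu> - l \<le> bexp {..<2 ^ \<mu>} (\<lambda>_. l) (\<lambda>S. of_bool (undet (RM_set r \<mu>) 0 S))"
proof -
  let ?I = "{..<2 ^ \<mu> :: nat}" and ?C = "RM_set r \<mu>"
  let ?E = "\<lambda>x. bexp ?I (\<lambda>_. l) (\<lambda>S. of_bool (undet ?C x S))"
  have "2 ^ \<mu> * RM_rate r \<mu> = bexp ?I (\<lambda>_. l) (\<lambda>S. log 2 (card ?C))"
    by (simp add: bexp_const log_card_RM_set)
  also have "\<dots> \<le> bexp ?I (\<lambda>_. l) (\<lambda>S. real (card S) + (\<Sum>x\<in>?I. of_bool (undet ?C x S)))"
  proof (rule bexp_mono)
    fix S assume "S \<subseteq> ?I"
    then show "log 2 (card ?C) \<le> real (card S) + (\<Sum>x\<in>?I. of_bool (undet ?C x S))"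
      using RM_set_sub RM_set_empty[of r \<mu>] RM_set_sym_diff by (intro log_card_code_le) blast+
  qed (use assms in auto)
  also have "\<dots> = l * 2 ^ \<mu> + (\<Sum>x\<in>?I. ?E x)"
    by (simp add: bexp_add bexp_sum bexp_card del: sum_of_bool_eq)
  also have "(\<Sum>x\<in>?I. ?E x) \<le> (\<Sum>x\<in>?I. ?E 0)"
  proof (rule sum_mono)
    fix x assume x: "x \<in> ?I"
    have "?E x \<le> bexp ?I (\<lambda>_. l) (\<lambda>S. of_bool (undet ?C 0 ((\<lambda>i. i XOR x) ` S)))"
      using assms x undet_translate[of r \<mu> x] by (intro bexp_mono) auto
    also have "\<dots> = bexp ((\<lambda>i. i XOR x) ` ?I) (\<lambda>_. l) (\<lambda>S. of_bool (undet ?C 0 S))"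
      using x by (subst bexp_reindex) (auto simp: xor_image_lessThan o_def)
    finally show "?E x \<le> ?E 0" using x by (simp add: xor_image_lessThan)
  qed
  finally have "2 ^ \<mu> * RM_rate r \<mu> \<le> 2 ^ \<mu> * (l + ?E 0)" by (simp add: algebra_simps)
  then have "RM_rate r \<mu> \<le> l + ?E 0" by (subst (asm) mult_le_cancel_left_pos) auto
  then show ?thesis by simp
qed

text \<open>Conditional probability that the origin stays undetermined, given the pattern \<open>A\<close> on the first
  \<open>2 ^ d\<close> points.\<close>

definition cundet :: "real \<Rightarrow> nat \<Rightarrow> nat \<Rightarrow> nat \<Rightarrow> nat set \<Rightarrow> real" where
  "cundet l r D d A = bexp {2 ^ d..<2 ^ D} (\<lambda>_. l) (\<lambda>B. of_bool (undet (RM_set r D) 0 (A \<union> B)))"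

lemma cundet_step:
  assumes "d < D"
  shows "cundet l r D d A = bexp {2 ^ d..<2 ^ Suc d} (\<lambda>_. l) (\<lambda>B. cundet l r D (Suc d) (A \<union> B))"
proof -
  have "(2::nat) ^ d \<le> 2 ^ Suc d" "(2::nat) ^ Suc d \<le> 2 ^ D"
    using assms by (auto intro: power_increasing simp del: power_Suc)
  then have "{2 ^ d..<2 ^ D} = {2 ^ d..<2 ^ Suc d} \<union> {2 ^ Suc d..<2 ^ D :: nat}"
    by (simp only: ivl_disj_un_two)
  then show ?thesis
    unfolding cundet_def by (simp add: bexp_Un Un_assoc ivl_disj_int_two del: power_Suc)
qed

lemma cundet_le_1: "0 \<le> l \<Longrightarrow> l \<le> 1 \<Longrightarrow> cundet l r D d A \<le> 1"
  unfolding cundet_def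
  using bexp_mono[of "{2 ^ d..<2 ^ D}" "\<lambda>_. l" "\<lambda>B. of_bool (undet (RM_set r D) 0 (A \<union> B))" "\<lambda>_. 1"]
  by (simp add: bexp_const)

lemma cundet_top: "cundet l r D D A = of_bool (undet (RM_set r D) 0 A)"
  by (simp add: cundet_def)

lemma undet_insert_self: "undet C x (insert x S) \<longleftrightarrow> undet C x S"
  by (auto simp: undet_def)

text \<open>At dimension 0 the condition concerns the origin alone, whose own value is irrelevant,
  so the conditional probability is the unconditional one.\<close>

lemma cundet_0:
  assumes "0 \<le> l" "l \<le> 1" "A \<subseteq> {0}"
  shows "RM_rate r D - l \<le> cundet l r D 0 A"
proof -
  have eq: "undet (RM_set r D) 0 (A \<union> B) \<longleftrightarrow> undet (RM_set r D) 0 B"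
    if "A \<subseteq> {0}" for A B
    using that undet_insert_self[of _ 0] by (auto simp: subset_singleton_iff)
  have "{..<2 ^ D} = {0} \<union> {1..<2 ^ D :: nat}" by auto
  then have "bexp {..<2 ^ D} (\<lambda>_. l) (\<lambda>S. of_bool (undet (RM_set r D) 0 S))
     = bexp {0} (\<lambda>_. l) (\<lambda>A. bexp {1..<2 ^ D} (\<lambda>_. l) (\<lambda>B. of_bool (undet (RM_set r D) 0 (A \<union> B))))"
    by (simp only: bexp_Un) (subst bexp_Un; simp)
  also have "\<dots> = bexp {0::nat} (\<lambda>_. l) (\<lambda>_. cundet l r D 0 A)"
    by (intro bexp_cong refl) (simp add: cundet_def eq assms(3))
  finally show ?thesis
    using undet_zero_prob[OF assms(1,2), of r D] by (simp add: bexp_const)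
qed

text \<open>The blocks \<open>{j * 2 ^ d..<Suc j * 2 ^ d}\<close> are the nontrivial cosets of the \<open>d\<close>-dimensional
  subspace. Their patterns are independent, and each coset completes the subspace to a good
  \<open>(d + 1)\<close>-dimensional one with probability at least \<open>\<eta>\<close> by Markov's inequality.\<close>

lemma cundet_petals:
  assumes l: "0 \<le> l" "l \<le> 1" and d: "d < D" "D \<le> \<mu>"
    and \<tau>: "0 \<le> \<tau>" "\<tau> + \<eta> \<le> cundet l r D d A"
  shows "bexp {2 ^ d..<2 ^ \<mu>} (\<lambda>_. l) (\<lambda>B. of_bool (\<forall>j\<in>{1..<2 ^ (\<mu> - d)}.
      cundet l r D (Suc d) (A \<union> (\<lambda>y. 2 ^ d + y) ` {y. y < 2 ^ d \<and> j * 2 ^ d + y \<in> B}) < \<tau>))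
    \<le> (1 - \<eta>) ^ (2 ^ (\<mu> - d) - 1)"
proof -
  let ?J = "{1..<2 ^ (\<mu> - d) :: nat}"
  define Bl where "Bl = (\<lambda>j. {j * 2 ^ d..<Suc j * 2 ^ d :: nat})"
  define F where "F = (\<lambda>j B. of_bool (cundet l r D (Suc d)
    (A \<union> (\<lambda>y. 2 ^ d + y) ` {y. y < 2 ^ d \<and> j * 2 ^ d + y \<in> B}) < \<tau>) :: real)"
  have mem: "x \<in> Bl j \<longleftrightarrow> x div 2 ^ d = j" for x j
  proof
    assume "x div 2 ^ d = j"
    moreover have "x div 2 ^ d * 2 ^ d \<le> x" by (rule div_times_less_eq_dividend)
    moreover have "x < 2 ^ d + x div 2 ^ d * 2 ^ d" by (rule dividend_less_div_times) simp
    ultimately show "x \<in> Bl j" by (simp add: Bl_def)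
  qed (auto simp: Bl_def mult.commute intro!: div_nat_eqI)
  have disj: "disjoint_family_on Bl ?J"
    using mem by (auto simp: disjoint_family_on_def)
  have Un: "(\<Union>j\<in>?J. Bl j) = {2 ^ d..<2 ^ \<mu>}"
  proof -
    have "x div 2 ^ d \<in> ?J \<longleftrightarrow> x \<in> {2 ^ d..<2 ^ \<mu>}" for x :: nat
    proof -
      have "x div 2 ^ d < 2 ^ (\<mu> - d) \<longleftrightarrow> x < 2 ^ (\<mu> - d) * 2 ^ d"
        by (simp add: div_less_iff_less_mult)
      moreover have "(2::nat) ^ (\<mu> - d) * 2 ^ d = 2 ^ \<mu>"
        using d by (simp flip: power_add)
      moreover have "1 \<le> x div 2 ^ d \<longleftrightarrow> 2 ^ d \<le> x"
        by (simp add: less_eq_div_iff_mult_less_eq)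
      ultimately show ?thesis by simp
    qed
    moreover have "x \<in> (\<Union>j\<in>?J. Bl j) \<longleftrightarrow> x div 2 ^ d \<in> ?J" for x
      by (simp only: UN_iff mem) blast
    ultimately show ?thesis by (intro set_eqI) (simp only:)
  qed
  have one: "bexp (Bl j) (\<lambda>_. l) (F j) \<le> 1 - \<eta>" for j
  proof -
    let ?I = "{2 ^ d..<2 ^ Suc d :: nat}"
    have shift: "bexp {s..<s + 2 ^ d} (\<lambda>_. l) G = bexp {..<2 ^ d} (\<lambda>_. l) (\<lambda>B. G ((+) s ` B))" for s :: nat and G
    proof -
      have "{s..<s + 2 ^ d} = (+) s ` {..<2 ^ d}"
        by (simp add: lessThan_atLeast0 add.commute)
      then show ?thesis by (simp add: bexp_reindex o_def)
    qed
    have pre: "{y. y < 2 ^ d \<and> j * 2 ^ d + y \<in> (+) (j * 2 ^ d) ` B} = B" if "B \<subseteq> {..<2 ^ d}" for B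
      using that by auto
    \<comment> \<open>The pattern on any coset, shifted to the block
      \<open>2 ^ d..<2 ^ Suc d\<close>, has the law over which \<open>cundet_step\<close>
      averages.\<close>
    have "bexp (Bl j) (\<lambda>_. l) (F j) = bexp {..<2 ^ d} (\<lambda>_. l) (\<lambda>B. F j ((+) (j * 2 ^ d) ` B))"
      using shift[of "j * 2 ^ d" "F j"] by (simp add: Bl_def add.commute)
    also have "\<dots> = bexp {..<2 ^ d} (\<lambda>_. l) (\<lambda>B. of_bool (cundet l r D (Suc d) (A \<union> (+) (2 ^ d) ` B) < \<tau>))"
      unfolding F_def by (intro bexp_cong refl) (simp only: pre)
    also have "\<dots> = bexp ?I (\<lambda>_. l) (\<lambda>B. of_bool (cundet l r D (Suc d) (A \<union> B) < \<tau>))"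
      using shift[of "2 ^ d" "\<lambda>B. of_bool (cundet l r D (Suc d) (A \<union> B) < \<tau>)"] by (simp add: mult_2)
    \<comment> \<open>Markov's inequality in pointwise form: the indicator of X < \<tau> is at most
      1 + \<tau> - X when X <= 1 and \<tau> >= 0.\<close>
    also have "\<dots> \<le> bexp ?I (\<lambda>_. l) (\<lambda>B. (1 + \<tau>) - cundet l r D (Suc d) (A \<union> B))"
      using l \<tau>(1) cundet_le_1[OF l] by (intro bexp_mono) (auto simp: of_bool_def add_increasing2)
    also have "\<dots> = 1 + \<tau> - cundet l r D d A"
      by (simp add: bexp_diff bexp_const cundet_step[OF d(1)] del: power_Suc)
    finally show ?thesis using \<tau>(2) by simp
  qed
  have pw: "of_bool (\<forall>j\<in>?J. cundet l r D (Suc d) (A \<union> (\<lambda>y. 2 ^ d + y) ` {y. y < 2 ^ d \<and> j * 2 ^ d + y \<in> B}) < \<tau>)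
    = (\<Prod>j\<in>?J. F j (B \<inter> Bl j))" for B
  proof -
    have eqm: "j * 2 ^ d + y \<in> B \<inter> Bl j \<longleftrightarrow> j * 2 ^ d + y \<in> B" if "y < 2 ^ d" for j y
      using that by (simp add: mem)
    have "{y. y < 2 ^ d \<and> j * 2 ^ d + y \<in> B \<inter> Bl j} = {y. y < 2 ^ d \<and> j * 2 ^ d + y \<in> B}" for j
      by (intro Collect_cong conj_cong refl eqm)
    then have "F j (B \<inter> Bl j) = F j B" for j by (simp only: F_def)
    then show ?thesis by (auto simp: F_def prod_zero_iff of_bool_def)
  qed
  have "bexp {2 ^ d..<2 ^ \<mu>} (\<lambda>_. l) (\<lambda>B. \<Prod>j\<in>?J. F j (B \<inter> Bl j)) = (\<Prod>j\<in>?J. bexp (Bl j) (\<lambda>_. l) (F j))"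
    unfolding Un[symmetric] by (rule bexp_blocks[OF _ _ disj]) (auto simp: Bl_def)
  also have "\<dots> \<le> (\<Prod>j\<in>?J. 1 - \<eta>)"
    using one l by (intro prod_mono conjI bexp_nonneg) (auto simp: F_def)
  finally show ?thesis unfolding pw by simp
qed

text \<open>A witness on the subspace is extended by 0 and transported by a completed frame. It
  vanishes off the subspace, so the part of S lying there imposes no condition.\<close>

lemma undet_extend:
  assumes "undet (RM_set r D) 0 {y. y < 2 ^ D \<and> aff a v D y \<in> S}"
    and "inj_on (aff a v D) {..<2 ^ D}" "a < 2 ^ (D + k)" "\<And>i. i < D \<Longrightarrow> v i < 2 ^ (D + k)"
  shows "undet (RM_set (r + k) (D + k)) a S"
proof -
  let ?\<mu> = "D + k"
  obtain c where c: "c \<in> RM_set r D" "0 \<in> c" "c \<inter> {y. y < 2 ^ D \<and> aff a v D y \<in> S} \<subseteq> {0}"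
    using assms(1) by (auto simp: undet_def)
  obtain w where w: "\<forall>i<D. w i = v i" "\<forall>i<?\<mu>. w i < 2 ^ ?\<mu>" "inj_on (aff a w ?\<mu>) {..<2 ^ ?\<mu>}"
    using aff_inj_extend[OF assms(2) _ assms(3,4)] by auto
  obtain e where e: "e \<in> RM_set (r + k) ?\<mu>" "c = {i. i < 2 ^ ?\<mu> \<and> aff a w ?\<mu> i \<in> e}"
    using RM_set_vimage_aff_surj[OF RM_set_extend[OF c(1), of k] assms(3) _ w(3)] w(2) by blast
  have onto: "aff a w ?\<mu> ` {..<2 ^ ?\<mu>} = {..<2 ^ ?\<mu>}"
    using aff_less[OF assms(3)] w(2) by (intro endo_inj_surj w(3)) auto
  have agree: "aff a w ?\<mu> y = aff a v D y" if "y < 2 ^ D" for y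
    using aff_le_dim[OF that, of ?\<mu> a w] aff_cong[of D w v a y] w(1) by simp
  have "a \<in> e" using c(2) unfolding e(2) by simp
  moreover have "x = a" if x: "x \<in> e" "x \<in> S" for x
  proof -
    have "x \<in> aff a w ?\<mu> ` {..<2 ^ ?\<mu>}"
      unfolding onto using RM_set_sub[OF e(1)] x(1) by auto
    then obtain y where y: "y < 2 ^ ?\<mu>" "x = aff a w ?\<mu> y" by auto
    then have "y \<in> c" unfolding e(2) using x by simp
    then have "y < 2 ^ D" using RM_set_sub[OF c(1)] by auto
    then have "y = 0" using c(3) \<open>y \<in> c\<close> y(2) x(2) agree by auto
    then show ?thesis using y by simp
  qed
  ultimately show ?thesis
    unfolding undet_def by (intro bexI[OF _ e(1)]) auto
qed

text \<open>In coordinates adapted to the frame, the subspace is the initial segment of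
  \<open>2 ^ d\<close> points and the pattern splits into independent parts: \<open>A\<close> on it
  and \<open>B\<close> on its cosets. Each coset supplies an admissible direction, so a bad frame
  means that all cosets fail at once.\<close>

lemma frame_step:
  fixes \<tau> :: real
  assumes l: "0 \<le> l" "l \<le> 1" and d: "d < D" "D \<le> \<mu>" and a: "a < 2 ^ \<mu>"
    and \<tau>: "0 \<le> \<tau>" and \<eta>: "\<eta> \<le> 1"
    and v: "\<And>i. i < d \<Longrightarrow> v i < 2 ^ \<mu>" "inj_on (aff a v d) {..<2 ^ d}"
  shows "bexp {..<2 ^ \<mu>} (\<lambda>_. l) (\<lambda>S. of_bool (\<tau> + \<eta> \<le> cundet l r D d {y. y < 2 ^ d \<and> aff a v d y \<in> S} \<and>
      (\<forall>w<2 ^ \<mu>. inj_on (aff a (v(d := w)) (Suc d)) {..<2 ^ Suc d} \<longrightarrow>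
        cundet l r D (Suc d) {y. y < 2 ^ Suc d \<and> aff a (v(d := w)) (Suc d) y \<in> S} < \<tau>)))
    \<le> (1 - \<eta>) ^ (2 ^ (\<mu> - d) - 1)" (is "bexp ?I _ (\<lambda>S. of_bool (?bad S)) \<le> ?b")
proof -
  let ?J = "{1..<2 ^ (\<mu> - d) :: nat}"
  obtain u where u: "\<forall>i<d. u i = v i" "\<forall>i<\<mu>. u i < 2 ^ \<mu>" "inj_on (aff a u \<mu>) ?I"
    using aff_inj_extend[OF v(2) _ a v(1)] d by auto
  let ?L = "aff a u \<mu>"
  have onto: "?L ` ?I = ?I"
    using aff_less[OF a] u(2) by (intro endo_inj_surj u(3)) auto
  have dm: "y < 2 ^ \<mu>" if "y < 2 ^ d" for y :: nat
    using that d power_increasing[of d \<mu> "2::nat"] by linarith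
  have agree: "aff a v d y = ?L y" if "y < 2 ^ d" for y
    using aff_le_dim[OF that, of \<mu> a u] aff_cong[of d u v a y] u(1) d by simp
  have memL: "?L y \<in> ?L ` S \<longleftrightarrow> y \<in> S" if "y < 2 ^ \<mu>" "S \<subseteq> ?I" for y S
    using inj_on_image_mem_iff[OF u(3), of y S] that by simp
  define P where "P = (\<lambda>A B. \<tau> + \<eta> \<le> cundet l r D d A \<and> (\<forall>j\<in>?J.
     cundet l r D (Suc d) (A \<union> (\<lambda>y. 2 ^ d + y) ` {y. y < 2 ^ d \<and> j * 2 ^ d + y \<in> B}) < \<tau>))"
  have imp: "P A B" if AB: "A \<subseteq> {..<2 ^ d}" "B \<subseteq> {2 ^ d..<2 ^ \<mu>}" and bad: "?bad (?L ` (A \<union> B))" for A B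
  proof -
    have sub: "A \<union> B \<subseteq> ?I" using AB by (auto dest: dm)
    have "{y. y < 2 ^ d \<and> aff a v d y \<in> ?L ` (A \<union> B)} = A"
    proof -
      have "y < 2 ^ d \<and> aff a v d y \<in> ?L ` (A \<union> B) \<longleftrightarrow> y \<in> A" for y
      proof (cases "y < 2 ^ d")
        case True
        then have "aff a v d y \<in> ?L ` (A \<union> B) \<longleftrightarrow> y \<in> A \<union> B"
          using agree memL[OF _ sub] dm by simp
        then show ?thesis using True AB by auto
      qed (use AB in auto)
      then show ?thesis by simp
    qed
    moreover have "cundet l r D (Suc d) (A \<union> (\<lambda>y. 2 ^ d + y) ` {y. y < 2 ^ d \<and> j * 2 ^ d + y \<in> B}) < \<tau>"
      if j: "j \<in> ?J" for j
    proof -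
      \<comment> \<open>The image of the coset's first point, measured from \<open>a\<close>, is the
        direction whose addition adjoins exactly this coset.\<close>
      define w where "w = ?L (j * 2 ^ d) XOR a"
      have jb: "j * 2 ^ d + y < 2 ^ \<mu>" "2 ^ d \<le> j * 2 ^ d + y" if "y < 2 ^ d" for y
      proof -
        have "j * 2 ^ d + y < Suc j * 2 ^ d" using that by simp
        also have "\<dots> \<le> 2 ^ (\<mu> - d) * 2 ^ d" using j by (intro mult_right_mono) auto
        also have "\<dots> = 2 ^ \<mu>" using d by (simp flip: power_add)
        finally show "j * 2 ^ d + y < 2 ^ \<mu>" .
        have "1 * 2 ^ d \<le> j * 2 ^ d" using j by (intro mult_right_mono) auto
        then show "2 ^ d \<le> j * 2 ^ d + y" by linarith
      qed
      have w: "w < 2 ^ \<mu>" unfolding w_def using aff_less[OF a, of \<mu> u] u(2) a xor_less_power by blast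
      have up: "aff a (v(d := w)) (Suc d) (2 ^ d + y) = ?L (j * 2 ^ d + y)" if "y < 2 ^ d" for y
      proof -
        have "aff a (v(d := w)) (Suc d) (2 ^ d + y) = aff a v d y XOR w"
          using aff_Suc_upper[OF that, of a "v(d := w)"] aff_cong[of d "v(d := w)" v a y] by simp
        also have "\<dots> = ?L (j * 2 ^ d) XOR ?L y XOR a"
          using agree[OF that] by (simp add: w_def xor.assoc xor.commute xor.left_commute)
        finally show ?thesis using aff_block[OF that] by simp
      qed
      have lo: "aff a (v(d := w)) (Suc d) y = ?L y" if "y < 2 ^ d" for y
        using aff_le_dim[OF that, of "Suc d" a "v(d := w)"] aff_cong[of d "v(d := w)" v a y] agree[OF that] by simp
      \<comment> \<open>In adapted coordinates the enlarged subspace is the initial segment followed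
        by the j-th block.\<close>
      define g where "g = (\<lambda>y. if y < 2 ^ d then y else j * 2 ^ d + (y - 2 ^ d))"
      have g: "aff a (v(d := w)) (Suc d) y = ?L (g y)" "g y < 2 ^ \<mu>" if "y < 2 ^ Suc d" for y
      proof -
        have "y - 2 ^ d < 2 ^ d" if "\<not> y < 2 ^ d" using \<open>y < 2 ^ Suc d\<close> that by simp
        then show "aff a (v(d := w)) (Suc d) y = ?L (g y)"
          using lo[of y] up[of "y - 2 ^ d"] by (cases "y < 2 ^ d") (simp_all add: g_def del: aff.simps)
        show "g y < 2 ^ \<mu>"
          using jb(1)[of "y - 2 ^ d"] \<open>\<not> y < 2 ^ d \<Longrightarrow> y - 2 ^ d < 2 ^ d\<close> dm[of y] by (cases "y < 2 ^ d") (simp_all add: g_def)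
      qed
      have injg: "inj_on g {..<2 ^ Suc d}"
      proof (rule inj_onI)
        fix x y assume xy: "x \<in> {..<2 ^ Suc d}" "y \<in> {..<2 ^ Suc d}" "g x = g y"
        have big: "2 ^ d \<le> g z" if "\<not> z < 2 ^ d" "z < 2 ^ Suc d" for z
          using jb(2)[of "z - 2 ^ d"] that by (simp add: g_def)
        show "x = y"
        proof (cases "x < 2 ^ d"; cases "y < 2 ^ d")
          assume "\<not> x < 2 ^ d" "\<not> y < 2 ^ d"
          then show ?thesis using xy(3) by (simp add: g_def)
        qed (use xy big[of x] big[of y] in \<open>simp_all add: g_def\<close>)
      qed
      have "inj_on (\<lambda>y. ?L (g y)) {..<2 ^ Suc d}"
        using comp_inj_on[OF injg inj_on_subset[OF u(3)]] g(2) by (auto simp: o_def)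
      then have inj: "inj_on (aff a (v(d := w)) (Suc d)) {..<2 ^ Suc d}"
        by (rule inj_on_cong[THEN iffD1, rotated]) (use g(1) in auto)
      have "{y. y < 2 ^ Suc d \<and> aff a (v(d := w)) (Suc d) y \<in> ?L ` (A \<union> B)}
         = A \<union> (\<lambda>y. 2 ^ d + y) ` {y. y < 2 ^ d \<and> j * 2 ^ d + y \<in> B}" (is "?l = ?r")
      proof (rule set_eqI)
        fix y
        have "y \<in> ?l \<longleftrightarrow> y < 2 ^ Suc d \<and> g y \<in> A \<union> B"
          using g(1)[of y] memL[OF g(2)[of y] sub]
          by (cases "y < 2 ^ Suc d") (simp_all del: aff.simps power_Suc)
        also have "\<dots> \<longleftrightarrow> y \<in> ?r"
        proof (cases "y < 2 ^ d")
          case True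
          then show ?thesis using AB by (auto simp: g_def)
        next
          case False
          then obtain z where z: "y = 2 ^ d + z" by (metis le_iff_add not_less)
          then have "g y = j * 2 ^ d + z" by (simp add: g_def)
          moreover have "y \<notin> A" using AB(1) False by auto
          moreover have "j * 2 ^ d + z \<notin> A" if "z < 2 ^ d" using jb(2)[OF that] AB(1) by auto
          ultimately show ?thesis using z by auto
        qed
        finally show "y \<in> ?l \<longleftrightarrow> y \<in> ?r" .
      qed
      then show ?thesis using bad w inj by auto
    qed
    ultimately show ?thesis using bad unfolding P_def by simp
  qed
  have split: "?I = {..<2 ^ d} \<union> {2 ^ d..<2 ^ \<mu>}" by (auto dest: dm)
  \<comment> \<open>Since all points have the same density l, permuting them by \<open>?L\<close>
    does not change the expectation.\<close>
  have "bexp ?I (\<lambda>_. l) (\<lambda>S. of_bool (?bad S)) = bexp ?I (\<lambda>_. l) (\<lambda>S. of_bool (?bad (?L ` S)))"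
    using bexp_reindex[OF u(3), of "\<lambda>_. l" "\<lambda>S. of_bool (?bad S)"] by (simp only: onto o_def)
  also have "\<dots> = bexp {..<2 ^ d} (\<lambda>_. l) (\<lambda>A. bexp {2 ^ d..<2 ^ \<mu>} (\<lambda>_. l) (\<lambda>B. of_bool (?bad (?L ` (A \<union> B)))))"
    unfolding split by (rule bexp_Un) auto
  also have "\<dots> \<le> bexp {..<2 ^ d} (\<lambda>_. l) (\<lambda>A. bexp {2 ^ d..<2 ^ \<mu>} (\<lambda>_. l) (\<lambda>B. of_bool (P A B)))"
  proof (intro bexp_mono)
    fix A B :: "nat set" assume "A \<subseteq> {..<2 ^ d}" "B \<subseteq> {2 ^ d..<2 ^ \<mu>}"
    from imp[OF this] show "(of_bool (?bad (?L ` (A \<union> B))) :: real) \<le> of_bool (P A B)"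
      by (simp only: of_bool_def) auto
  qed (use l in auto)
  also have "\<dots> \<le> bexp {..<2 ^ d :: nat} (\<lambda>_. l) (\<lambda>A. ?b)"
  proof (rule bexp_mono)
    fix A :: "nat set"
    show "bexp {2 ^ d..<2 ^ \<mu>} (\<lambda>_. l) (\<lambda>B. of_bool (P A B)) \<le> ?b"
    proof (cases "\<tau> + \<eta> \<le> cundet l r D d A")
      case True
      then show ?thesis using cundet_petals[OF l d \<tau> True] by (simp add: P_def)
    next
      case False
      then show ?thesis using \<eta> by (simp add: P_def bexp_const)
    qed
  qed (use l in auto)
  finally show ?thesis by (simp add: bexp_const)
qed

text \<open>Union bound over the at most \<open>(2 ^ (D + k)) ^ d\<close> frames \<open>v\<close> of each dimension \<open>d\<close>: the quality
  threshold \<open>\<epsilon> - d * \<eta>\<close> is met trivially at \<open>d = 0\<close>, and at \<open>d = D\<close> it forces the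
  point to be undetermined.\<close>

lemma determined_prob_le:
  assumes l: "0 \<le> l" "l \<le> 1" and a: "a < 2 ^ (D + k)"
    and \<epsilon>: "RM_rate r D - l \<ge> \<epsilon>" "0 \<le> \<eta>" "\<eta> \<le> 1" "real D * \<eta> < \<epsilon>"
  shows "bexp {..<2 ^ (D + k)} (\<lambda>_. l) (\<lambda>S. of_bool (\<not> undet (RM_set (r + k) (D + k)) a S))
    \<le> real D * (2 ^ (D + k)) ^ D * (1 - \<eta>) ^ 2 ^ k"
proof -
  define \<mu> where "\<mu> = D + k"
  let ?I = "{..<2 ^ \<mu> :: nat}"
  define \<tau> where "\<tau> = (\<lambda>d. \<epsilon> - real d * \<eta>)"
  define V where "V = (\<lambda>d. {v \<in> PiE {..<d} (\<lambda>_. ?I). inj_on (aff a v d) {..<2 ^ d}})"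
  define Q where "Q = (\<lambda>d S. \<exists>v\<in>V d. \<tau> d \<le> cundet l r D d {y. y < 2 ^ d \<and> aff a v d y \<in> S})"
  have finV: "finite (V d)" for d
    unfolding V_def by (intro finite_subset[OF _ finite_PiE[of "{..<d}" "\<lambda>_. ?I"]]) auto
  have cardV: "real (card (V d)) \<le> (2 ^ \<mu>) ^ d" for d
  proof -
    have "card (V d) \<le> card (PiE {..<d} (\<lambda>_. ?I))"
      unfolding V_def by (intro card_mono finite_PiE) auto
    also have "\<dots> = (2 ^ \<mu>) ^ d" by (simp add: card_PiE)
    finally have "real (card (V d)) \<le> real ((2 ^ \<mu>) ^ d)" by (simp only: of_nat_le_iff)
    then show ?thesis by simp
  qed
  have Q0: "Q 0 S" for S
  proof -
    \<comment> \<open>The only frame of dimension 0: \<open>PiE\<close> over no indices contains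
      just the everywhere \<open>undefined\<close> function.\<close>
    have "(\<lambda>_. undefined) \<in> V 0" by (auto simp: V_def inj_on_def)
    moreover have "\<tau> 0 \<le> cundet l r D 0 {y. y < 2 ^ 0 \<and> aff a (\<lambda>_. undefined) 0 y \<in> S}"
      by (rule order_trans[OF _ cundet_0[OF l]]) (use \<epsilon>(1) in \<open>auto simp: \<tau>_def\<close>)
    ultimately show ?thesis unfolding Q_def by blast
  qed
  have QD: "undet (RM_set (r + k) (D + k)) a S" if QDS: "Q D S" for S
  proof -
    obtain v where v: "v \<in> V D" "\<tau> D \<le> cundet l r D D {y. y < 2 ^ D \<and> aff a v D y \<in> S}"
      using QDS unfolding Q_def by blast
    have "0 < \<tau> D" using \<epsilon>(4) by (simp add: \<tau>_def)
    then have "undet (RM_set r D) 0 {y. y < 2 ^ D \<and> aff a v D y \<in> S}"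
      using v(2) by (intro ccontr[where P = "undet _ _ _"]) (auto simp: cundet_top)
    then show ?thesis
      by (rule undet_extend) (use v(1) a in \<open>auto simp: V_def \<mu>_def PiE_iff\<close>)
  qed
  have step: "bexp ?I (\<lambda>_. l) (\<lambda>S. of_bool (Q d S \<and> \<not> Q (Suc d) S)) \<le> (2 ^ \<mu>) ^ D * (1 - \<eta>) ^ 2 ^ k"
    if d: "d < D" for d
  proof -
    define bad where "bad = (\<lambda>v S. \<tau> (Suc d) + \<eta> \<le> cundet l r D d {y. y < 2 ^ d \<and> aff a v d y \<in> S} \<and>
      (\<forall>w<2 ^ \<mu>. inj_on (aff a (v(d := w)) (Suc d)) {..<2 ^ Suc d} \<longrightarrow>
        cundet l r D (Suc d) {y. y < 2 ^ Suc d \<and> aff a (v(d := w)) (Suc d) y \<in> S} < \<tau> (Suc d)))"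
    have \<tau>S: "\<tau> (Suc d) + \<eta> = \<tau> d" by (simp add: \<tau>_def algebra_simps)
    have "\<tau> (Suc d) \<ge> 0"
    proof -
      have "real (Suc d) * \<eta> \<le> real D * \<eta>" using d \<epsilon>(2) by (intro mult_right_mono) auto
      then show ?thesis using \<epsilon>(4) by (simp add: \<tau>_def)
    qed
    have "bexp ?I (\<lambda>_. l) (\<lambda>S. of_bool (Q d S \<and> \<not> Q (Suc d) S)) \<le> bexp ?I (\<lambda>_. l) (\<lambda>S. \<Sum>v\<in>V d. of_bool (bad v S))"
    proof (rule bexp_mono)
      fix S
      have "\<exists>v\<in>V d. bad v S" if Q: "Q d S" "\<not> Q (Suc d) S"
      proof -
        obtain v where v: "v \<in> V d" "\<tau> d \<le> cundet l r D d {y. y < 2 ^ d \<and> aff a v d y \<in> S}"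
          using Q(1) unfolding Q_def by blast
        have "cundet l r D (Suc d) {y. y < 2 ^ Suc d \<and> aff a (v(d := w)) (Suc d) y \<in> S} < \<tau> (Suc d)"
          if w: "w < 2 ^ \<mu>" "inj_on (aff a (v(d := w)) (Suc d)) {..<2 ^ Suc d}" for w
        proof -
          have "v(d := w) \<in> PiE {..<Suc d} (\<lambda>_. ?I)"
            using v(1) w(1) by (auto simp: V_def PiE_iff extensional_def less_Suc_eq)
          then have "v(d := w) \<in> V (Suc d)" unfolding V_def using w(2) by simp
          then show ?thesis using Q(2) unfolding Q_def by (meson not_le)
        qed
        then have "bad v S" unfolding bad_def \<tau>S using v(2) by blast
        then show ?thesis using v(1) by blast
      qed
      then show "of_bool (Q d S \<and> \<not> Q (Suc d) S) \<le> (\<Sum>v\<in>V d. of_bool (bad v S) :: real)"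
      proof (cases "Q d S \<and> \<not> Q (Suc d) S")
        case True
        then obtain v where v: "v \<in> V d" "bad v S" using \<open>\<lbrakk>Q d S; \<not> Q (Suc d) S\<rbrakk> \<Longrightarrow> \<exists>v\<in>V d. bad v S\<close> by blast
        have "(of_bool (bad v S) :: real) \<le> (\<Sum>v\<in>V d. of_bool (bad v S))"
          by (rule member_le_sum) (use v finV in auto)
        then show ?thesis using True v by simp
      next
        case False
        then have z: "(of_bool (Q d S \<and> \<not> Q (Suc d) S) :: real) = 0"
          by (simp only: of_bool_eq_0_iff not_False_eq_True)
        show ?thesis unfolding z by (rule sum_nonneg) simp
      qed
    qed (use l in auto)
    also have "\<dots> = (\<Sum>v\<in>V d. bexp ?I (\<lambda>_. l) (\<lambda>S. of_bool (bad v S)))"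
      by (rule bexp_sum)
    also have "\<dots> \<le> (\<Sum>v\<in>V d. (1 - \<eta>) ^ 2 ^ k)"
    proof (rule sum_mono)
      fix v assume v: "v \<in> V d"
      have "bexp ?I (\<lambda>_. l) (\<lambda>S. of_bool (bad v S)) \<le> (1 - \<eta>) ^ (2 ^ (\<mu> - d) - 1)"
        unfolding bad_def using d \<epsilon>(3) v \<open>\<tau> (Suc d) \<ge> 0\<close> l a
        by (intro frame_step) (auto simp: V_def \<mu>_def PiE_iff)
      also have "\<dots> \<le> (1 - \<eta>) ^ 2 ^ k"
      proof (rule power_decreasing)
        \<comment> \<open>As d < D, at least k + 1 dimensions remain; this makes up for the missing
          trivial coset.\<close>
        have "(2::nat) ^ Suc k \<le> 2 ^ (\<mu> - d)" using d by (intro power_increasing) (auto simp: \<mu>_def)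
        moreover have "(1::nat) \<le> 2 ^ k" by simp
        ultimately show "2 ^ k \<le> 2 ^ (\<mu> - d) - (1::nat)" by (simp only: power_Suc)
      qed (use \<epsilon> in auto)
      finally show "bexp ?I (\<lambda>_. l) (\<lambda>S. of_bool (bad v S)) \<le> (1 - \<eta>) ^ 2 ^ k" .
    qed
    also have "\<dots> = real (card (V d)) * (1 - \<eta>) ^ 2 ^ k" by simp
    also have "\<dots> \<le> (2 ^ \<mu>) ^ D * (1 - \<eta>) ^ 2 ^ k"
    proof (rule mult_right_mono)
      have "((2::real) ^ \<mu>) ^ d \<le> (2 ^ \<mu>) ^ D" using d by (intro power_increasing) auto
      then show "real (card (V d)) \<le> (2 ^ \<mu>) ^ D" using cardV[of d] by linarith
    qed (use \<epsilon> in auto)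
    finally show ?thesis .
  qed
  have "bexp ?I (\<lambda>_. l) (\<lambda>S. of_bool (\<not> undet (RM_set (r + k) (D + k)) a S))
    \<le> bexp ?I (\<lambda>_. l) (\<lambda>S. \<Sum>d<D. of_bool (Q d S \<and> \<not> Q (Suc d) S))"
  proof (rule bexp_mono)
    fix S
    \<comment> \<open>\<open>Q 0\<close> always holds, so failure at \<open>m\<close> means that the
      property is lost at some step from \<open>d\<close> to \<open>Suc d\<close>.\<close>
    have tele: "of_bool (\<not> Q m S) \<le> (\<Sum>d<m. of_bool (Q d S \<and> \<not> Q (Suc d) S) :: real)" for m
    proof (induction m)
      case (Suc m)
      then show ?case by (cases "Q m S"; cases "Q (Suc m) S") (auto simp del: sum_of_bool_eq intro: sum_nonneg)
    qed (simp add: Q0)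
    have "(of_bool (\<not> undet (RM_set (r + k) (D + k)) a S) :: real) \<le> of_bool (\<not> Q D S)"
      using QD[of S] by (auto simp: of_bool_def)
    then show "of_bool (\<not> undet (RM_set (r + k) (D + k)) a S) \<le> (\<Sum>d<D. of_bool (Q d S \<and> \<not> Q (Suc d) S) :: real)"
      using tele[of D] by linarith
  qed (use l in auto)
  also have "\<dots> = (\<Sum>d<D. bexp ?I (\<lambda>_. l) (\<lambda>S. of_bool (Q d S \<and> \<not> Q (Suc d) S)))"
    by (rule bexp_sum)
  also have "\<dots> \<le> (\<Sum>d<D. (2 ^ \<mu>) ^ D * (1 - \<eta>) ^ 2 ^ k)"
    by (intro sum_mono step) auto
  finally show ?thesis by (simp add: \<mu>_def)
qed

section \<open>Two-point inequalities\<close>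

text \<open>A positive value at \<open>a\<close> would yield, by the mean value theorem, a positive
  slope before \<open>a\<close> and a negative one after it.\<close>

lemma sign_change_le_zero:
  fixes h h' :: "real \<Rightarrow> real"
  assumes cont: "continuous_on {0..1} h" and ends: "h 0 = 0" "h 1 = 0"
    and deriv: "\<And>x. 0 < x \<Longrightarrow> x < 1 \<Longrightarrow> (h has_real_derivative h' x) (at x)"
    and sign: "\<And>x y. 0 < x \<Longrightarrow> x < y \<Longrightarrow> y < 1 \<Longrightarrow> 0 < h' x \<Longrightarrow> 0 \<le> h' y"
    and a: "0 \<le> a" "a \<le> 1"
  shows "h a \<le> 0"
proof (rule ccontr)
  assume pos: "\<not> h a \<le> 0"
  then have a': "0 < a" "a < 1" using a ends by (auto simp: less_le)
  have D: "(h has_derivative (*) (h' x)) (at x)" if "0 < x" "x < 1" for x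
    using deriv[OF that] by (simp add: has_field_derivative_def)
  obtain x where x: "0 < x" "x < a" "h a - h 0 = h' x * (a - 0)"
    using mvt[OF a'(1), of h "\<lambda>x. (*) (h' x)"] continuous_on_subset[OF cont, of "{0..a}"] D a' by auto
  obtain y where y: "a < y" "y < 1" "h 1 - h a = h' y * (1 - a)"
    using mvt[OF a'(2), of h "\<lambda>x. (*) (h' x)"] continuous_on_subset[OF cont, of "{a..1}"] D a' by auto
  have "0 < h' x * a" using x(3) pos ends by simp
  then have "0 < h' x" using a' by (simp add: zero_less_mult_iff)
  moreover have "h' y * (1 - a) < 0" using y(3) pos ends by simp
  then have "h' y < 0" using a' by (simp add: mult_less_0_iff)
  ultimately show False using sign[of x y] x y by linarith
qed

text \<open>The claims feed each other: with E and K the sum and the difference of the two powers,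
  E_(s+1) = E_s + x K_s and K_(s+1) = K_s + x E_s. The second claim says that K_s(x) / x is
  nondecreasing.\<close>

lemma pow_sum_diff_mono:
  fixes a b :: real
  assumes ab: "0 < a" "a \<le> b" "b < 1"
  shows "(1 + a) ^ s + (1 - a) ^ s \<le> (1 + b) ^ s + (1 - b) ^ s"
  "b * ((1 + a) ^ s - (1 - a) ^ s) \<le> a * ((1 + b) ^ s - (1 - b) ^ s)"
proof (induction s)
  case (Suc s)
  let ?E = "\<lambda>x. (1 + x) ^ s + (1 - x) ^ s" and ?K = "\<lambda>x. (1 + x) ^ s - (1 - x) ^ s"
  have E: "(1 + x) ^ Suc s + (1 - x) ^ Suc s = ?E x + x * ?K x" for x :: real
    by (simp add: algebra_simps)
  have K: "(1 + x) ^ Suc s - (1 - x) ^ Suc s = ?K x + x * ?E x" for x :: real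
    by (simp add: algebra_simps)
  have pos: "0 \<le> ?K a" "0 \<le> ?K b" using ab by (auto intro!: power_mono)
  have "a * ?K a \<le> b * ?K a" using ab pos by (intro mult_right_mono) auto
  also have "\<dots> \<le> a * ?K b" by (rule Suc(2))
  also have "\<dots> \<le> b * ?K b" using ab pos by (intro mult_right_mono) auto
  finally have "a * ?K a \<le> b * ?K b" .
  then show "(1 + a) ^ Suc s + (1 - a) ^ Suc s \<le> (1 + b) ^ Suc s + (1 - b) ^ Suc s"
    unfolding E using Suc(1) by linarith
  have "(a * b) * ?E a \<le> (a * b) * ?E b" using ab by (intro mult_left_mono Suc(1)) auto
  then show "b * ((1 + a) ^ Suc s - (1 - a) ^ Suc s) \<le> a * ((1 + b) ^ Suc s - (1 - b) ^ Suc s)"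
    unfolding K using Suc(2) by (simp add: algebra_simps)
qed (use ab in auto)

text \<open>Each side is 1 / (1 + x \<rho>) with \<rho> the difference over the sum, and
  \<open>cross\<close> is the cross-multiplied form of the monotonicity of \<rho>.\<close>

lemma sum_diff_ratio_mono:
  fixes a b A B A' B' :: real
  assumes ab: "0 \<le> a" "a \<le> b" and AB: "B \<le> A" "B' \<le> A'" "0 < A + B" "0 < A' + B'"
    and cross: "A * B' \<le> A' * B"
  shows "(A' + B') / (A' + B' + b * (A' - B')) \<le> (A + B) / (A + B + a * (A - B))"
proof -
  have "(A - B) * (A' + B') \<le> (A' - B') * (A + B)"
    using cross by (simp add: algebra_simps)
  then have "a * ((A - B) * (A' + B')) \<le> b * ((A' - B') * (A + B))"
    by (rule mult_mono[rotated]) (use ab AB in auto)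
  moreover have "0 < A + B + a * (A - B)" "0 < A' + B' + b * (A' - B')"
    using ab AB by (auto intro!: add_pos_nonneg)
  ultimately show ?thesis
    by (simp add: divide_le_eq pos_le_divide_eq) (simp add: algebra_simps)
qed

text \<open>\<open>e x / x\<close> is the logarithmic derivative of
  \<open>N x = x * ((1 + x) ^ Suc t - (1 - x) ^ Suc t) / ((1 + x) ^ (t + 2) + (1 - x) ^ (t + 2))\<close>.\<close>

lemma log_slope_mono:
  fixes a b :: real and t :: nat
  assumes ab: "0 < a" "a \<le> b" "b < 1"
  defines "e \<equiv> \<lambda>x::real. ((1 + x) ^ Suc t + (1 - x) ^ Suc t) / ((1 + x) ^ Suc (Suc t) + (1 - x) ^ Suc (Suc t))
     + 4 * (real t + 1) * x * ((1 + x) * (1 - x)) ^ t /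
       (((1 + x) ^ Suc t - (1 - x) ^ Suc t) * ((1 + x) ^ Suc (Suc t) + (1 - x) ^ Suc (Suc t)))"
  shows "e b \<le> e a"
proof -
  define A B A' B' Q Q' where "A = (1 + a) ^ Suc t" "B = (1 - a) ^ Suc t"
    "A' = (1 + b) ^ Suc t" "B' = (1 - b) ^ Suc t"
    "Q = (1 + a) ^ Suc (Suc t) + (1 - a) ^ Suc (Suc t)"
    "Q' = (1 + b) ^ Suc (Suc t) + (1 - b) ^ Suc (Suc t)"
  note defs = this
  have Q: "Q = A + B + a * (A - B)" "Q' = A' + B' + b * (A' - B')"
    by (simp_all add: defs algebra_simps)
  have Qpos: "0 < Q" "0 < Q'" unfolding defs using ab by (auto intro!: add_pos_pos simp del: power_Suc)
  have AB: "B < A" "B' < A'"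
    unfolding defs using ab by (intro power_strict_mono; simp)+
  have sums: "0 < A + B" "0 < A' + B'"
    unfolding defs using ab by (auto intro!: add_pos_pos simp del: power_Suc)
  have cross: "A * B' \<le> A' * B"
    unfolding defs power_mult_distrib[symmetric]
  proof (rule power_mono)
    show "(1 + a) * (1 - b) \<le> (1 + b) * (1 - a)" using ab by (simp add: algebra_simps)
    show "0 \<le> (1 + a) * (1 - b)" using ab by (intro mult_nonneg_nonneg) auto
  qed
  have t1: "(A' + B') / Q' \<le> (A + B) / Q"
    unfolding Q using ab AB sums cross by (intro sum_diff_ratio_mono) auto
  \<comment> \<open>The second summand of \<open>e\<close> is, up to a constant, a product of three
    nonnegative nonincreasing factors: x over the power difference, a power of 1 - x^2, and the
    reciprocal of the power sum.\<close>
  have k: "b / (A' - B') \<le> a / (A - B)"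
  proof -
    have "b * (A - B) \<le> a * (A' - B')" unfolding defs by (rule pow_sum_diff_mono[OF ab])
    then show ?thesis using AB by (simp add: divide_le_eq pos_le_divide_eq mult.commute)
  qed
  have p: "((1 + b) * (1 - b)) ^ t \<le> ((1 + a) * (1 - a)) ^ t"
  proof (rule power_mono)
    have "a * a \<le> b * b" using ab by (intro mult_mono) auto
    then show "(1 + b) * (1 - b) \<le> (1 + a) * (1 - a)" by (simp add: algebra_simps)
  qed (use ab in auto)
  have q: "1 / Q' \<le> 1 / Q"
    using Qpos pow_sum_diff_mono(1)[OF ab, of "Suc (Suc t)"] unfolding defs by (intro divide_left_mono) auto
  have "0 \<le> ((1 + b) * (1 - b)) ^ t" "0 \<le> ((1 + a) * (1 - a)) ^ t"
    using ab by (intro zero_le_power mult_nonneg_nonneg; simp)+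
  then have t2: "(b / (A' - B')) * ((1 + b) * (1 - b)) ^ t * (1 / Q')
      \<le> (a / (A - B)) * ((1 + a) * (1 - a)) ^ t * (1 / Q)"
    using ab AB Qpos by (intro mult_mono[OF mult_mono[OF k p] q]) auto
  have split: "4 * (real t + 1) * x * p / (u * v) = 4 * (real t + 1) * ((x / u) * p * (1 / v))" for x p u v :: real
    by simp
  show ?thesis
    unfolding e_def split using t1 t2 unfolding defs by (intro add_mono mult_left_mono) auto
qed

text \<open>The q-th moment of the density with values 1 + x and 1 - x on two equally likely
  points.\<close>

definition psi :: "nat \<Rightarrow> real \<Rightarrow> real" where
  "psi q x = ((1 + x) ^ q + (1 - x) ^ q) / 2"

lemma psi_ge_1:
  assumes "\<bar>x\<bar> \<le> 1" shows "1 \<le> psi q x"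
proof -
  have "-1 \<le> x" "-1 \<le> -x" using assms by auto
  then show ?thesis
    using Bernoulli_inequality[of x q] Bernoulli_inequality[of "-x" q] by (simp add: psi_def)
qed

lemma DERIV_one_plus_power:
  "((\<lambda>x::real. (1 + x) ^ Suc n) has_real_derivative (real n + 1) * (1 + x) ^ n) (at x)"
  by (rule derivative_eq_intros refl | simp del: power_Suc)+

lemma DERIV_one_minus_power:
  "((\<lambda>x::real. (1 - x) ^ Suc n) has_real_derivative - ((real n + 1) * (1 - x) ^ n)) (at x)"
  by (rule derivative_eq_intros refl | simp del: power_Suc)+

lemma psi_0 [simp]: "psi q 0 = 1"
  by (simp add: psi_def)

lemma psi_1: "psi (Suc n) 1 = 2 ^ n"
  by (simp add: psi_def)

lemma psi_minus [simp]: "psi q (- x) = psi q x"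
  by (simp add: psi_def)

text \<open>The difference of the two sides vanishes at \<open>a = 0\<close> and \<open>a = 1\<close>, and its derivative has the
  sign of \<open>N (\<theta> * a) / N a - l\<close>; this ratio increases with \<open>a\<close>, so the sign changes at most once,
  from negative to positive.\<close>

lemma two_point_power:
  assumes q: "2 \<le> q" and \<theta>: "0 \<le> \<theta>" "\<theta> < 1" and a: "0 \<le> a" "a \<le> 1"
    and lam: "ln (psi q \<theta>) = l * ln (psi q 1)" "0 \<le> l"
  shows "ln (psi q (\<theta> * a)) \<le> l * ln (psi q a)"
proof (cases "\<theta> = 0")
  case True
  then show ?thesis using psi_ge_1[of a q] a lam(2) by simp
next
  case False
  then have \<theta>0: "0 < \<theta>" using \<theta> by simp
  define t where "t = q - 2"
  have qt: "q = Suc (Suc t)" using q by (simp add: t_def)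
  define K where "K = (\<lambda>x::real. (1 + x) ^ Suc t - (1 - x) ^ Suc t)"
  define N where "N = (\<lambda>x. x * K x / ((1 + x) ^ q + (1 - x) ^ q))"
  have psi_pos: "0 < psi q x" if "\<bar>x\<bar> \<le> 1" for x
    using psi_ge_1[OF that, of q] by linarith
  have Kpos: "0 < K x" if "0 < x" "x < 1" for x
    unfolding K_def using that by (simp only: diff_gt_0_iff_gt) (intro power_strict_mono; simp)
  have Npos: "0 < N x" if "0 < x" "x < 1" for x
    unfolding N_def using that Kpos[OF that] by (intro divide_pos_pos mult_pos_pos add_pos_pos) auto
  have dpsi: "(psi q has_real_derivative real q * K x / 2) (at x)" for x
  proof -
    have "(psi q has_real_derivative
      ((real (Suc t) + 1) * (1 + x) ^ Suc t + - ((real (Suc t) + 1) * (1 - x) ^ Suc t)) / 2) (at x)"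
      unfolding psi_def[abs_def] qt
      by (intro DERIV_cdivide DERIV_add DERIV_one_plus_power DERIV_one_minus_power)
    then show ?thesis by (simp add: K_def qt algebra_simps del: power_Suc)
  qed
  have dlnpsi: "((\<lambda>x. ln (psi q x)) has_real_derivative real q * N x / x) (at x)" if "0 < x" "x < 1" for x
  proof -
    have "((\<lambda>x. ln (psi q x)) has_real_derivative 1 / psi q x * (real q * K x / 2)) (at x)"
      using that by (intro DERIV_chain2[OF DERIV_ln_divide dpsi] psi_pos) auto
    moreover have "1 / (s / 2) * (c * y / 2) = c * (x * y / s) / x" for c y s
      using that by simp
    ultimately show ?thesis by (simp only: N_def psi_def)
  qed
  define e where "e = (\<lambda>x::real. ((1 + x) ^ Suc t + (1 - x) ^ Suc t) / ((1 + x) ^ (Suc (Suc t)) + (1 - x) ^ (Suc (Suc t)))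
     + 4 * (real t + 1) * x * ((1 + x) * (1 - x)) ^ t /
       (((1 + x) ^ Suc t - (1 - x) ^ Suc t) * ((1 + x) ^ (Suc (Suc t)) + (1 - x) ^ (Suc (Suc t)))))"
  have dlnN: "((\<lambda>x. ln (N x)) has_real_derivative e x / x) (at x)" if x: "0 < x" "x < 1" for x
  proof -
    define X Y where "X = (1 + x) ^ t" "Y = (1 - x) ^ t"
    define Q where "Q = (1 + x) ^ 2 * X + (1 - x) ^ 2 * Y"
    define k where "k = (1 + x) * X - (1 - x) * Y"
    have Qpos: "0 < Q" unfolding Q_def X_Y_def using x by (intro add_pos_pos mult_pos_pos) auto
    have kpos: "0 < k" using Kpos[OF x] by (simp add: K_def k_def X_Y_def)
    have Qe: "(1 + x) ^ q + (1 - x) ^ q = Q"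
      by (simp add: qt Q_def X_Y_def power2_eq_square mult.assoc)
    have Ke: "K x = k" by (simp add: K_def k_def X_Y_def)
    have dK: "(K has_real_derivative (real t + 1) * (X + Y)) (at x)"
    proof -
      have "(K has_real_derivative (real t + 1) * (1 + x) ^ t - - ((real t + 1) * (1 - x) ^ t)) (at x)"
        unfolding K_def by (intro DERIV_diff DERIV_one_plus_power DERIV_one_minus_power)
      then show ?thesis by (simp add: X_Y_def algebra_simps)
    qed
    have dQ: "((\<lambda>x. (1 + x) ^ q + (1 - x) ^ q) has_real_derivative (real t + 2) * k) (at x)"
    proof -
      have "((\<lambda>x. (1 + x) ^ q + (1 - x) ^ q) has_real_derivative
        (real (Suc t) + 1) * (1 + x) ^ Suc t + - ((real (Suc t) + 1) * (1 - x) ^ Suc t)) (at x)"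
        unfolding qt by (intro DERIV_add DERIV_one_plus_power DERIV_one_minus_power)
      then show ?thesis by (simp add: k_def X_Y_def algebra_simps)
    qed
    have "((\<lambda>x. ln x + ln (K x) - ln ((1 + x) ^ q + (1 - x) ^ q)) has_real_derivative
       1 / x + 1 / k * ((real t + 1) * (X + Y)) - 1 / Q * ((real t + 2) * k)) (at x)"
      using x Qpos kpos Qe Ke
      by (intro derivative_intros DERIV_ln_divide DERIV_chain2[OF DERIV_ln_divide dK, unfolded Ke]
           DERIV_chain2[OF DERIV_ln_divide dQ, unfolded Qe]) auto
    moreover have "1 / x + 1 / k * ((real t + 1) * (X + Y)) - 1 / Q * ((real t + 2) * k) = e x / x"
    proof -
      have ex: "e x = ((1 + x) * X + (1 - x) * Y) / Q + 4 * (real t + 1) * x * (X * Y) / (k * Q)"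
        by (simp add: e_def Q_def k_def X_Y_def power_add power2_eq_square power_mult_distrib mult_ac)
      \<comment> \<open>Clearing the denominator \<open>x * k * Q\<close> leaves a polynomial
        identity in x, t, X and Y.\<close>
      have "k * Q + x * (real t + 1) * (X + Y) * Q - (real t + 2) * x * k * k
        = ((1 + x) * X + (1 - x) * Y) * k + 4 * (real t + 1) * x * (X * Y)"
        unfolding Q_def k_def by (simp add: algebra_simps power2_eq_square)
      then have "(k * Q + x * (real t + 1) * (X + Y) * Q - (real t + 2) * x * k * k) / (x * k * Q)
        = (((1 + x) * X + (1 - x) * Y) * k + 4 * (real t + 1) * x * (X * Y)) / (x * k * Q)"
        by simp
      then show ?thesis
        unfolding ex using x Qpos kpos by (simp add: add_divide_distrib diff_divide_distrib mult.commute[of Q x])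
    qed
    ultimately have D: "((\<lambda>x. ln x + ln (K x) - ln ((1 + x) ^ q + (1 - x) ^ q)) has_real_derivative e x / x) (at x)"
      by simp
    show ?thesis
    proof (rule DERIV_cong_ev[THEN iffD1, OF refl _ refl D])
      have "eventually (\<lambda>x. x \<in> {0<..<1}) (nhds x)"
        using x by (intro eventually_nhds_in_open) auto
      then show "\<forall>\<^sub>F x in nhds x. ln x + ln (K x) - ln ((1 + x) ^ q + (1 - x) ^ q) = ln (N x)"
      proof eventually_elim
        case (elim y)
        then have "0 < y" "0 < K y" "0 < (1 + y) ^ q + (1 - y) ^ q" using Kpos by (auto intro!: add_pos_pos)
        then show ?case by (simp add: N_def ln_mult ln_div)
      qed
    qed
  qed
  \<comment> \<open>The logarithm of the ratio has derivative (e(\<theta> z) - e(z)) / z, which is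
    nonnegative because e is nonincreasing and \<theta> z <= z.\<close>
  have kappa: "N (\<theta> * x) / N x \<le> N (\<theta> * y) / N y" if xy: "0 < x" "x < y" "y < 1" for x y
  proof -
    have t1: "0 < \<theta> * z" "\<theta> * z < 1" "\<theta> * z \<le> z" if "0 < z" "z < 1" for z
    proof -
      show "0 < \<theta> * z" "\<theta> * z \<le> z" using \<theta>0 \<theta> that by (auto simp: mult_le_cancel_right1)
      then show "\<theta> * z < 1" using that by linarith
    qed
    have "ln (N (\<theta> * x)) - ln (N x) \<le> ln (N (\<theta> * y)) - ln (N y)"
    proof (rule DERIV_nonneg_imp_nondecreasing[where f = "\<lambda>z. ln (N (\<theta> * z)) - ln (N z)"])
      fix z assume "x \<le> z" "z \<le> y"
      then have z: "0 < z" "z < 1" using xy by auto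
      have "((\<lambda>z. ln (N (\<theta> * z))) has_real_derivative e (\<theta> * z) / (\<theta> * z) * \<theta>) (at z)"
        by (rule DERIV_chain2[OF dlnN DERIV_cmult_Id]) (use t1[OF z] in auto)
      from DERIV_diff[OF this dlnN[OF z]]
      have "((\<lambda>z. ln (N (\<theta> * z)) - ln (N z)) has_real_derivative e (\<theta> * z) / (\<theta> * z) * \<theta> - e z / z) (at z)" .
      moreover have "e (\<theta> * z) / (\<theta> * z) * \<theta> - e z / z = (e (\<theta> * z) - e z) / z"
        using \<theta>0 z by (simp add: diff_divide_distrib)
      moreover have "e z \<le> e (\<theta> * z)"
        unfolding e_def by (rule log_slope_mono) (use t1[OF z] z in auto)
      then have "0 \<le> (e (\<theta> * z) - e z) / z" using z by simp
      ultimately show "\<exists>D. ((\<lambda>z. ln (N (\<theta> * z)) - ln (N z)) has_real_derivative D) (at z) \<and> 0 \<le> D"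
        by (simp only:) blast
    qed (use xy in simp)
    moreover have pos: "0 < N x" "0 < N y" "0 < N (\<theta> * x)" "0 < N (\<theta> * y)"
      by (rule Npos; use t1[of x] t1[of y] xy in simp)+
    ultimately have "ln (N (\<theta> * x) / N x) \<le> ln (N (\<theta> * y) / N y)"
      by (simp add: ln_div)
    then show ?thesis
      using pos by (subst (asm) ln_le_cancel_iff) auto
  qed
  define h where "h = (\<lambda>x. ln (psi q (\<theta> * x)) - l * ln (psi q x))"
  define h' where "h' = (\<lambda>x. real q * (N (\<theta> * x) - l * N x) / x)"
  have tx: "\<bar>\<theta> * x\<bar> \<le> 1" if "0 \<le> x" "x \<le> 1" for x
    using \<theta> that by (simp add: abs_mult mult_le_one)
  have "h a \<le> 0"
  proof (rule sign_change_le_zero[OF _ _ _ _ _ a])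
    show "continuous_on {0..1} h"
      unfolding h_def psi_def[abs_def]
      using psi_pos tx by (intro continuous_intros) (auto simp: psi_def less_imp_neq[symmetric])
    show "h 0 = 0" "h 1 = 0" using lam(1) by (auto simp: h_def)
    fix x :: real assume x: "0 < x" "x < 1"
    have tz: "0 < \<theta> * x" "\<theta> * x < 1" using \<theta>0 \<theta> x mult_strict_mono[of \<theta> 1 x 1] by auto
    have "(h has_real_derivative real q * N (\<theta> * x) / (\<theta> * x) * \<theta> - l * (real q * N x / x)) (at x)"
      unfolding h_def
      by (intro DERIV_diff DERIV_cmult dlnpsi x DERIV_chain2[OF dlnpsi[OF tz] DERIV_cmult_Id])
    moreover have "real q * N (\<theta> * x) / (\<theta> * x) * \<theta> - l * (real q * N x / x) = h' x"
      using \<theta>0 x by (simp add: h'_def field_simps)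
    ultimately show "(h has_real_derivative h' x) (at x)" by simp
  next
    fix x y :: real assume xy: "0 < x" "x < y" "y < 1" "0 < h' x"
    have "0 < N (\<theta> * x) - l * N x"
      using xy q by (simp add: h'_def zero_less_mult_iff zero_less_divide_iff)
    then have "l < N (\<theta> * x) / N x" using Npos[of x] xy by (simp add: field_simps)
    also have "\<dots> \<le> N (\<theta> * y) / N y" using kappa xy by simp
    finally have "0 \<le> N (\<theta> * y) - l * N y" using Npos[of y] xy by (simp add: field_simps)
    then show "0 \<le> h' y" using xy by (simp add: h'_def)
  qed
  then show ?thesis by (simp add: h_def)
qed

section \<open>Two-point inequalities for the maximum and for x ln x\<close>

lemma bernoulli_powr:
  fixes t l :: real
  assumes "0 \<le> t" "0 \<le> l" "l \<le> 1"
  shows "t powr l \<le> l * t + (1 - l)"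
proof (cases "t = 0")
  case False
  then show ?thesis
    using Youngs_inequality_0[of l "1 - l" t 1] assms by simp
qed (use assms in simp)

text \<open>Jensen's inequality for the concave power \<open>t powr l\<close> at the points 1 and 2
  with weights 1 - a and a: the mean is 1 + a, the mean of the values is 1 + \<theta> a.
  \<open>bernoulli_powr\<close> supplies the tangent at 1 + a.\<close>

lemma one_plus_le_powr:
  fixes a l \<theta> :: real
  assumes \<theta>: "1 + \<theta> = 2 powr l" and l: "0 \<le> l" "l \<le> 1" and a: "0 \<le> a" "a \<le> 1"
  shows "1 + \<theta> * a \<le> (1 + a) powr l"
proof -
  define c where "c = (1 + a) powr l"
  have c: "0 < c" using a by (simp add: c_def)
  have "1 / c \<le> l * (1 / (1 + a)) + (1 - l)"
    using bernoulli_powr[of "1 / (1 + a)" l] a l by (simp add: c_def powr_divide)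
  then have 1: "(1 - a) * (1 / c) \<le> (1 - a) * (l * (1 / (1 + a)) + (1 - l))"
    using a by (intro mult_left_mono) auto
  have "(1 + \<theta>) / c \<le> l * (2 / (1 + a)) + (1 - l)"
    using bernoulli_powr[of "2 / (1 + a)" l] a l by (simp add: c_def powr_divide \<theta>)
  then have 2: "a * ((1 + \<theta>) / c) \<le> a * (l * (2 / (1 + a)) + (1 - l))"
    using a by (intro mult_left_mono) auto
  have "(1 + \<theta> * a) / c = (1 - a) * (1 / c) + a * ((1 + \<theta>) / c)"
    by (simp add: algebra_simps diff_divide_distrib add_divide_distrib)
  also have "\<dots> \<le> (1 - a) * (l * (1 / (1 + a)) + (1 - l)) + a * (l * (2 / (1 + a)) + (1 - l))"
    using 1 2 by linarith
  also have "\<dots> = l * ((1 + a) * (1 / (1 + a))) + (1 - l)"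
  proof -
    have "(1 - a) * (l * u + (1 - l)) + a * (l * (2 * u) + (1 - l)) = l * ((1 + a) * u) + (1 - l)" for u
      by (simp add: algebra_simps)
    moreover have "2 / (1 + a) = 2 * (1 / (1 + a))" by simp
    ultimately show ?thesis by (simp only:)
  qed
  also have "\<dots> = 1" using a by simp
  finally show ?thesis using c by (simp add: c_def)
qed

text \<open>The relative entropy, in nats, of the law ((1 + x)/2, (1 - x)/2) with respect to a fair
  coin.\<close>

definition Psi :: "real \<Rightarrow> real" where
  "Psi x = ((1 + x) * ln (1 + x) + (1 - x) * ln (1 - x)) / 2"

lemma Psi_minus [simp]: "Psi (- x) = Psi x"
  by (simp add: Psi_def)

lemma Psi_0 [simp]: "Psi 0 = 0"
  by (simp add: Psi_def)

text \<open>The difference \<open>h\<close> vanishes at 0 with derivative \<theta>/2 times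
  \<open>g\<close>, and \<open>g\<close> vanishes at 0 and increases because 2 / (1 - z^2) does.
  Near 0, Psi behaves like x^2 / 2, so the factor \<theta>^2 cannot be improved.\<close>

lemma Psi_contract_less:
  assumes \<theta>: "0 \<le> \<theta>" "\<theta> < 1" and a: "0 \<le> a" "a < 1"
  shows "Psi (\<theta> * a) \<le> \<theta>\<^sup>2 * Psi a"
proof -
  define h where "h = (\<lambda>x. \<theta>\<^sup>2 * Psi x - Psi (\<theta> * x))"
  define g where "g = (\<lambda>x. \<theta> * (ln (1 + x) - ln (1 - x)) - (ln (1 + \<theta> * x) - ln (1 - \<theta> * x)))"
  have tx: "0 \<le> \<theta> * x" "\<theta> * x < 1" if "0 \<le> x" "x < 1" for x
    using \<theta> that mult_mono[of \<theta> 1 x x] by auto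
  have "g 0 \<le> g x" if x: "0 \<le> x" "x < 1" for x
  proof (rule DERIV_nonneg_imp_nondecreasing[where f = g])
    fix y assume "0 \<le> y" "y \<le> x"
    then have y: "0 \<le> y" "y < 1" using x by auto
    have "(g has_real_derivative \<theta> * (1 / (1 + y) + 1 / (1 - y)) - (\<theta> / (1 + \<theta> * y) + \<theta> / (1 - \<theta> * y))) (at y)"
      unfolding g_def using y tx[OF y] by (auto intro!: derivative_eq_intros)
    moreover have "1 / (1 + \<theta> * y) + 1 / (1 - \<theta> * y) \<le> 1 / (1 + y) + 1 / (1 - y)"
    proof -
      have e: "1 / (1 + z) + 1 / (1 - z) = 2 / (1 - z * z)" if "0 \<le> z" "z < 1" for z :: real
      proof -
        have "1 - z * z = (1 + z) * (1 - z)" by (simp add: algebra_simps)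
        then show ?thesis using that by (simp add: field_simps)
      qed
      have "\<theta> * y \<le> y" using \<theta> y by (simp add: mult_left_le_one_le)
      then have "\<theta> * y * (\<theta> * y) \<le> y * y" using tx[OF y] by (intro mult_mono) auto
      moreover have "y * y < 1" using y mult_strict_mono[of y 1 y 1] by auto
      ultimately have "2 / (1 - \<theta> * y * (\<theta> * y)) \<le> 2 / (1 - y * y)" by (intro divide_left_mono) auto
      then show ?thesis using e[OF y] e[OF tx[OF y]] by simp
    qed
    then have "\<theta> * (1 / (1 + \<theta> * y) + 1 / (1 - \<theta> * y)) \<le> \<theta> * (1 / (1 + y) + 1 / (1 - y))"
      using \<theta> by (intro mult_left_mono) auto
    then have "0 \<le> \<theta> * (1 / (1 + y) + 1 / (1 - y)) - (\<theta> / (1 + \<theta> * y) + \<theta> / (1 - \<theta> * y))"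
      by (simp add: distrib_left)
    ultimately show "\<exists>D. (g has_real_derivative D) (at y) \<and> 0 \<le> D" by blast
  qed (use x in auto)
  then have g: "0 \<le> g x" if "0 \<le> x" "x < 1" for x using that by (simp add: g_def)
  have dPsi: "(Psi has_real_derivative (ln (1 + x) - ln (1 - x)) / 2) (at x)" if "0 \<le> x" "x < 1" for x
    unfolding Psi_def[abs_def] using that by (auto intro!: derivative_eq_intros)
  have "h 0 \<le> h a"
  proof (rule DERIV_nonneg_imp_nondecreasing[where f = h])
    fix y assume "0 \<le> y" "y \<le> a"
    then have y: "0 \<le> y" "y < 1" using a by auto
    have "((\<lambda>x. Psi (\<theta> * x)) has_real_derivative (ln (1 + \<theta> * y) - ln (1 - \<theta> * y)) / 2 * \<theta>) (at y)"
      by (rule DERIV_chain2[OF dPsi DERIV_cmult_Id]) (use tx[OF y] in auto)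
    from DERIV_diff[OF DERIV_cmult[OF dPsi[OF y], of "\<theta>\<^sup>2"] this]
    have "(h has_real_derivative \<theta>\<^sup>2 * ((ln (1 + y) - ln (1 - y)) / 2) - (ln (1 + \<theta> * y) - ln (1 - \<theta> * y)) / 2 * \<theta>) (at y)"
      unfolding h_def .
    moreover have "\<theta>\<^sup>2 * ((ln (1 + y) - ln (1 - y)) / 2) - (ln (1 + \<theta> * y) - ln (1 - \<theta> * y)) / 2 * \<theta> = \<theta> / 2 * g y"
      by (simp add: g_def power2_eq_square field_simps)
    moreover have "0 \<le> \<theta> / 2 * g y" using \<theta> g[OF y] by simp
    ultimately show "\<exists>D. (h has_real_derivative D) (at y) \<and> 0 \<le> D" by metis
  qed (use a in auto)
  then show ?thesis by (simp add: h_def)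
qed

text \<open>The endpoint a = 1, where ln (1 - a) is singular, is reached by a limit: \<theta> < 1
  keeps the left-hand side continuous, and Psi stays below its endpoint value ln 2.\<close>

lemma Psi_contract:
  assumes \<theta>: "0 \<le> \<theta>" "\<theta> < 1" and a: "0 \<le> a" "a \<le> 1"
  shows "Psi (\<theta> * a) \<le> \<theta>\<^sup>2 * Psi a"
proof (cases "a = 1")
  case True
  have "Psi x \<le> ln 2" if "0 \<le> x" "x < 1" for x
  proof -
    have "(1 + x) * ln (1 + x) \<le> 2 * ln 2" using that by (intro mult_mono) auto
    moreover have "(1 - x) * ln (1 - x) \<le> 0" using that by (intro mult_nonneg_nonpos) auto
    ultimately show ?thesis by (simp add: Psi_def)
  qed
  then have bd: "Psi (\<theta> * x) \<le> \<theta>\<^sup>2 * ln 2" if "0 \<le> x" "x < 1" for x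
    using Psi_contract_less[OF \<theta> that] that by (meson mult_left_mono order_trans zero_le_power2)
  have "isCont (\<lambda>x. Psi (\<theta> * x)) 1"
    unfolding Psi_def using \<theta> by (auto intro!: continuous_intros)
  then have lim: "((\<lambda>x. Psi (\<theta> * x)) \<longlongrightarrow> Psi (\<theta> * 1)) (at_left 1)"
    unfolding isCont_def by (rule tendsto_within_subset) simp
  have "eventually (\<lambda>x::real. 0 \<le> x \<and> x < 1) (at_left 1)"
    using eventually_at_left_real[of 0 "1::real"] by (rule eventually_mono) auto
  then have "eventually (\<lambda>x. Psi (\<theta> * x) \<le> \<theta>\<^sup>2 * ln 2) (at_left 1)"
    by (rule eventually_mono) (use bd in auto)
  then have "Psi (\<theta> * 1) \<le> \<theta>\<^sup>2 * ln 2"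
    by (rule tendsto_upperbound[OF lim]) simp
  then show ?thesis using True by (simp add: Psi_def)
qed (use Psi_contract_less[OF \<theta>] a in auto)

text \<open>In terms of the mean m and the relative difference x of a pair, a bit flip keeps m and
  multiplies x by 1 - 2\<delta>; this reduces the inequalities to one variable.\<close>

lemma pair_params:
  fixes a0 a1 \<delta> :: real
  assumes "0 \<le> a0" "0 \<le> a1" "0 < a0 + a1"
  obtains m x where "0 < m" "\<bar>x\<bar> \<le> 1" "m = (a0 + a1) / 2" "a0 = m * (1 + x)" "a1 = m * (1 - x)"
    "(1 - \<delta>) * a0 + \<delta> * a1 = m * (1 + (1 - 2 * \<delta>) * x)" "(1 - \<delta>) * a1 + \<delta> * a0 = m * (1 - (1 - 2 * \<delta>) * x)"
proof
  define m x where "m = (a0 + a1) / 2" "x = (a0 - a1) / (a0 + a1)"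
  note defs = this
  show "0 < m" using assms by (simp add: defs)
  show "\<bar>x\<bar> \<le> 1" using assms by (simp add: defs abs_le_iff divide_le_eq)
  show "m = (a0 + a1) / 2" by (simp add: defs)
  have "m * x = (a0 + a1) / (a0 + a1) * ((a0 - a1) / 2)"
  proof -
    have "s / 2 * (d / s) = s / s * (d / 2)" for s d :: real by simp
    then show ?thesis unfolding defs .
  qed
  then have mx: "m * x = (a0 - a1) / 2" using assms by simp
  show a: "a0 = m * (1 + x)" "a1 = m * (1 - x)"
    by (simp_all add: distrib_left right_diff_distrib mx) (simp_all add: defs field_simps)
  show "(1 - \<delta>) * a0 + \<delta> * a1 = m * (1 + (1 - 2 * \<delta>) * x)"
    "(1 - \<delta>) * a1 + \<delta> * a0 = m * (1 - (1 - 2 * \<delta>) * x)"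
    unfolding a by (simp_all add: algebra_simps)
qed

lemma psi_contract_powr:
  assumes q: "2 \<le> q" and \<theta>: "\<bar>\<theta>\<bar> < 1" and x: "\<bar>x\<bar> \<le> 1"
    and lam: "ln (psi q \<theta>) = l * ln (psi q 1)" "0 \<le> l"
  shows "psi q (\<theta> * x) \<le> psi q x powr l"
proof -
  have abs: "psi q \<bar>y\<bar> = psi q y" for y by (cases "0 \<le> y") auto
  have "ln (psi q (\<bar>\<theta>\<bar> * \<bar>x\<bar>)) \<le> l * ln (psi q \<bar>x\<bar>)"
    using assms by (intro two_point_power) (auto simp: abs)
  then have ln: "ln (psi q (\<theta> * x)) \<le> l * ln (psi q x)"
    by (simp add: abs flip: abs_mult)
  have "\<bar>\<theta> * x\<bar> \<le> 1" using \<theta> x by (simp add: abs_mult mult_le_one)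
  then have pos: "0 < psi q (\<theta> * x)" "0 < psi q x"
    using psi_ge_1[of "\<theta> * x" q] psi_ge_1[OF x, of q] by linarith+
  have "psi q (\<theta> * x) = exp (ln (psi q (\<theta> * x)))" using pos by simp
  also have "\<dots> \<le> exp (l * ln (psi q x))" using ln by simp
  also have "\<dots> = psi q x powr l" using pos by (simp add: powr_def)
  finally show ?thesis .
qed

text \<open>By homogeneity the factor m^q splits into its powers l and 1 - l, which gives the
  geometric mean required by Hoelder's inequality.\<close>

lemma pair_power:
  fixes a0 a1 \<delta> l :: real
  assumes q: "2 \<le> q" and a: "0 \<le> a0" "0 \<le> a1" and \<delta>: "0 < \<delta>" "\<delta> < 1"
    and lam: "ln (psi q (1 - 2 * \<delta>)) = l * ln (psi q 1)" "0 \<le> l"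
  shows "(((1 - \<delta>) * a0 + \<delta> * a1) ^ q + ((1 - \<delta>) * a1 + \<delta> * a0) ^ q) / 2
    \<le> ((a0 ^ q + a1 ^ q) / 2) powr l * (((a0 + a1) / 2) ^ q) powr (1 - l)"
proof (cases "a0 + a1 = 0")
  case True
  then have "a0 = 0" "a1 = 0" using a by auto
  then show ?thesis using q by (simp add: power_0_left)
next
  case False
  then have "0 < a0 + a1" using a by simp
  then obtain m x where m: "0 < m" "\<bar>x\<bar> \<le> 1" "m = (a0 + a1) / 2" "a0 = m * (1 + x)" "a1 = m * (1 - x)"
    "(1 - \<delta>) * a0 + \<delta> * a1 = m * (1 + (1 - 2 * \<delta>) * x)" "(1 - \<delta>) * a1 + \<delta> * a0 = m * (1 - (1 - 2 * \<delta>) * x)"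
    using pair_params[OF a] by blast
  have e: "((m * (1 + y)) ^ q + (m * (1 - y)) ^ q) / 2 = m ^ q * psi q y" for y
    unfolding psi_def power_mult_distrib by (simp add: algebra_simps)
  have "m ^ q * psi q ((1 - 2 * \<delta>) * x) \<le> m ^ q * psi q x powr l"
    using m(1,2) \<delta> by (intro mult_left_mono psi_contract_powr q lam) auto
  also have "\<dots> = (m ^ q * psi q x) powr l * (m ^ q) powr (1 - l)"
  proof -
    have 1: "(m ^ q) powr l * (m ^ q) powr (1 - l) = m ^ q"
      using m(1) by (simp flip: powr_add)
    have "(m ^ q * psi q x) powr l = (m ^ q) powr l * psi q x powr l"
      by (rule powr_mult)
    then have "(m ^ q * psi q x) powr l * (m ^ q) powr (1 - l)
        = (m ^ q) powr l * (m ^ q) powr (1 - l) * psi q x powr l"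
      by (simp only: mult_ac)
    then show ?thesis unfolding 1 by (rule sym)
  qed
  also have "m ^ q * psi q x = (a0 ^ q + a1 ^ q) / 2" unfolding e[symmetric] m(4,5)[symmetric] ..
  finally show ?thesis unfolding m(6,7) e m(3)[symmetric] .
qed

lemma pair_xlogx:
  fixes a0 a1 \<delta> :: real
  assumes a: "0 \<le> a0" "0 \<le> a1" and \<delta>: "0 < \<delta>" "\<delta> < 1"
  defines "\<phi> \<equiv> \<lambda>t::real. t * ln t"
  shows "(\<phi> ((1 - \<delta>) * a0 + \<delta> * a1) + \<phi> ((1 - \<delta>) * a1 + \<delta> * a0)) / 2
    \<le> (1 - 2 * \<delta>)\<^sup>2 * ((\<phi> a0 + \<phi> a1) / 2) + (1 - (1 - 2 * \<delta>)\<^sup>2) * \<phi> ((a0 + a1) / 2)"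
proof (cases "a0 + a1 = 0")
  case True
  then have "a0 = 0" "a1 = 0" using a by auto
  then show ?thesis by (simp add: \<phi>_def)
next
  case False
  then have "0 < a0 + a1" using a by simp
  then obtain m x where m: "0 < m" "\<bar>x\<bar> \<le> 1" "m = (a0 + a1) / 2" "a0 = m * (1 + x)" "a1 = m * (1 - x)"
    "(1 - \<delta>) * a0 + \<delta> * a1 = m * (1 + (1 - 2 * \<delta>) * x)" "(1 - \<delta>) * a1 + \<delta> * a0 = m * (1 - (1 - 2 * \<delta>) * x)"
    using pair_params[OF a] by blast
  let ?\<theta> = "1 - 2 * \<delta>"
  \<comment> \<open>Scaling by m adds a term linear in t, whose mean over a pair depends on m only;
    as the weights l and 1 - l add up to 1, it cancels from both sides.\<close>
  have \<phi>1: "\<phi> (m * t) = t * (m * ln m) + m * (t * ln t)" if "0 \<le> t" for t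
    using that m(1) by (cases "t = 0") (auto simp: \<phi>_def ln_mult algebra_simps)
  have e: "(\<phi> (m * (1 + y)) + \<phi> (m * (1 - y))) / 2 = \<phi> m + m * Psi y" if "\<bar>y\<bar> \<le> 1" for y
  proof -
    have "\<phi> (m * (1 + y)) = (1 + y) * (m * ln m) + m * ((1 + y) * ln (1 + y))"
      "\<phi> (m * (1 - y)) = (1 - y) * (m * ln m) + m * ((1 - y) * ln (1 - y))"
      by (rule \<phi>1; use that in simp)+
    moreover have "2 * Psi y = (1 + y) * ln (1 + y) + (1 - y) * ln (1 - y)"
      by (simp add: Psi_def)
    ultimately have "\<phi> (m * (1 + y)) + \<phi> (m * (1 - y)) = 2 * (m * ln m) + m * (2 * Psi y)"
      by (simp only:) (simp add: algebra_simps)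
    then show ?thesis by (simp add: \<phi>_def)
  qed
  have \<theta>x: "\<bar>?\<theta> * x\<bar> \<le> 1" using \<delta> m(2) by (simp add: abs_mult mult_le_one)
  have abs: "Psi \<bar>y\<bar> = Psi y" for y by (cases "0 \<le> y") auto
  have "Psi (\<bar>?\<theta>\<bar> * \<bar>x\<bar>) \<le> \<bar>?\<theta>\<bar>\<^sup>2 * Psi \<bar>x\<bar>"
    using \<delta> m(2) by (intro Psi_contract) auto
  then have "Psi (?\<theta> * x) \<le> ?\<theta>\<^sup>2 * Psi x"
    by (simp only: abs power2_abs flip: abs_mult)
  then have "m * Psi (?\<theta> * x) \<le> m * (?\<theta>\<^sup>2 * Psi x)" using m(1) by (intro mult_left_mono) auto
  moreover have "?\<theta>\<^sup>2 * (\<phi> m + m * Psi x) + (1 - ?\<theta>\<^sup>2) * \<phi> m = \<phi> m + m * (?\<theta>\<^sup>2 * Psi x)"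
    by (simp add: algebra_simps)
  ultimately show ?thesis
    unfolding m(6,7) e[OF \<theta>x] m(3)[symmetric] unfolding m(4,5) e[OF m(2)] by linarith
qed

lemma pair_max:
  fixes a0 a1 \<delta> l :: real
  assumes a: "0 \<le> a0" "0 \<le> a1" and \<delta>: "0 < \<delta>" "\<delta> < 1"
    and lam: "1 + \<bar>1 - 2 * \<delta>\<bar> = 2 powr l" "0 \<le> l" "l \<le> 1"
  shows "(1 - \<delta>) * a0 + \<delta> * a1 \<le> (max a0 a1) powr l * ((a0 + a1) / 2) powr (1 - l)"
proof (cases "a0 + a1 = 0")
  case True
  then have "a0 = 0" "a1 = 0" using a by auto
  then show ?thesis by simp
next
  case False
  then have "0 < a0 + a1" using a by simp
  then obtain m x where m: "0 < m" "\<bar>x\<bar> \<le> 1" "m = (a0 + a1) / 2" "a0 = m * (1 + x)" "a1 = m * (1 - x)"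
    "(1 - \<delta>) * a0 + \<delta> * a1 = m * (1 + (1 - 2 * \<delta>) * x)"
    using pair_params[OF a] by blast
  let ?\<theta> = "1 - 2 * \<delta>"
  have mx: "max a0 a1 = m * (1 + \<bar>x\<bar>)"
    unfolding m(4,5) using m(1) by (auto simp: max_def abs_if)
  have "1 + ?\<theta> * x \<le> 1 + \<bar>?\<theta>\<bar> * \<bar>x\<bar>" by (simp flip: abs_mult)
  also have "\<dots> \<le> (1 + \<bar>x\<bar>) powr l" using lam m(2) by (intro one_plus_le_powr) auto
  finally have "m * (1 + ?\<theta> * x) \<le> m * (1 + \<bar>x\<bar>) powr l" using m(1) by (intro mult_left_mono) auto
  also have "\<dots> = (m * (1 + \<bar>x\<bar>)) powr l * m powr (1 - l)"
  proof -
    have 1: "m powr l * m powr (1 - l) = m" using m(1) by (simp flip: powr_add)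
    have "(m * (1 + \<bar>x\<bar>)) powr l = m powr l * (1 + \<bar>x\<bar>) powr l"
      by (rule powr_mult)
    then have "(m * (1 + \<bar>x\<bar>)) powr l * m powr (1 - l) = m powr l * m powr (1 - l) * (1 + \<bar>x\<bar>) powr l"
      by (simp only: mult_ac)
    then show ?thesis unfolding 1 by (rule sym)
  qed
  finally show ?thesis unfolding m(6) mx m(3)[symmetric] .
qed

section \<open>From noise to erasures\<close>

text \<open>The rate depends on the coordinate in order to allow hybrids: rate 0 keeps a coordinate,
  and rate 1/2 averages it out, which amounts to an erasure.\<close>

definition noise :: "nat set \<Rightarrow> (nat \<Rightarrow> real) \<Rightarrow> (nat set \<Rightarrow> real) \<Rightarrow> nat set \<Rightarrow> real" where
  "noise I \<epsilon> f x = bexp I \<epsilon> (\<lambda>z. f (sym_diff x z))"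

abbreviation avg :: "nat set \<Rightarrow> (nat set \<Rightarrow> real) \<Rightarrow> real" where
  "avg I \<equiv> bexp I (\<lambda>_. 1/2)"

definition flip_mix :: "nat \<Rightarrow> real \<Rightarrow> (nat set \<Rightarrow> real) \<Rightarrow> nat set \<Rightarrow> real" where
  "flip_mix i p g x = (1 - p) * g x + p * g (sym_diff x {i})"

lemma noise_upd:
  assumes "finite I" "i \<in> I"
  shows "noise I (\<epsilon>(i := p)) f = flip_mix i p (noise I (\<epsilon>(i := 0)) f)"
proof (rule ext)
  fix x
  let ?J = "I - {i}"
  have I: "I = insert i ?J" and J: "finite ?J" "i \<notin> ?J" using assms by auto
  have ins: "bexp ?J \<epsilon> (\<lambda>S. f (sym_diff x (insert i S))) = bexp ?J \<epsilon> (\<lambda>S. f (sym_diff (sym_diff x {i}) S))" for x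
  proof (rule bexp_cong)
    fix S assume "S \<subseteq> ?J"
    then have "sym_diff x (insert i S) = sym_diff (sym_diff x {i}) S" by auto
    then show "f (sym_diff x (insert i S)) = f (sym_diff (sym_diff x {i}) S)" by simp
  qed simp
  have upd: "noise I (\<epsilon>(i := p)) f x = p * bexp ?J \<epsilon> (\<lambda>S. f (sym_diff (sym_diff x {i}) S)) + (1 - p) * bexp ?J \<epsilon> (\<lambda>S. f (sym_diff x S))" for p x
  proof -
    have "noise I (\<epsilon>(i := p)) f x = p * bexp ?J (\<epsilon>(i := p)) (\<lambda>S. f (sym_diff x (insert i S)))
        + (1 - p) * bexp ?J (\<epsilon>(i := p)) (\<lambda>S. f (sym_diff x S))"
      unfolding noise_def by (subst I, subst bexp_insert[OF J]) simp
    moreover have "bexp ?J (\<epsilon>(i := p)) G = bexp ?J \<epsilon> G" for G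
      by (rule bexp_cong) auto
    ultimately show ?thesis by (simp only: ins)
  qed
  show "noise I (\<epsilon>(i := p)) f x = flip_mix i p (noise I (\<epsilon>(i := 0)) f) x"
    unfolding flip_mix_def upd by simp
qed

lemma noise_nonneg:
  assumes "\<And>i. 0 \<le> \<epsilon> i \<and> \<epsilon> i \<le> 1" "\<And>y. 0 \<le> f y"
  shows "0 \<le> noise I \<epsilon> f x"
  unfolding noise_def using assms by (intro bexp_nonneg) auto

lemma avg_noise:
  assumes "finite I"
  shows "avg I (noise I \<epsilon> f) = avg I f"
proof -
  have shift: "(\<Sum>x\<in>Pow I. f (sym_diff x z)) = (\<Sum>x\<in>Pow I. f x)" if "z \<subseteq> I" for z
    by (rule sum.reindex_bij_witness[of _ "\<lambda>x. sym_diff x z" "\<lambda>x. sym_diff x z"])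
       (use that in \<open>auto intro!: arg_cong[where f = f]\<close>)
  have "avg I (noise I \<epsilon> f) = (\<Sum>x\<in>Pow I. bexp I \<epsilon> (\<lambda>z. f (sym_diff x z))) / 2 ^ card I"
    using assms by (simp add: bexp_half noise_def)
  also have "\<dots> = bexp I \<epsilon> (\<lambda>z. \<Sum>x\<in>Pow I. f (sym_diff x z)) / 2 ^ card I"
    by (simp only: bexp_sum)
  also have "bexp I \<epsilon> (\<lambda>z. \<Sum>x\<in>Pow I. f (sym_diff x z)) = bexp I \<epsilon> (\<lambda>z. \<Sum>x\<in>Pow I. f x)"
    by (rule bexp_cong) (simp_all only: shift)
  finally show ?thesis using assms by (simp add: bexp_const bexp_half)
qed

lemma avg_pair:
  assumes "finite I" "i \<in> I"
  shows "avg I G = avg (I - {i}) (\<lambda>y. (G y + G (insert i y)) / 2)"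
proof -
  have "avg I G = avg (insert i (I - {i})) G" using assms by (simp add: insert_absorb)
  also have "\<dots> = avg (I - {i}) (\<lambda>y. (1/2) * (G y + G (insert i y)))"
    using assms bexp_insert[of "I - {i}" i "\<lambda>_. 1/2" G] by (simp only: bexp_cmult bexp_add) simp
  finally show ?thesis by simp
qed

lemma flip_mix_pair:
  assumes "i \<notin> y"
  shows "flip_mix i p g y = (1 - p) * g y + p * g (insert i y)"
    "flip_mix i p g (insert i y) = (1 - p) * g (insert i y) + p * g y"
proof -
  have "sym_diff y {i} = insert i y" "sym_diff (insert i y) {i} = y" using assms by auto
  then show "flip_mix i p g y = (1 - p) * g y + p * g (insert i y)"
    "flip_mix i p g (insert i y) = (1 - p) * g (insert i y) + p * g y"
    unfolding flip_mix_def by simp_all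
qed

text \<open>Coordinates are processed one at a time: the noise rate \<open>\<delta>\<close> is traded for the rate \<open>0\<close>
  (coordinate kept) with weight \<open>l\<close> and for the rate \<open>1/2\<close> (coordinate erased) with weight \<open>1 - l\<close>.\<close>

lemma noise_erasure_le:
  assumes I: "finite I" and \<delta>: "0 \<le> \<delta>" "\<delta> \<le> 1"
    and step: "\<And>g i. i \<in> I \<Longrightarrow> (\<And>x. 0 \<le> g x) \<Longrightarrow> avg I g = 1 \<Longrightarrow>
      \<Phi> (flip_mix i \<delta> g) \<le> l * \<Phi> g + (1 - l) * \<Phi> (flip_mix i (1/2) g)"
    and l: "0 \<le> l" "l \<le> 1" and f: "\<And>x. 0 \<le> f x" "avg I f = 1"
  shows "\<Phi> (noise I (\<lambda>_. \<delta>) f) \<le> bexp I (\<lambda>_. l) (\<lambda>S. \<Phi> (noise I (\<lambda>i. if i \<in> S then 0 else 1/2) f))"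
proof -
  \<comment> \<open>Generalised over the rates off \<open>J\<close>, since the induction uses its
    hypothesis once with \<open>i\<close> kept and once with \<open>i\<close> erased.\<close>
  have gen: "\<Phi> (noise I (\<lambda>i. if i \<in> J then \<delta> else \<epsilon> i) f)
     \<le> bexp J (\<lambda>_. l) (\<lambda>S. \<Phi> (noise I (\<lambda>i. if i \<in> S then 0 else if i \<in> J then 1/2 else \<epsilon> i) f))"
    if "finite J" "J \<subseteq> I" "\<And>i. 0 \<le> \<epsilon> i \<and> \<epsilon> i \<le> 1" for J \<epsilon>
    using that
  proof (induction J arbitrary: \<epsilon>)
    case empty
    then show ?case by simp
  next
    case (insert i J)
    \<comment> \<open>All rates except that of \<open>i\<close> are frozen. With \<open>g\<close>
      the hybrid at rate 0, the hybrid at rate p is the flip of \<open>g\<close> at coordinate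
      \<open>i\<close> with probability p.\<close>
    let ?e = "\<lambda>p k. if k \<in> J then \<delta> else (\<epsilon>(i := p)) k"
    have e: "?e p = (?e 0)(i := p)" for p using insert.hyps by auto
    define g where "g = noise I (?e 0) f"
    have mix: "noise I (?e p) f = flip_mix i p g" for p
    proof -
      have "noise I (?e p) f = noise I ((?e 0)(i := p)) f" by (rule arg_cong2[of _ _ _ _ "noise I"]) (rule e, rule refl)
      also have "\<dots> = flip_mix i p (noise I ((?e 0)(i := 0)) f)"
        using I insert.prems by (intro noise_upd) auto
      also have "(?e 0)(i := 0) = ?e 0" by (rule e[symmetric])
      finally show ?thesis by (simp only: g_def)
    qed
    have g0: "0 \<le> g x" for x
      unfolding g_def using insert.prems(2) \<delta> f(1) by (intro noise_nonneg) auto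
    have g1: "avg I g = 1" unfolding g_def using avg_noise[OF I] f(2) by simp
    have bounds: "0 \<le> (\<epsilon>(i := p)) k \<and> (\<epsilon>(i := p)) k \<le> 1" if "0 \<le> p" "p \<le> 1" for p k
      using insert.prems(2) that by simp
    have "(\<lambda>k. if k \<in> insert i J then \<delta> else \<epsilon> k) = ?e \<delta>" using insert.hyps by auto
    then have "\<Phi> (noise I (\<lambda>k. if k \<in> insert i J then \<delta> else \<epsilon> k) f) = \<Phi> (flip_mix i \<delta> g)"
      using mix[of \<delta>] by (simp only:)
    also have "\<dots> \<le> l * \<Phi> g + (1 - l) * \<Phi> (flip_mix i (1/2) g)"
      using insert.prems by (intro step g0 g1) auto
    also have "\<dots> = l * \<Phi> (noise I (?e 0) f) + (1 - l) * \<Phi> (noise I (?e (1/2)) f)"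
      unfolding mix[of "1/2"] unfolding g_def ..
    also have "\<dots> \<le> l * bexp J (\<lambda>_. l) (\<lambda>S. \<Phi> (noise I (\<lambda>k. if k \<in> S then 0 else if k \<in> J then 1/2 else (\<epsilon>(i := 0)) k) f))
       + (1 - l) * bexp J (\<lambda>_. l) (\<lambda>S. \<Phi> (noise I (\<lambda>k. if k \<in> S then 0 else if k \<in> J then 1/2 else (\<epsilon>(i := 1/2)) k) f))"
      using l insert.prems(1) bounds[of 0] bounds[of "1/2"]
      by (intro add_mono mult_left_mono insert.IH) auto
    also have "\<dots> = bexp (insert i J) (\<lambda>_. l) (\<lambda>S. \<Phi> (noise I (\<lambda>k. if k \<in> S then 0 else if k \<in> insert i J then 1/2 else \<epsilon> k) f))"
    proof -
      have 1: "(\<lambda>k. if k \<in> S then 0 else if k \<in> J then 1/2 else (\<epsilon>(i := 0)) k) =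
          (\<lambda>k. if k \<in> insert i S then 0 else if k \<in> insert i J then 1/2 else \<epsilon> k)" if "S \<subseteq> J" for S
        using insert.hyps that by auto
      have 2: "(\<lambda>k. if k \<in> S then 0 else if k \<in> J then 1/2 else (\<epsilon>(i := 1/2)) k) =
          (\<lambda>k. if k \<in> S then 0 else if k \<in> insert i J then 1/2 else \<epsilon> k)" if "S \<subseteq> J" for S
        using insert.hyps that by auto
      show ?thesis
        unfolding bexp_insert[OF insert.hyps]
        by (intro arg_cong2[of _ _ _ _ "(+)"] arg_cong2[of _ _ _ _ "(*)"] refl bexp_cong) (simp_all only: 1 2)
    qed
    finally show ?case .
  qed
  have "bexp I (\<lambda>_. l) (\<lambda>S. \<Phi> (noise I (\<lambda>i. if i \<in> S then 0 else if i \<in> I then 1/2 else 0) f))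
      = bexp I (\<lambda>_. l) (\<lambda>S. \<Phi> (noise I (\<lambda>i. if i \<in> S then 0 else 1/2) f))"
  proof (rule bexp_cong)
    fix S
    have "noise I (\<lambda>i. if i \<in> S then 0 else if i \<in> I then 1/2 else 0) f = noise I (\<lambda>i. if i \<in> S then 0 else 1/2) f"
      unfolding noise_def[abs_def] by (intro ext bexp_cong) auto
    then show "\<Phi> (noise I (\<lambda>i. if i \<in> S then 0 else if i \<in> I then 1/2 else 0) f)
       = \<Phi> (noise I (\<lambda>i. if i \<in> S then 0 else 1/2) f)" by simp
  qed simp
  moreover have "noise I (\<lambda>i. if i \<in> I then \<delta> else 0) f = noise I (\<lambda>_. \<delta>) f"
    unfolding noise_def[abs_def] by (intro ext bexp_cong) auto
  ultimately show ?thesis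
    using gen[OF I order_refl, of "\<lambda>_. 0"] by simp
qed

section \<open>A code seen through erasures\<close>

lemma bexp_zero:
  assumes "finite I" shows "bexp I (\<lambda>_. 0) F = F {}"
  using assms by (induction I arbitrary: F) (auto simp: bexp_insert)

text \<open>The codewords attached to the points of \<open>Y\<close> have singleton traces on
  \<open>S\<close>; their sum has trace \<open>Y\<close>.\<close>

lemma code_extend:
  assumes C: "\<And>c d. c \<in> C \<Longrightarrow> d \<in> C \<Longrightarrow> sym_diff c d \<in> C" "{} \<in> C"
    and U: "\<And>y. y \<in> U \<Longrightarrow> y \<in> S \<and> (\<exists>c\<in>C. y \<in> c \<and> c \<inter> S \<subseteq> {y})" and Y: "finite Y" "Y \<subseteq> U"
  shows "\<exists>c\<in>C. c \<inter> S = Y"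
  using Y
proof (induction Y)
  case empty
  then show ?case using C(2) by (intro bexI[of _ "{}"]) auto
next
  case (insert y Y)
  then obtain c where c: "c \<in> C" "c \<inter> S = Y" by auto
  obtain e where e: "e \<in> C" "y \<in> e" "e \<inter> S \<subseteq> {y}" "y \<in> S" using U[of y] insert.prems by auto
  have "sym_diff c e \<inter> S = insert y Y"
    using c(2) e insert.hyps by auto
  then show ?case using C(1)[OF c(1) e(1)] by blast
qed

text \<open>Translating the fibre over \<open>x \<inter> S\<close> by one codeword of trace
  \<open>Y\<close> for each subset \<open>Y\<close> of \<open>U\<close> gives
  \<open>2 ^ card U\<close> disjoint copies of it inside the code.\<close>

lemma code_fiber_card_le:
  assumes I: "finite I" "C \<subseteq> Pow I" and C: "\<And>c d. c \<in> C \<Longrightarrow> d \<in> C \<Longrightarrow> sym_diff c d \<in> C" "{} \<in> C"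
    and S: "S \<subseteq> I"
  defines "U \<equiv> {y \<in> S. \<exists>c\<in>C. y \<in> c \<and> c \<inter> S \<subseteq> {y}}"
  shows "card {c \<in> C. c \<inter> S = x \<inter> S} * 2 ^ card U \<le> card C"
proof -
  let ?M = "{c \<in> C. c \<inter> S = x \<inter> S}"
  have finU: "finite U" using I(1) S unfolding U_def by (auto intro: finite_subset)
  have finC: "finite C" using I by (auto intro: finite_subset)
  have "\<exists>c\<in>C. c \<inter> S = Y" if "Y \<subseteq> U" for Y
    using that finU by (intro code_extend[OF C, of U]) (auto simp: U_def intro: finite_subset)
  then obtain k where k: "\<And>Y. Y \<subseteq> U \<Longrightarrow> k Y \<in> C \<and> k Y \<inter> S = Y" by metis
  have "inj_on (\<lambda>(c, Y). sym_diff c (k Y)) (?M \<times> Pow U)"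
  proof (rule inj_onI, clarify)
    fix c Y c' Y' assume cs: "c \<inter> S = x \<inter> S" "c' \<inter> S = x \<inter> S" "Y \<subseteq> U" "Y' \<subseteq> U"
      and eq: "sym_diff c (k Y) = sym_diff c' (k Y')"
    have "sym_diff c (k Y) \<inter> S = sym_diff (x \<inter> S) Y" "sym_diff c' (k Y') \<inter> S = sym_diff (x \<inter> S) Y'"
      using cs k[OF cs(3)] k[OF cs(4)] by blast+
    then have "sym_diff (x \<inter> S) Y = sym_diff (x \<inter> S) Y'" using eq by simp
    then have Y: "Y = Y'" by blast
    have "sym_diff c (k Y) = sym_diff c' (k Y)" using eq Y by simp
    then have "c = c'" by blast
    then show "c = c' \<and> Y = Y'" using Y by blast
  qed
  moreover have "(\<lambda>(c, Y). sym_diff c (k Y)) ` (?M \<times> Pow U) \<subseteq> C"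
  proof (clarsimp simp del: Diff_iff Un_iff)
    fix c Y assume "c \<in> C" "Y \<subseteq> U"
    then show "sym_diff c (k Y) \<in> C" using k C(1) by simp
  qed
  ultimately have "card (?M \<times> Pow U) \<le> card C"
    using finC by (rule card_inj_on_le)
  then show ?thesis using finU by (simp add: card_cartesian_product card_Pow)
qed

text \<open>The erased density at x is \<open>2 ^ card S\<close> times the fraction of codewords
  agreeing with x on \<open>S\<close>. The fibre bound divides by 2 for every point of
  \<open>S\<close> that the rest of \<open>S\<close> leaves undetermined.\<close>

lemma erased_code_le:
  assumes I: "finite I" "C \<subseteq> Pow I" and C: "\<And>c d. c \<in> C \<Longrightarrow> d \<in> C \<Longrightarrow> sym_diff c d \<in> C" "{} \<in> C"
    and S: "S \<subseteq> I" and x: "x \<subseteq> I"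
  shows "noise I (\<lambda>i. if i \<in> S then 0 else 1/2) (\<lambda>y. 2 ^ card I / card C * of_bool (y \<in> C)) x
    \<le> 2 ^ card {y \<in> S. \<not> (\<exists>c\<in>C. y \<in> c \<and> c \<inter> S \<subseteq> {y})}"
proof -
  let ?f = "\<lambda>y. 2 ^ card I / real (card C) * of_bool (y \<in> C)"
  let ?M = "{c \<in> C. c \<inter> S = x \<inter> S}"
  let ?U = "{y \<in> S. \<exists>c\<in>C. y \<in> c \<and> c \<inter> S \<subseteq> {y}}" and ?D = "{y \<in> S. \<not> (\<exists>c\<in>C. y \<in> c \<and> c \<inter> S \<subseteq> {y})}"
  have fin: "finite S" "finite (I - S)" "finite C" using I S by (auto intro: finite_subset)
  have cpos: "0 < card C" using fin C(2) by (auto simp: card_gt_0_iff)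
  have IS: "I = S \<union> (I - S)" using S by auto
  have cS: "card I = card S + card (I - S)"
    using card_Un_disjoint[of S "I - S"] fin IS by auto
  have "noise I (\<lambda>i. if i \<in> S then 0 else 1/2) ?f x
    = bexp S (\<lambda>i. if i \<in> S then 0 else 1/2) (\<lambda>A. bexp (I - S) (\<lambda>i. if i \<in> S then 0 else 1/2) (\<lambda>B. ?f (sym_diff x (A \<union> B))))"
    unfolding noise_def by (subst IS, subst bexp_Un) (use fin in auto)
  also have "\<dots> = bexp S (\<lambda>_. 0) (\<lambda>A. bexp (I - S) (\<lambda>_. 1/2) (\<lambda>B. ?f (sym_diff x (A \<union> B))))"
    by (intro bexp_cong) auto
  also have "\<dots> = (\<Sum>B\<in>Pow (I - S). ?f (sym_diff x B)) / 2 ^ card (I - S)"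
    using fin by (simp add: bexp_zero bexp_half)
  also have "(\<Sum>B\<in>Pow (I - S). ?f (sym_diff x B)) = 2 ^ card I / card C * card {B \<in> Pow (I - S). sym_diff x B \<in> C}"
    by (subst sum_distrib_left[symmetric]) (use fin in \<open>simp add: Int_def\<close>)
  also have "\<dots> / 2 ^ card (I - S) = 2 ^ card S * card {B \<in> Pow (I - S). sym_diff x B \<in> C} / card C"
    by (simp add: cS power_add)
  also have "\<dots> \<le> 2 ^ card S * card ?M / card C"
  proof -
    have "inj_on (sym_diff x) {B \<in> Pow (I - S). sym_diff x B \<in> C}"
      by (rule inj_onI) blast
    moreover have "sym_diff x ` {B \<in> Pow (I - S). sym_diff x B \<in> C} \<subseteq> ?M" by auto
    ultimately have "card {B \<in> Pow (I - S). sym_diff x B \<in> C} \<le> card ?M"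
      using fin by (intro card_inj_on_le) auto
    then show ?thesis by (intro divide_right_mono mult_left_mono) auto
  qed
  also have "\<dots> \<le> 2 ^ card ?D"
  proof -
    have "S = ?U \<union> ?D" by auto
    then have sc: "card S = card ?U + card ?D"
      using card_Un_disjoint[of ?U ?D] fin by auto
    have "real (card ?M * 2 ^ card ?U) \<le> real (card C)"
      using code_fiber_card_le[OF I C S, of x] by (simp only: of_nat_le_iff)
    then have "2 ^ card ?D * (real (card ?M) * 2 ^ card ?U) \<le> 2 ^ card ?D * real (card C)"
      by (intro mult_left_mono) auto
    then show ?thesis using cpos by (simp add: sc power_add divide_le_eq mult_ac)
  qed
  finally show ?thesis .
qed

text \<open>Hoelder's inequality with exponents 1/l and 1/(1 - l), from Young's inequality for
  \<open>A\<close> and \<open>B\<close> divided by their means.\<close>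

lemma bexp_Young:
  assumes J: "finite J" "\<And>i. i \<in> J \<Longrightarrow> 0 \<le> p i \<and> p i \<le> 1" and l: "0 \<le> l" "l \<le> 1"
    and AB: "\<And>y. 0 \<le> A y" "\<And>y. 0 \<le> B y" and pos: "0 < bexp J p A" "0 < bexp J p B"
  shows "bexp J p (\<lambda>y. A y powr l * B y powr (1 - l)) \<le> bexp J p A powr l * bexp J p B powr (1 - l)"
proof -
  let ?a = "bexp J p A" and ?b = "bexp J p B"
  let ?c = "?a powr l * ?b powr (1 - l)"
  have c: "0 < ?c" using pos by simp
  have "bexp J p (\<lambda>y. A y powr l * B y powr (1 - l)) \<le> bexp J p (\<lambda>y. ?c * (l / ?a * A y + (1 - l) / ?b * B y))"
  proof (rule bexp_mono)
    fix y
    show "A y powr l * B y powr (1 - l) \<le> ?c * (l / ?a * A y + (1 - l) / ?b * B y)"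
    proof (cases "A y = 0 \<or> B y = 0")
      case True
      have "0 \<le> ?c * (l / ?a * A y + (1 - l) / ?b * B y)"
        using c pos l AB by (intro mult_nonneg_nonneg add_nonneg_nonneg) auto
      then show ?thesis using True by auto
    next
      case False
      then have "0 < A y" "0 < B y" using AB[of y] by auto
      then have "(A y / ?a) powr l * (B y / ?b) powr (1 - l) \<le> l * (A y / ?a) + (1 - l) * (B y / ?b)"
        using l pos by (intro Youngs_inequality_0) auto
      then have "?c * ((A y / ?a) powr l * (B y / ?b) powr (1 - l)) \<le> ?c * (l / ?a * A y + (1 - l) / ?b * B y)"
        using c by (intro mult_left_mono) auto
      moreover have "?c * ((A y / ?a) powr l * (B y / ?b) powr (1 - l)) = A y powr l * B y powr (1 - l)"
        using pos by (simp add: powr_divide)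
      ultimately show ?thesis by simp
    qed
  qed (use J in auto)
  also have "\<dots> = ?c * (l / ?a * ?a + (1 - l) / ?b * ?b)"
    by (simp only: bexp_cmult bexp_add)
  also have "\<dots> = ?c" using pos by simp
  finally show ?thesis .
qed

section \<open>The three divergences as functionals of a density\<close>

lemma avg_power_ge_1:
  assumes "finite I" "\<And>x. 0 \<le> g x" "avg I g = 1"
  shows "1 \<le> avg I (\<lambda>x. g x ^ q)"
proof -
  have "1 = avg I (\<lambda>x. 1 + real q * (g x - 1))"
    using assms by (simp only: bexp_add bexp_cmult bexp_diff bexp_const) simp
  also have "\<dots> \<le> avg I (\<lambda>x. g x ^ q)"
  proof (rule bexp_mono)
    fix x
    have "-1 \<le> g x - 1" using assms(2)[of x] by simp
    from Bernoulli_inequality[OF this, of q] show "1 + real q * (g x - 1) \<le> g x ^ q" by simp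
  qed simp
  finally show ?thesis .
qed

lemma avg_flip_mix:
  assumes "finite I" "i \<in> I"
  shows "avg I (flip_mix i p g) = avg I g"
proof -
  have "avg I (flip_mix i p g) = avg (I - {i}) (\<lambda>y. (flip_mix i p g y + flip_mix i p g (insert i y)) / 2)"
    by (rule avg_pair[OF assms])
  also have "\<dots> = avg (I - {i}) (\<lambda>y. (g y + g (insert i y)) / 2)"
  proof (rule bexp_cong)
    fix y assume "y \<subseteq> I - {i}"
    then have "i \<notin> y" by auto
    from flip_mix_pair[OF this, of p g]
    show "(flip_mix i p g y + flip_mix i p g (insert i y)) / 2 = (g y + g (insert i y)) / 2"
      by (simp only:) (simp add: algebra_simps)
  qed simp
  finally show ?thesis using avg_pair[OF assms, of g] by simp
qed

lemma flip_mix_nonneg: "0 \<le> p \<Longrightarrow> p \<le> 1 \<Longrightarrow> (\<And>x. 0 \<le> g x) \<Longrightarrow> 0 \<le> flip_mix i p g x"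
  by (simp add: flip_mix_def)

lemma flip_mix_half:
  assumes "i \<notin> y"
  shows "flip_mix i (1/2) g y = (g y + g (insert i y)) / 2"
    "flip_mix i (1/2) g (insert i y) = (g y + g (insert i y)) / 2"
  using flip_mix_pair[OF assms, of "1/2" g] by (simp_all add: field_simps)

text \<open>For a density of mean 1, its Renyi divergence of order q from the uniform law.\<close>

definition log_moment :: "nat \<Rightarrow> nat set \<Rightarrow> (nat set \<Rightarrow> real) \<Rightarrow> real" where
  "log_moment q I g = 1 / (real q - 1) * log 2 (avg I (\<lambda>x. g x ^ q))"

lemma log_moment_step:
  assumes I: "finite I" "i \<in> I" and q: "2 \<le> q" and g: "\<And>x. 0 \<le> g x" "avg I g = 1"
    and \<delta>: "0 < \<delta>" "\<delta> < 1" and lam: "ln (psi q (1 - 2 * \<delta>)) = l * ln (psi q 1)" "0 \<le> l" "l \<le> 1"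
  shows "log_moment q I (flip_mix i \<delta> g) \<le> l * log_moment q I g + (1 - l) * log_moment q I (flip_mix i (1/2) g)"
proof -
  let ?J = "I - {i}"
  let ?m = "\<lambda>g. avg I (\<lambda>x. g x ^ q)"
  let ?A = "\<lambda>y. (g y ^ q + g (insert i y) ^ q) / 2" and ?B = "\<lambda>y. ((g y + g (insert i y)) / 2) ^ q"
  have A: "?m g = avg ?J ?A"
    using avg_pair[OF I, of "\<lambda>x. g x ^ q"] .
  have B: "?m (flip_mix i (1/2) g) = avg ?J ?B"
    unfolding avg_pair[OF I, of "\<lambda>x. flip_mix i (1/2) g x ^ q"]
  proof (rule bexp_cong)
    fix y assume "y \<subseteq> ?J"
    then have "i \<notin> y" by auto
    from flip_mix_half[OF this, of g]
    show "(flip_mix i (1/2) g y ^ q + flip_mix i (1/2) g (insert i y) ^ q) / 2 = ?B y" by (simp only:) simp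
  qed simp
  have ge: "1 \<le> ?m g" "1 \<le> ?m (flip_mix i (1/2) g)" "1 \<le> ?m (flip_mix i \<delta> g)"
    using g \<delta> I by (auto intro!: avg_power_ge_1 flip_mix_nonneg simp: avg_flip_mix)
  have "?m (flip_mix i \<delta> g) \<le> avg ?J (\<lambda>y. ?A y powr l * ?B y powr (1 - l))"
    unfolding avg_pair[OF I, of "\<lambda>x. flip_mix i \<delta> g x ^ q"]
  proof (rule bexp_mono)
    fix y assume "y \<subseteq> ?J"
    then have "i \<notin> y" by auto
    from flip_mix_pair[OF this, of \<delta> g] pair_power[OF q g(1) g(1) \<delta> lam(1,2), of y "insert i y"]
    show "(flip_mix i \<delta> g y ^ q + flip_mix i \<delta> g (insert i y) ^ q) / 2 \<le> ?A y powr l * ?B y powr (1 - l)"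
      by (simp only:)
  qed simp
  also have "\<dots> \<le> avg ?J ?A powr l * avg ?J ?B powr (1 - l)"
    using I lam g(1) ge by (intro bexp_Young) (auto simp flip: A B)
  also have "\<dots> = ?m g powr l * ?m (flip_mix i (1/2) g) powr (1 - l)"
    by (simp only: A B)
  finally have "log 2 (?m (flip_mix i \<delta> g)) \<le> log 2 (?m g powr l * ?m (flip_mix i (1/2) g) powr (1 - l))"
    using ge by (subst log_le_cancel_iff) (auto intro!: mult_pos_pos)
  also have "\<dots> = l * log 2 (?m g) + (1 - l) * log 2 (?m (flip_mix i (1/2) g))"
    using ge by (simp add: log_mult log_powr)
  finally have "1 / (real q - 1) * log 2 (?m (flip_mix i \<delta> g))
     \<le> 1 / (real q - 1) * (l * log 2 (?m g) + (1 - l) * log 2 (?m (flip_mix i (1/2) g)))"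
    using q by (intro mult_left_mono) auto
  then show ?thesis by (simp add: log_moment_def algebra_simps add_divide_distrib diff_divide_distrib)
qed

text \<open>Of the q factors, q - 1 are bounded by the maximum and the last has mean 1; the
  normalisation 1/(q - 1) then leaves \<nu>.\<close>

lemma log_moment_le:
  assumes I: "finite I" and q: "2 \<le> q" and g: "\<And>x. 0 \<le> g x" "avg I g = 1" "\<And>x. x \<subseteq> I \<Longrightarrow> g x \<le> 2 ^ \<nu>"
  shows "log_moment q I g \<le> real \<nu>"
proof -
  have q1: "q = Suc (q - 1)" using q by simp
  have "avg I (\<lambda>x. g x ^ q) \<le> avg I (\<lambda>x. (2 ^ \<nu>) ^ (q - 1) * g x)"
  proof (rule bexp_mono)
    fix x assume "x \<subseteq> I"
    then have "g x ^ (q - 1) * g x \<le> (2 ^ \<nu>) ^ (q - 1) * g x"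
      using g by (intro mult_right_mono power_mono) auto
    then show "g x ^ q \<le> (2 ^ \<nu>) ^ (q - 1) * g x" by (subst q1) (simp add: mult.commute)
  qed simp
  also have "\<dots> = 2 ^ (\<nu> * (q - 1))" using g(2) by (simp add: bexp_cmult power_mult)
  finally have "log 2 (avg I (\<lambda>x. g x ^ q)) \<le> log 2 (2 ^ (\<nu> * (q - 1)))"
    using avg_power_ge_1[OF I g(1,2), of q] by (subst log_le_cancel_iff) auto
  also have "\<dots> = real \<nu> * (real q - 1)" using q by (simp add: log_nat_power of_nat_diff)
  finally show ?thesis using q by (simp add: log_moment_def divide_le_eq)
qed

definition log_max :: "nat set \<Rightarrow> (nat set \<Rightarrow> real) \<Rightarrow> real" where
  "log_max I g = log 2 (Max (g ` Pow I))"

lemma Max_ge_1: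
  assumes I: "finite I" and g: "avg I g = 1"
  shows "1 \<le> Max (g ` Pow I)"
proof -
  have "avg I g \<le> avg I (\<lambda>_. Max (g ` Pow I))"
    using I by (intro bexp_mono) auto
  then show ?thesis using I g by (simp add: bexp_const)
qed

text \<open>The bound is pointwise: \<open>pair_max\<close> is applied to x and its neighbour across
  coordinate \<open>i\<close>, and both factors are replaced by their maxima. This takes the place
  of Hoelder's inequality.\<close>

lemma log_max_step:
  assumes I: "finite I" "i \<in> I" and g: "\<And>x. 0 \<le> g x" "avg I g = 1"
    and \<delta>: "0 < \<delta>" "\<delta> < 1" and lam: "1 + \<bar>1 - 2 * \<delta>\<bar> = 2 powr l" "0 \<le> l" "l \<le> 1"
  shows "log_max I (flip_mix i \<delta> g) \<le> l * log_max I g + (1 - l) * log_max I (flip_mix i (1/2) g)"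
proof -
  let ?M = "\<lambda>g. Max (g ` Pow I)"
  have ge: "1 \<le> ?M g" "1 \<le> ?M (flip_mix i (1/2) g)" "1 \<le> ?M (flip_mix i \<delta> g)"
    using g I by (auto intro!: Max_ge_1 simp: avg_flip_mix)
  have "flip_mix i \<delta> g x \<le> ?M g powr l * ?M (flip_mix i (1/2) g) powr (1 - l)" if x: "x \<in> Pow I" for x
  proof -
    have x': "sym_diff x {i} \<in> Pow I" using x I by auto
    have "flip_mix i \<delta> g x \<le> (max (g x) (g (sym_diff x {i}))) powr l * ((g x + g (sym_diff x {i})) / 2) powr (1 - l)"
      unfolding flip_mix_def by (rule pair_max[OF g(1) g(1) \<delta> lam])
    also have "(g x + g (sym_diff x {i})) / 2 = flip_mix i (1/2) g x"
      by (simp add: flip_mix_def)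
    also have "(max (g x) (g (sym_diff x {i}))) powr l * flip_mix i (1/2) g x powr (1 - l)
        \<le> ?M g powr l * ?M (flip_mix i (1/2) g) powr (1 - l)"
      using I x x' g(1) lam
      by (intro mult_mono powr_mono2 flip_mix_nonneg) (auto intro!: Max_ge simp: le_max_iff_disj simp del: Pow_iff)
    finally show ?thesis .
  qed
  then have "?M (flip_mix i \<delta> g) \<le> ?M g powr l * ?M (flip_mix i (1/2) g) powr (1 - l)"
    using I by (subst Max_le_iff) auto
  then have "log 2 (?M (flip_mix i \<delta> g)) \<le> log 2 (?M g powr l * ?M (flip_mix i (1/2) g) powr (1 - l))"
    using ge by (subst log_le_cancel_iff) (auto intro!: mult_pos_pos)
  also have "\<dots> = l * log 2 (?M g) + (1 - l) * log 2 (?M (flip_mix i (1/2) g))"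
    using ge by (simp add: log_mult log_powr)
  finally show ?thesis by (simp add: log_max_def)
qed

lemma log_max_le:
  assumes I: "finite I" and g: "avg I g = 1" "\<And>x. x \<subseteq> I \<Longrightarrow> g x \<le> 2 ^ \<nu>"
  shows "log_max I g \<le> real \<nu>"
proof -
  have "Max (g ` Pow I) \<le> 2 ^ \<nu>" using I g(2) by (subst Max_le_iff) auto
  then have "log 2 (Max (g ` Pow I)) \<le> log 2 (2 ^ \<nu>)"
    using Max_ge_1[OF I g(1)] by (subst log_le_cancel_iff) auto
  then show ?thesis by (simp add: log_max_def log_nat_power)
qed

definition log_mean :: "nat set \<Rightarrow> (nat set \<Rightarrow> real) \<Rightarrow> real" where
  "log_mean I g = avg I (\<lambda>x. g x * log 2 (g x))"

text \<open>The two-point inequality is already linear in the three quantities, so averaging over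
  the remaining coordinates finishes the step.\<close>

lemma log_mean_step:
  assumes I: "finite I" "i \<in> I" and g: "\<And>x. 0 \<le> g x" and \<delta>: "0 < \<delta>" "\<delta> < 1"
  defines "l \<equiv> (1 - 2 * \<delta>)\<^sup>2"
  shows "log_mean I (flip_mix i \<delta> g) \<le> l * log_mean I g + (1 - l) * log_mean I (flip_mix i (1/2) g)"
proof -
  let ?J = "I - {i}" and ?\<phi> = "\<lambda>t::real. t * log 2 t"
  have pair: "(?\<phi> ((1 - \<delta>) * a0 + \<delta> * a1) + ?\<phi> ((1 - \<delta>) * a1 + \<delta> * a0)) / 2
    \<le> l * ((?\<phi> a0 + ?\<phi> a1) / 2) + (1 - l) * ?\<phi> ((a0 + a1) / 2)" if "0 \<le> a0" "0 \<le> a1" for a0 a1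
  proof -
    have e: "?\<phi> t = t * ln t / ln 2" for t by (simp add: log_def)
    have "(X / ln 2 + Y / ln 2) / 2 = ((X + Y) / 2) / ln 2" for X Y :: real by (simp add: add_divide_distrib)
    moreover have "l * ((X / ln 2 + Y / ln 2) / 2) + (1 - l) * (Z / ln 2) = (l * ((X + Y) / 2) + (1 - l) * Z) / ln 2" for X Y Z :: real
      by (simp add: field_simps)
    ultimately show ?thesis
      unfolding e using pair_xlogx[OF that \<delta>] unfolding l_def by (simp only:) (intro divide_right_mono; simp)
  qed
  have "log_mean I (flip_mix i \<delta> g) \<le> avg ?J (\<lambda>y. l * ((?\<phi> (g y) + ?\<phi> (g (insert i y))) / 2)
      + (1 - l) * ?\<phi> ((g y + g (insert i y)) / 2))"
    unfolding log_mean_def avg_pair[OF I, of "\<lambda>x. ?\<phi> (flip_mix i \<delta> g x)"]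
  proof (rule bexp_mono)
    fix y assume "y \<subseteq> ?J"
    then have "i \<notin> y" by auto
    from flip_mix_pair[OF this, of \<delta> g] pair[OF g g, of y "insert i y"]
    show "(?\<phi> (flip_mix i \<delta> g y) + ?\<phi> (flip_mix i \<delta> g (insert i y))) / 2 \<le>
       l * ((?\<phi> (g y) + ?\<phi> (g (insert i y))) / 2) + (1 - l) * ?\<phi> ((g y + g (insert i y)) / 2)"
      by (simp only:)
  qed simp
  also have "\<dots> = l * avg ?J (\<lambda>y. (?\<phi> (g y) + ?\<phi> (g (insert i y))) / 2)
      + (1 - l) * avg ?J (\<lambda>y. ?\<phi> ((g y + g (insert i y)) / 2))"
    by (simp only: bexp_add bexp_cmult)
  also have "avg ?J (\<lambda>y. (?\<phi> (g y) + ?\<phi> (g (insert i y))) / 2) = log_mean I g"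
    unfolding log_mean_def by (rule avg_pair[OF I, symmetric])
  also have "avg ?J (\<lambda>y. ?\<phi> ((g y + g (insert i y)) / 2)) = log_mean I (flip_mix i (1/2) g)"
    unfolding log_mean_def avg_pair[OF I, of "\<lambda>x. ?\<phi> (flip_mix i (1/2) g x)"]
  proof (rule bexp_cong)
    fix y assume "y \<subseteq> ?J"
    then have "i \<notin> y" by auto
    from flip_mix_half[OF this, of g]
    show "?\<phi> ((g y + g (insert i y)) / 2) = (?\<phi> (flip_mix i (1/2) g y) + ?\<phi> (flip_mix i (1/2) g (insert i y))) / 2"
      by (simp only:) simp
  qed simp
  finally show ?thesis .
qed

lemma log_mean_nonneg:
  assumes I: "finite I" and g: "\<And>x. 0 \<le> g x" "avg I g = 1"
  shows "0 \<le> log_mean I g"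
proof -
  have "0 = avg I (\<lambda>x. 1 / ln 2 * (g x - 1))"
    using I g(2) by (simp only: bexp_cmult bexp_diff bexp_const) simp
  also have "\<dots> \<le> avg I (\<lambda>x. g x * log 2 (g x))"
  proof (rule bexp_mono)
    fix x
    have "g x - 1 \<le> g x * ln (g x)"
    proof (cases "g x = 0")
      case False
      then have p: "0 < g x" using g(1)[of x] by simp
      have "ln (1 / g x) \<le> 1 / g x - 1" using p by (intro ln_le_minus_one) auto
      then have "1 - 1 / g x \<le> ln (g x)" using p by (simp add: ln_div)
      then have "g x * (1 - 1 / g x) \<le> g x * ln (g x)" using p by (intro mult_left_mono) auto
      then show ?thesis using p by (simp add: right_diff_distrib)
    qed simp
    then show "1 / ln 2 * (g x - 1) \<le> g x * log 2 (g x)" by (simp add: log_def divide_right_mono)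
  qed simp
  finally show ?thesis by (simp add: log_mean_def)
qed

lemma log_mean_le:
  assumes I: "finite I" and g: "\<And>x. 0 \<le> g x" "avg I g = 1" "\<And>x. x \<subseteq> I \<Longrightarrow> g x \<le> 2 ^ \<nu>"
  shows "log_mean I g \<le> real \<nu>"
proof -
  have "log_mean I g \<le> avg I (\<lambda>x. real \<nu> * g x)"
    unfolding log_mean_def
  proof (rule bexp_mono)
    fix x assume x: "x \<subseteq> I"
    show "g x * log 2 (g x) \<le> real \<nu> * g x"
    proof (cases "g x = 0")
      case False
      then have p: "0 < g x" using g(1)[of x] by simp
      then have "log 2 (g x) \<le> log 2 (2 ^ \<nu>)" using g(3)[OF x] by (subst log_le_cancel_iff) auto
      then have "log 2 (g x) \<le> real \<nu>" by (simp add: log_nat_power)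
      then show ?thesis using p by (simp add: mult.commute)
    qed simp
  qed simp
  then show ?thesis using g(2) by (simp add: bexp_cmult)
qed

text \<open>The density of the uniform law on the code relative to the uniform law on all
  words.\<close>

definition code_fun :: "nat set \<Rightarrow> nat set set \<Rightarrow> nat set \<Rightarrow> real" where
  "code_fun I C = (\<lambda>y. 2 ^ card I / card C * of_bool (y \<in> C))"

lemma code_fun_nonneg: "0 \<le> code_fun I C x"
  by (simp add: code_fun_def)

lemma avg_code_fun:
  assumes I: "finite I" "C \<subseteq> Pow I" and C: "C \<noteq> {}"
  shows "avg I (code_fun I C) = 1"
proof -
  have "0 < card C" using I C by (auto simp: card_gt_0_iff intro: finite_subset)
  moreover have "(\<Sum>y\<in>Pow I. code_fun I C y) = 2 ^ card I / card C * (\<Sum>y\<in>Pow I. of_bool (y \<in> C))"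
    unfolding code_fun_def by (rule sum_distrib_left[symmetric])
  moreover have "(\<Sum>y\<in>Pow I. of_bool (y \<in> C) :: real) = card C"
    using I by (simp add: Int_absorb1 Int_absorb2)
  ultimately show ?thesis using I(1) by (simp add: bexp_half)
qed

text \<open>Common form of the argument for the three divergences: \<open>step\<close> trades noise
  for erasures, and \<open>bound\<close> turns the maximum of the erased density into a number of
  determined points.\<close>

lemma code_noise_le:
  assumes I: "finite I" "C \<subseteq> Pow I" and C: "\<And>c d. c \<in> C \<Longrightarrow> d \<in> C \<Longrightarrow> sym_diff c d \<in> C" "{} \<in> C"
    and \<delta>: "0 \<le> \<delta>" "\<delta> \<le> 1" and l: "0 \<le> l" "l \<le> 1"
    and step: "\<And>g i. i \<in> I \<Longrightarrow> (\<And>x. 0 \<le> g x) \<Longrightarrow> avg I g = 1 \<Longrightarrow>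
      \<Phi> (flip_mix i \<delta> g) \<le> l * \<Phi> g + (1 - l) * \<Phi> (flip_mix i (1/2) g)"
    and bound: "\<And>g \<nu>. (\<And>x. 0 \<le> g x) \<Longrightarrow> avg I g = 1 \<Longrightarrow> (\<And>x. x \<subseteq> I \<Longrightarrow> g x \<le> 2 ^ \<nu>) \<Longrightarrow> \<Phi> g \<le> real \<nu>"
  shows "\<Phi> (noise I (\<lambda>_. \<delta>) (code_fun I C)) \<le> (\<Sum>x\<in>I. bexp I (\<lambda>_. l) (\<lambda>S. of_bool (\<not> undet C x S)))"
proof -
  let ?f = "code_fun I C"
  have f1: "avg I ?f = 1" using C(2) by (intro avg_code_fun I) auto
  have "\<Phi> (noise I (\<lambda>_. \<delta>) ?f) \<le> bexp I (\<lambda>_. l) (\<lambda>S. \<Phi> (noise I (\<lambda>i. if i \<in> S then 0 else 1/2) ?f))"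
    by (rule noise_erasure_le[OF I(1) \<delta> step l code_fun_nonneg f1])
  also have "\<dots> \<le> bexp I (\<lambda>_. l) (\<lambda>S. \<Sum>x\<in>I. of_bool (\<not> undet C x S))"
  proof (rule bexp_mono)
    fix S assume S: "S \<subseteq> I"
    let ?D = "{y \<in> S. \<not> (\<exists>c\<in>C. y \<in> c \<and> c \<inter> S \<subseteq> {y})}"
    have "\<Phi> (noise I (\<lambda>i. if i \<in> S then 0 else 1/2) ?f) \<le> real (card ?D)"
    proof (rule bound)
      fix x
      show "0 \<le> noise I (\<lambda>i. if i \<in> S then 0 else 1/2) ?f x" by (intro noise_nonneg code_fun_nonneg) auto
      show "noise I (\<lambda>i. if i \<in> S then 0 else 1/2) ?f x \<le> 2 ^ card ?D" if "x \<subseteq> I"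
        unfolding code_fun_def using erased_code_le[OF I C S that] .
    qed (simp add: avg_noise[OF I(1)] f1)
    \<comment> \<open>Determined points outside \<open>S\<close> are added to the count, which turns
      it into a sum over all of \<open>I\<close>.\<close>
    also have "\<dots> \<le> real (card {x \<in> I. \<not> undet C x S})"
      using I(1) S by (intro of_nat_mono card_mono) (auto simp: undet_def)
    also have "\<dots> = (\<Sum>x\<in>I. of_bool (\<not> undet C x S))"
      using I(1) by (simp add: Int_def)
    finally show "\<Phi> (noise I (\<lambda>i. if i \<in> S then 0 else 1/2) ?f) \<le> (\<Sum>x\<in>I. of_bool (\<not> undet C x S))" .
  qed (use l in auto)
  also have "\<dots> = (\<Sum>x\<in>I. bexp I (\<lambda>_. l) (\<lambda>S. of_bool (\<not> undet C x S)))"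
    by (rule bexp_sum)
  finally show ?thesis .
qed

section \<open>The syndrome distribution\<close>

definition char_vec :: "nat set \<Rightarrow> nat \<Rightarrow> bool" where
  "char_vec X = (\<lambda>i. i \<in> X)"

lemma inj_char_vec: "inj_on char_vec A"
  by (rule inj_onI) (auto simp: char_vec_def fun_eq_iff)

lemma vecs_eq: "vecs n = char_vec ` Pow {..<n}"
proof -
  have "x \<in> char_vec ` Pow {..<n}" if "x \<in> vecs n" for x
  proof (rule image_eqI)
    show "x = char_vec {i. x i}" by (simp add: char_vec_def)
    show "{i. x i} \<in> Pow {..<n}" using that unfolding vecs_def by (auto intro: leI not_le_imp_less)
  qed
  then show ?thesis by (auto simp: vecs_def char_vec_def)
qed

lemma finite_vecs: "finite (vecs n)" and card_vecs: "card (vecs n) = 2 ^ n"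
  by (simp_all add: vecs_eq card_image[OF inj_char_vec] card_Pow)

lemma pmf_bern_vec:
  assumes "0 \<le> \<delta>" "\<delta> \<le> 1" "z \<subseteq> {..<n}"
  shows "pmf (bern_vec n \<delta>) (char_vec z) = (\<Prod>i<n. if i \<in> z then \<delta> else 1 - \<delta>)"
  unfolding bern_vec_def using assms
  by (subst pmf_Pi) (auto simp: char_vec_def intro!: prod.cong)

lemma pmf_map_bern_vec:
  assumes "0 \<le> \<delta>" "\<delta> \<le> 1"
  shows "pmf (map_pmf f (bern_vec n \<delta>)) s = bexp {..<n} (\<lambda>_. \<delta>) (\<lambda>z. of_bool (f (char_vec z) = s))"
proof -
  let ?p = "bern_vec n \<delta>"
  have sub: "set_pmf ?p \<subseteq> vecs n"
    unfolding bern_vec_def using set_Pi_pmf_subset[of "{..<n}" False "\<lambda>_. bernoulli_pmf \<delta>"]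
    by (auto simp: vecs_def)
  have "pmf (map_pmf f ?p) s = measure ?p (f -` {s})"
    by (rule pmf_map)
  also have "\<dots> = measure ?p (f -` {s} \<inter> vecs n)"
    by (rule measure_eq_AE) (use sub in \<open>auto simp: AE_measure_pmf_iff\<close>)
  also have "\<dots> = (\<Sum>x\<in>f -` {s} \<inter> vecs n. pmf ?p x)"
    by (rule measure_measure_pmf_finite) (simp add: finite_vecs)
  also have "\<dots> = (\<Sum>x\<in>vecs n. pmf ?p x * of_bool (f x = s))"
    using finite_vecs by (intro sum.mono_neutral_cong_left) auto
  also have "\<dots> = (\<Sum>z\<in>Pow {..<n}. pmf ?p (char_vec z) * of_bool (f (char_vec z) = s))"
    unfolding vecs_eq by (simp add: sum.reindex[OF inj_char_vec])
  also have "\<dots> = bexp {..<n} (\<lambda>_. \<delta>) (\<lambda>z. of_bool (f (char_vec z) = s))"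
    unfolding bexp_def using assms by (intro sum.cong refl) (simp add: pmf_bern_vec)
  finally show ?thesis .
qed

lemma syndrome_sym_diff:
  "syndrome m n H (char_vec (sym_diff x y)) i \<longleftrightarrow> syndrome m n H (char_vec x) i \<noteq> syndrome m n H (char_vec y) i"
proof -
  let ?A = "\<lambda>x. {k. k < n \<and> H i k \<and> char_vec x k}"
  have "?A (sym_diff x y) = sym_diff (?A x) (?A y)" by (auto simp: char_vec_def)
  moreover have "finite (?A x)" "finite (?A y)" by auto
  ultimately have "odd (card (?A (sym_diff x y))) \<longleftrightarrow> odd (card (?A x)) \<noteq> odd (card (?A y))"
    by (simp only: odd_card_sym_diff)
  then show ?thesis by (auto simp: syndrome_def)
qed

lemma syndrome_eq_iff:
  assumes ker: "{x \<in> vecs n. syndrome m n H x = (\<lambda>_. False)} = char_vec ` C" and C: "C \<subseteq> Pow {..<n}"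
    and xy: "x \<subseteq> {..<n}" "y \<subseteq> {..<n}"
  shows "syndrome m n H (char_vec x) = syndrome m n H (char_vec y) \<longleftrightarrow> sym_diff x y \<in> C"
proof -
  have "syndrome m n H (char_vec x) = syndrome m n H (char_vec y) \<longleftrightarrow> syndrome m n H (char_vec (sym_diff x y)) = (\<lambda>_. False)"
    unfolding fun_eq_iff syndrome_sym_diff by simp
  also have "\<dots> \<longleftrightarrow> char_vec (sym_diff x y) \<in> char_vec ` C"
    unfolding ker[symmetric] using xy by (auto simp: vecs_eq)
  also have "\<dots> \<longleftrightarrow> sym_diff x y \<in> C"
    by (simp add: inj_image_mem_iff[OF inj_char_vec])
  finally show ?thesis .
qed

text \<open>The size relation \<open>card_C\<close> is what makes the syndrome map onto
  \<open>vecs m\<close>.\<close>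

locale syndrome_code =
  fixes m n :: nat and H :: "nat \<Rightarrow> nat \<Rightarrow> bool" and C :: "nat set set" and \<delta> :: real
  assumes ker: "{x \<in> vecs n. syndrome m n H x = (\<lambda>_. False)} = char_vec ` C"
    and C: "C \<subseteq> Pow {..<n}" and card_C: "card C * 2 ^ m = 2 ^ n"
    and \<delta>: "0 < \<delta>" "\<delta> < 1"
begin

abbreviation "syn x \<equiv> syndrome m n H (char_vec x)"

abbreviation "P \<equiv> map_pmf (syndrome m n H) (bern_vec n \<delta>)"

abbreviation "g \<equiv> noise {..<n} (\<lambda>_. \<delta>) (code_fun {..<n} C)"

lemma card_fiber:
  assumes x: "x \<subseteq> {..<n}"
  shows "card {y \<in> Pow {..<n}. syn y = syn x} = card C"
proof -
  have "{y \<in> Pow {..<n}. syn y = syn x} = (\<lambda>c. sym_diff x c) ` C"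
  proof (intro set_eqI iffI)
    fix y assume y: "y \<in> {y \<in> Pow {..<n}. syn y = syn x}"
    then have "sym_diff y x \<in> C" using syndrome_eq_iff[OF ker C, of y x] x by auto
    then show "y \<in> (\<lambda>c. sym_diff x c) ` C" by (intro image_eqI[of _ _ "sym_diff y x"]) auto
  next
    fix y assume "y \<in> (\<lambda>c. sym_diff x c) ` C"
    then obtain c where c: "c \<in> C" "y = sym_diff x c" by auto
    have "c \<subseteq> {..<n}" using C c by auto
    then have y: "y \<subseteq> {..<n}" using c x by auto
    have "sym_diff y x = c" using c by auto
    then show "y \<in> {y \<in> Pow {..<n}. syn y = syn x}"
      using syndrome_eq_iff[OF ker C y x] c y by auto
  qed
  moreover have "inj_on (\<lambda>c. sym_diff x c) C" by (rule inj_onI) blast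
  ultimately show ?thesis by (simp add: card_image)
qed

text \<open>The fibres of the syndrome map are the cosets of \<open>C\<close>, all of the same
  size.\<close>

lemma sum_syn: "(\<Sum>s\<in>syn ` Pow {..<n}. G s) * real (card C) = (\<Sum>x\<in>Pow {..<n}. G (syn x))"
proof -
  have "(\<Sum>x\<in>Pow {..<n}. G (syn x)) = (\<Sum>s\<in>syn ` Pow {..<n}. \<Sum>x\<in>{x \<in> Pow {..<n}. syn x = s}. G (syn x))"
    by (rule sum.image_gen) simp
  also have "\<dots> = (\<Sum>s\<in>syn ` Pow {..<n}. real (card C) * G s)"
  proof (rule sum.cong)
    fix s assume "s \<in> syn ` Pow {..<n}"
    then obtain x where "x \<subseteq> {..<n}" "s = syn x" by auto
    then have "card {y \<in> Pow {..<n}. syn y = s} = card C" using card_fiber by simp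
    then show "(\<Sum>x\<in>{x \<in> Pow {..<n}. syn x = s}. G (syn x)) = real (card C) * G s" by simp
  qed simp
  finally show ?thesis by (simp add: sum_distrib_left mult.commute sum_distrib_right)
qed

lemma range_syn: "syn ` Pow {..<n} = vecs m"
proof (rule card_subset_eq[OF finite_vecs])
  show "syn ` Pow {..<n} \<subseteq> vecs m" by (auto simp: vecs_def syndrome_def)
  have "real (card (syn ` Pow {..<n})) * real (card C) = 2 ^ n"
    using sum_syn[of "\<lambda>_. 1"] by (simp add: card_Pow)
  also have "\<dots> = real (card C) * 2 ^ m"
    using card_C by (metis of_nat_mult of_nat_numeral of_nat_power)
  finally have "real (card (syn ` Pow {..<n})) = 2 ^ m"
    using card_C by (cases "card C = 0") auto
  then show "card (syn ` Pow {..<n}) = card (vecs m)"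
    by (simp add: card_vecs)
qed

text \<open>A noise vector z has the syndrome of x exactly when x + z is a codeword, and
  \<open>2 ^ m\<close> equals \<open>2 ^ n / card C\<close>, the normalisation in
  \<open>code_fun\<close>.\<close>

lemma pmf_syn:
  assumes x: "x \<subseteq> {..<n}"
  shows "2 ^ m * pmf P (syn x) = g x"
proof -
  have cpos: "0 < card C" using card_C by (cases "card C = 0") auto
  have pw: "(2::real) ^ m = 2 ^ n / card C"
    using card_C cpos by (simp add: field_simps) (metis mult.commute of_nat_mult of_nat_numeral of_nat_power)
  have "2 ^ m * pmf P (syn x) = bexp {..<n} (\<lambda>_. \<delta>) (\<lambda>z. 2 ^ m * of_bool (syn z = syn x))"
    using \<delta> by (simp add: pmf_map_bern_vec bexp_cmult)
  also have "\<dots> = bexp {..<n} (\<lambda>_. \<delta>) (\<lambda>z. code_fun {..<n} C (sym_diff x z))"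
  proof (rule bexp_cong)
    fix z assume z: "z \<subseteq> {..<n}"
    have "syn z = syn x \<longleftrightarrow> sym_diff x z \<in> C"
      using syndrome_eq_iff[OF ker C x z] by auto
    then show "2 ^ m * of_bool (syn z = syn x) = code_fun {..<n} C (sym_diff x z)"
      by (simp add: code_fun_def pw)
  qed simp
  finally show ?thesis by (simp add: noise_def)
qed

lemma pmf_unif: "s \<in> vecs m \<Longrightarrow> pmf (unif_vec m) s = 1 / 2 ^ m"
  unfolding unif_vec_def using finite_vecs[of m] card_vecs[of m]
  by (subst pmf_of_set) (auto simp: indicator_def)

lemma sum_vecs_eq_avg: "(\<Sum>s\<in>vecs m. G (2 ^ m * pmf P s)) / 2 ^ m = avg {..<n} (\<lambda>x. G (g x))"
proof -
  have cpos: "0 < card C" using card_C by (cases "card C = 0") auto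
  have "(\<Sum>s\<in>vecs m. G (2 ^ m * pmf P s)) * real (card C) = (\<Sum>x\<in>Pow {..<n}. G (2 ^ m * pmf P (syn x)))"
    unfolding range_syn[symmetric] by (rule sum_syn)
  also have "\<dots> = (\<Sum>x\<in>Pow {..<n}. G (g x))"
    by (intro sum.cong refl) (simp only: Pow_iff pmf_syn)
  finally have e: "(\<Sum>s\<in>vecs m. G (2 ^ m * pmf P s)) * real (card C) = (\<Sum>x\<in>Pow {..<n}. G (g x))" .
  have "(2::real) ^ n = real (card C) * 2 ^ m"
    using card_C by (metis of_nat_mult of_nat_numeral of_nat_power)
  then show ?thesis using cpos by (simp add: bexp_half e[symmetric])
qed

lemma renyi_div_eq:
  assumes "2 \<le> p"
  shows "renyi_div (real p) (vecs m) P (unif_vec m) = log_moment p {..<n} g"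
proof -
  have "(\<Sum>x\<in>vecs m. pmf P x powr real p * pmf (unif_vec m) x powr (1 - real p))
    = (\<Sum>s\<in>vecs m. (2 ^ m * pmf P s) ^ p / 2 ^ m)"
  proof (rule sum.cong)
    fix s assume s: "s \<in> vecs m"
    have u: "(1 / 2 ^ m :: real) powr (1 - real p) = (2 ^ m) ^ p / 2 ^ m"
    proof -
      have "(1 / 2 ^ m :: real) powr (1 - real p) = (2 ^ m) powr (real p - 1)"
        by (simp add: powr_divide powr_minus_divide[symmetric] flip: powr_minus)
      also have "\<dots> = (2 ^ m) powr real p / 2 ^ m" by (simp add: powr_diff)
      finally show ?thesis by (simp add: powr_realpow)
    qed
    have "pmf P s powr real p = pmf P s ^ p"
      using assms by (cases "pmf P s = 0") (auto simp: powr_realpow pmf_pos power_0_left order_less_le)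
    then show "pmf P s powr real p * pmf (unif_vec m) s powr (1 - real p) = (2 ^ m * pmf P s) ^ p / 2 ^ m"
      unfolding pmf_unif[OF s] u by (simp add: power_mult_distrib)
  qed simp
  also have "\<dots> = (\<Sum>s\<in>vecs m. (2 ^ m * pmf P s) ^ p) / 2 ^ m"
    by (rule sum_divide_distrib[symmetric])
  also have "\<dots> = avg {..<n} (\<lambda>x. g x ^ p)"
    by (rule sum_vecs_eq_avg)
  finally show ?thesis by (simp add: renyi_div_def log_moment_def)
qed

lemma renyi_inf_eq: "renyi_inf (vecs m) P (unif_vec m) = log_max {..<n} g"
proof -
  have "(\<lambda>x. pmf P x / pmf (unif_vec m) x) ` vecs m = (\<lambda>x. 2 ^ m * pmf P x) ` vecs m"
    by (rule image_cong) (auto simp: pmf_unif)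
  also have "\<dots> = (\<lambda>x. 2 ^ m * pmf P (syn x)) ` Pow {..<n}"
    unfolding range_syn[symmetric] by (simp only: image_image)
  also have "\<dots> = g ` Pow {..<n}"
    by (rule image_cong) (simp_all only: Pow_iff pmf_syn)
  finally show ?thesis by (simp add: renyi_inf_def log_max_def)
qed

lemma kl_div_eq: "kl_div (vecs m) P (unif_vec m) = log_mean {..<n} g"
proof -
  \<comment> \<open>The separate case of probability 0 in \<open>kl_div\<close> is absorbed by the
    factor 0 in front of the logarithm.\<close>
  have "kl_div (vecs m) P (unif_vec m) = (\<Sum>s\<in>vecs m. (2 ^ m * pmf P s) * log 2 (2 ^ m * pmf P s) / 2 ^ m)"
    unfolding kl_div_def by (intro sum.cong refl) (simp add: pmf_unif mult.commute)
  also have "\<dots> = (\<Sum>s\<in>vecs m. (2 ^ m * pmf P s) * log 2 (2 ^ m * pmf P s)) / 2 ^ m"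
    by (rule sum_divide_distrib[symmetric])
  also have "\<dots> = avg {..<n} (\<lambda>x. g x * log 2 (g x))"
    by (rule sum_vecs_eq_avg)
  finally show ?thesis by (simp add: log_mean_def)
qed

end

section \<open>Asymptotics\<close>

text \<open>The factors bound, in this order, the number of dimensions, of points and of frames, and
  the failure probability of one frame.\<close>

lemma determined_bound_tendsto:
  assumes "0 < e"
  shows "((\<lambda>x::real. x * 2 powr x * 2 powr (x * x) * exp (- (e / 2) * x ^ 3)) \<longlongrightarrow> 0) at_top"
  using assms by real_asymp

lemma log_small:
  shows "((\<lambda>x::real. (4 * log 2 x + 2) / sqrt (x / 2)) \<longlongrightarrow> 0) at_top"
    and "eventually (\<lambda>x::real. 4 * log 2 x + 1 \<le> x / 2) at_top"
  by real_asymp+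

lemma determined_sum_tendsto:
  fixes r \<mu> :: "nat \<Rightarrow> nat" and R l :: real
  assumes l: "0 \<le> l" "l \<le> 1" "l < R" and R: "0 < R"
    and \<mu>: "filterlim \<mu> at_top sequentially"
    and rate: "(\<lambda>j. RM_rate (r j) (\<mu> j)) \<longlonglongrightarrow> R"
  shows "(\<lambda>j. \<Sum>x\<in>{..<2 ^ \<mu> j}. bexp {..<2 ^ \<mu> j} (\<lambda>_. l)
     (\<lambda>S. of_bool (\<not> undet (RM_set (r j) (\<mu> j)) x S))) \<longlonglongrightarrow> 0"
    (is "?E \<longlonglongrightarrow> 0")
proof -
  \<comment> \<open>Half of the gap between R and l absorbs the loss of rate; the other half remains
    as the initial quality.\<close>
  define e where "e = (R - l) / 2"
  have e: "0 < e" using l by (simp add: e_def)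
  \<comment> \<open>The factor 4 gives 2^k >= \<mu>^4: one power of \<mu> is lost to \<eta>, and the
    remaining \<mu>^3 outgrows the \<mu>^2 of the union bound.\<close>
  define k where "k = (\<lambda>\<mu>::nat. nat \<lceil>4 * log 2 (real \<mu>)\<rceil>)"
  have real_\<mu>: "filterlim (\<lambda>j. real (\<mu> j)) at_top sequentially"
    by (rule filterlim_compose[OF filterlim_real_sequentially \<mu>])
  \<comment> \<open>The constant 2 covers both the rounding in K and the numerator K + 1 of
    \<open>RM_rate_le\<close>.\<close>
  let ?s = "\<lambda>x::real. (4 * log 2 x + 2) / sqrt (x / 2)"
  let ?b = "\<lambda>x::real. x * 2 powr x * 2 powr (x * x) * exp (- (e / 2) * x ^ 3)"
  have s0: "(\<lambda>j. ?s (real (\<mu> j))) \<longlonglongrightarrow> 0"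
    by (rule filterlim_compose[OF log_small(1) real_\<mu>])
  have b0: "(\<lambda>j. ?b (real (\<mu> j))) \<longlonglongrightarrow> 0"
    by (rule filterlim_compose[OF determined_bound_tendsto[OF e] real_\<mu>])
  have "(\<lambda>j. RM_rate (r j) (\<mu> j) - ?s (real (\<mu> j))) \<longlonglongrightarrow> R - 0"
    by (intro tendsto_diff rate s0)
  then have ev1: "eventually (\<lambda>j. l + e < RM_rate (r j) (\<mu> j) - ?s (real (\<mu> j))) sequentially"
    by (rule order_tendstoD) (use l in \<open>simp add: e_def field_simps\<close>)
  have ev2: "eventually (\<lambda>j. 4 * log 2 (real (\<mu> j)) + 1 \<le> real (\<mu> j) / 2) sequentially"
    by (rule eventually_compose_filterlim[OF log_small(2) real_\<mu>])
  have ev3: "eventually (\<lambda>j. real (\<mu> j) \<ge> max 2 e) sequentially"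
    using real_\<mu> by (simp only: filterlim_at_top)
  have "eventually (\<lambda>j. ?E j \<le> ?b (real (\<mu> j))) sequentially"
    using ev1 ev2 ev3
  proof eventually_elim
    case (elim j)
    define M K where "M = \<mu> j" "K = k (\<mu> j)"
    have M: "2 \<le> M" "e \<le> real M" using elim(3) by (auto simp: M_K_def)
    have lg: "0 \<le> log 2 (real M)" using M by simp
    have K1: "4 * log 2 (real M) \<le> real K" "real K \<le> 4 * log 2 (real M) + 1"
      using lg unfolding M_K_def k_def by linarith+
    have KM: "real K \<le> real M / 2" using K1(2) elim(2) by (simp add: M_K_def)
    define D where "D = M - K"
    have DK: "M = D + K" using KM by (simp add: D_def)
    have Dge: "real M / 2 \<le> real D" using KM DK by simp
    have sq: "0 < sqrt (real M / 2)" "sqrt (real M / 2) \<le> sqrt (real D + 1)" using Dge M by auto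
    have small: "real K / sqrt (real D + 1) \<le> ?s (real M)" "(real K + 1) / sqrt (real D + 1) \<le> ?s (real M)"
      using K1(2) lg sq by (auto intro!: frac_le)
    \<comment> \<open>A degree below K would make the rate as small as the error term.\<close>
    have rK: "K \<le> r j"
    proof (rule ccontr)
      assume "\<not> K \<le> r j"
      then have "(real (r j) + 1) / sqrt (real M + 1) \<le> (real K + 1) / sqrt (real D + 1)"
        using DK by (intro frac_le) auto
      then have "RM_rate (r j) M \<le> ?s (real M)"
        using RM_rate_le[of "r j" M] small(2) by linarith
      then show False using elim(1) l e by (simp add: M_K_def)
    qed
    define q where "q = r j - K"
    have rj: "r j = q + K" using rK by (simp add: q_def)
    have "RM_rate (r j) M - ?s (real M) \<le> RM_rate q D"
      using RM_rate_shift[of q K D] small(1) by (simp add: rj DK)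
    then have rateD: "e \<le> RM_rate q D - l" using elim(1) by (simp add: M_K_def)
    \<comment> \<open>At most M losses of this size consume no more than half of the quality
      e.\<close>
    define \<eta> where "\<eta> = e / (2 * real M)"
    have \<eta>: "0 \<le> \<eta>" "\<eta> \<le> 1" "real D * \<eta> < e"
    proof -
      show "0 \<le> \<eta>" "\<eta> \<le> 1" using e M by (auto simp: \<eta>_def)
      have "real D * \<eta> \<le> real M * \<eta>" using \<open>0 \<le> \<eta>\<close> DK by (intro mult_right_mono) auto
      also have "\<dots> = e / 2" using M by (simp add: \<eta>_def)
      finally show "real D * \<eta> < e" using e by simp
    qed
    have pow: "real M ^ 4 \<le> 2 ^ K"
    proof -
      have "real M ^ 4 = (2 powr log 2 (real M)) powr real 4"
        using M powr_realpow[of "real M" 4] by simp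
      also have "\<dots> = 2 powr (log 2 (real M) * real 4)" by (rule powr_powr)
      also have "\<dots> \<le> 2 powr real K" using K1(1) by simp
      finally show ?thesis by (simp add: powr_realpow)
    qed
    have expo: "(1 - \<eta>) ^ 2 ^ K \<le> exp (- (e / 2) * real M ^ 3)"
    proof -
      have "(1 - \<eta>) ^ 2 ^ K \<le> exp (- \<eta>) ^ 2 ^ K"
        using \<eta> exp_ge_add_one_self[of "- \<eta>"] by (intro power_mono) auto
      also have "\<dots> = exp (- \<eta> * 2 ^ K)" by (subst exp_of_nat_mult[symmetric]) simp
      also have "\<dots> \<le> exp (- \<eta> * real M ^ 4)" using \<eta> pow by (simp add: mult_left_mono)
      also have "- \<eta> * real M ^ 4 = - (e / 2) * real M ^ 3"
        using M by (simp add: \<eta>_def power_numeral_reduce)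
      finally show ?thesis .
    qed
    have one: "bexp {..<2 ^ M} (\<lambda>_. l) (\<lambda>S. of_bool (\<not> undet (RM_set (r j) M) x S))
      \<le> real M * 2 powr (real M * real M) * exp (- (e / 2) * real M ^ 3)" if "x < 2 ^ M" for x
    proof -
      have "bexp {..<2 ^ M} (\<lambda>_. l) (\<lambda>S. of_bool (\<not> undet (RM_set (r j) M) x S))
        \<le> real D * (2 ^ M) ^ D * (1 - \<eta>) ^ 2 ^ K"
        using determined_prob_le[OF l(1,2) _ rateD \<eta>, of x K] that by (simp add: rj DK)
      also have "\<dots> \<le> real M * (2 ^ M) ^ M * exp (- (e / 2) * real M ^ 3)"
        using DK \<eta> by (intro mult_mono expo power_increasing) auto
      also have "((2::real) ^ M) ^ M = 2 powr (real M * real M)"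
        unfolding power_mult[symmetric] by (subst powr_realpow[symmetric]) simp_all
      finally show ?thesis .
    qed
    have "?E j = (\<Sum>x\<in>{..<2 ^ M}. bexp {..<2 ^ M} (\<lambda>_. l) (\<lambda>S. of_bool (\<not> undet (RM_set (r j) M) x S)))"
      by (simp add: M_K_def)
    also have "\<dots> \<le> (\<Sum>x\<in>{..<2 ^ M :: nat}. real M * 2 powr (real M * real M) * exp (- (e / 2) * real M ^ 3))"
      using one by (intro sum_mono) simp
    also have "\<dots> = ?b (real M)" by (simp add: powr_realpow mult_ac)
    finally show ?case by (simp add: M_K_def)
  qed
  then show ?thesis
    by (intro tendsto_sandwich[OF _ _ tendsto_const b0])
       (use l in \<open>auto intro!: always_eventually sum_nonneg bexp_nonneg\<close>)
qed

lemma RM_set_card_times: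
  assumes "real m = 2 ^ \<mu> * (1 - RM_rate r \<mu>)"
  shows "card (RM_set r \<mu>) * 2 ^ m = 2 ^ 2 ^ \<mu>"
proof -
  have "real (\<Sum>i\<le>r. \<mu> choose i) = 2 ^ \<mu> * RM_rate r \<mu>" by (simp add: RM_rate_def)
  then have "real ((\<Sum>i\<le>r. \<mu> choose i) + m) = real (2 ^ \<mu>)"
    using assms by (simp add: algebra_simps)
  then have "(\<Sum>i\<le>r. \<mu> choose i) + m = 2 ^ \<mu>" by (simp only: of_nat_eq_iff)
  then show ?thesis by (simp only: card_RM_set flip: power_add)
qed

text \<open>\<open>psi p (1 - 2 * \<delta>)\<close> is 2^(p-1) times the sum of the p-th powers of
  \<delta> and 1 - \<delta>, and \<open>psi p 1\<close> is 2^(p-1). So 1 - h_p(\<delta>) is exactly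
  the exponent with equality at the endpoint.\<close>

lemma ln_psi_hp:
  assumes p: "2 \<le> p" and \<delta>: "0 < \<delta>" "\<delta> < 1"
  defines "l \<equiv> 1 - hp (real p) \<delta>"
  shows "ln (psi p (1 - 2 * \<delta>)) = l * ln (psi p 1)" "0 \<le> l" "l \<le> 1"
proof -
  define s where "s = \<delta> ^ p + (1 - \<delta>) ^ p"
  have s: "0 < s" using \<delta> by (simp add: s_def add_pos_pos)
  obtain n where n: "p = Suc n" "1 \<le> n" using p by (cases p) auto
  have psi: "psi p (1 - 2 * \<delta>) = 2 ^ n * s"
  proof -
    have "1 + (1 - 2 * \<delta>) = 2 * (1 - \<delta>)" "1 - (1 - 2 * \<delta>) = 2 * \<delta>" by simp_all
    then have "psi p (1 - 2 * \<delta>) = (2 ^ p * (1 - \<delta>) ^ p + 2 ^ p * \<delta> ^ p) / 2"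
      unfolding psi_def by (simp only: power_mult_distrib)
    also have "(2::real) ^ p = 2 * 2 ^ n" by (simp add: n(1))
    also have "(2 * 2 ^ n * (1 - \<delta>) ^ p + 2 * 2 ^ n * \<delta> ^ p) / 2 = 2 ^ n * s"
      unfolding s_def by (simp add: distrib_left mult.assoc)
    finally show ?thesis .
  qed
  have l: "l = 1 + log 2 s / real n"
  proof -
    have "\<delta> powr real p = \<delta> ^ p" "(1 - \<delta>) powr real p = (1 - \<delta>) ^ p"
      using \<delta> by (auto intro: powr_realpow)
    then show ?thesis by (simp add: l_def hp_def s_def n(1))
  qed
  have psi1: "ln (psi p 1) = real n * ln 2" by (simp add: n(1) psi_1 ln_realpow)
  have "ln (psi p (1 - 2 * \<delta>)) = real n * ln 2 + ln s" using s by (simp add: psi ln_mult ln_realpow)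
  also have "\<dots> = l * (real n * ln 2)" using n(2) by (simp add: l log_def field_simps)
  finally show eq: "ln (psi p (1 - 2 * \<delta>)) = l * ln (psi p 1)" by (simp add: psi1)
  have pos: "0 < ln (psi p 1)" using n(2) by (simp add: psi1)
  have "1 \<le> psi p (1 - 2 * \<delta>)" using \<delta> by (intro psi_ge_1) auto
  then have "0 \<le> l * ln (psi p 1)" by (simp flip: eq)
  then show "0 \<le> l" using pos by (simp add: zero_le_mult_iff)
  have "\<delta> ^ p \<le> \<delta> ^ 1" "(1 - \<delta>) ^ p \<le> (1 - \<delta>) ^ 1" using p \<delta> by (intro power_decreasing; simp)+
  then have "s \<le> 1" by (simp add: s_def)
  then have "log 2 s \<le> 0" using s by simp
  then show "l \<le> 1" using n(2) by (simp add: l divide_nonpos_pos)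
qed

text \<open>Both sides of the first equation are twice the larger of \<delta> and 1 -
  \<delta>.\<close>

lemma one_plus_abs_h_inf:
  assumes \<delta>: "0 < \<delta>" "\<delta> < 1"
  defines "l \<equiv> 1 - h_inf \<delta>"
  shows "1 + \<bar>1 - 2 * \<delta>\<bar> = 2 powr l" "0 \<le> l" "l \<le> 1"
proof -
  define M where "M = max \<delta> (1 - \<delta>)"
  have M: "1 / 2 \<le> M" "M \<le> 1" using \<delta> by (auto simp: M_def max_def)
  have l: "l = 1 + log 2 M" by (simp add: l_def h_inf_def M_def)
  show "1 + \<bar>1 - 2 * \<delta>\<bar> = 2 powr l"
    using M by (simp add: l powr_add) (simp add: M_def max_def abs_if)
  have "log 2 (1 / 2) \<le> log 2 M" using M by (subst log_le_cancel_iff) auto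
  then show "0 \<le> l" by (simp add: l log_divide)
  show "l \<le> 1" using M by (simp add: l)
qed

theorem theorem4p1:
  fixes R \<delta> :: real and r \<mu> m :: "nat \<Rightarrow> nat" and H :: "nat \<Rightarrow> nat \<Rightarrow> nat \<Rightarrow> bool"
  assumes R: "0 < R" "R < 1" and \<delta>: "0 < \<delta>" "\<delta> < 1"
    and len: "filterlim (\<lambda>j. (2::nat) ^ \<mu> j) at_top sequentially"
    and rate: "(\<lambda>j. RM_rate (r j) (\<mu> j)) \<longlonglongrightarrow> R"
    and rows: "\<And>j. real (m j) = 2 ^ \<mu> j * (1 - RM_rate (r j) (\<mu> j))"
    and pc: "\<And>j. parity_check (m j) (2 ^ \<mu> j) (H j) (RM (r j) (\<mu> j))"
  defines "P \<equiv> \<lambda>j. map_pmf (syndrome (m j) (2 ^ \<mu> j) (H j)) (bern_vec (2 ^ \<mu> j) \<delta>)"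
  shows "(\<forall>p::nat. 2 \<le> p \<longrightarrow> R > 1 - hp (real p) \<delta> \<longrightarrow>
            (\<lambda>j. renyi_div (real p) (vecs (m j)) (P j) (unif_vec (m j))) \<longlonglongrightarrow> 0)
       \<and> (R > 1 - h_inf \<delta> \<longrightarrow>
            (\<lambda>j. renyi_inf (vecs (m j)) (P j) (unif_vec (m j))) \<longlonglongrightarrow> 0)
       \<and> (R > (1 - 2 * \<delta>) ^ 2 \<longrightarrow>
            (\<lambda>j. kl_div (vecs (m j)) (P j) (unif_vec (m j))) \<longlonglongrightarrow> 0)"
proof -
  let ?I = "\<lambda>j. {..<2 ^ \<mu> j :: nat}" and ?C = "\<lambda>j. RM_set (r j) (\<mu> j)"
  let ?g = "\<lambda>j. noise (?I j) (\<lambda>_. \<delta>) (code_fun (?I j) (?C j))"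
  have \<mu>: "filterlim \<mu> at_top sequentially"
    unfolding filterlim_at_top
  proof
    fix Z
    have "eventually (\<lambda>j. 2 ^ Z \<le> (2::nat) ^ \<mu> j) sequentially"
      using len by (simp only: filterlim_at_top)
    then show "eventually (\<lambda>j. Z \<le> \<mu> j) sequentially" by (rule eventually_mono) simp
  qed
  have sc: "syndrome_code (m j) (2 ^ \<mu> j) (H j) (?C j) \<delta>" for j
  proof
    have "char_vec ` ?C j = RM (r j) (\<mu> j)" by (simp add: RM_eq_RM_set char_vec_def)
    then show "{x \<in> vecs (2 ^ \<mu> j). syndrome (m j) (2 ^ \<mu> j) (H j) x = (\<lambda>_. False)} = char_vec ` ?C j"
      using pc[of j] by (simp add: parity_check_def)
    show "?C j \<subseteq> Pow (?I j)" using RM_set_sub by blast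
    show "card (?C j) * 2 ^ m j = 2 ^ 2 ^ \<mu> j" by (rule RM_set_card_times[OF rows])
  qed (use \<delta> in auto)
  have g0: "0 \<le> ?g j x" for j x
    using \<delta> by (intro noise_nonneg code_fun_nonneg) auto
  have CI: "?C j \<subseteq> Pow (?I j)" for j using RM_set_sub by blast
  have "?C j \<noteq> {}" for j using RM_set_empty by blast
  then have g1: "avg (?I j) (?g j) = 1" for j
    by (simp add: avg_noise avg_code_fun CI)
  \<comment> \<open>\<open>\<Phi>\<close> takes the index set as an argument because the length
    changes with j; the three limits differ only in \<open>\<Phi>\<close> and l.\<close>
  have conv: "(\<lambda>j. \<Phi> (?I j) (?g j)) \<longlonglongrightarrow> 0"
    if l: "0 \<le> l" "l \<le> 1" "l < R"
      and nonneg: "\<And>j. 0 \<le> \<Phi> (?I j) (?g j)"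
      and step: "\<And>I i g. finite I \<Longrightarrow> i \<in> I \<Longrightarrow> (\<And>x. 0 \<le> g x) \<Longrightarrow> avg I g = 1 \<Longrightarrow>
        \<Phi> I (flip_mix i \<delta> g) \<le> l * \<Phi> I g + (1 - l) * \<Phi> I (flip_mix i (1/2) g)"
      and bound: "\<And>I g \<nu>. finite I \<Longrightarrow> (\<And>x. 0 \<le> g x) \<Longrightarrow> avg I g = 1 \<Longrightarrow>
        (\<And>x. x \<subseteq> I \<Longrightarrow> g x \<le> 2 ^ \<nu>) \<Longrightarrow> \<Phi> I g \<le> real \<nu>"
    for l and \<Phi> :: "nat set \<Rightarrow> (nat set \<Rightarrow> real) \<Rightarrow> real"
  proof (rule tendsto_sandwich[OF _ _ tendsto_const determined_sum_tendsto[OF l R(1) \<mu> rate]])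
    show "\<forall>\<^sub>F j in sequentially. 0 \<le> \<Phi> (?I j) (?g j)" by (simp add: nonneg)
    have "\<Phi> (?I j) (?g j) \<le> (\<Sum>x\<in>?I j. bexp (?I j) (\<lambda>_. l) (\<lambda>S. of_bool (\<not> undet (?C j) x S)))" for j
      using \<delta> by (intro code_noise_le CI RM_set_sym_diff RM_set_empty l step bound) auto
    then show "\<forall>\<^sub>F j in sequentially. \<Phi> (?I j) (?g j) \<le>
        (\<Sum>x\<in>?I j. bexp (?I j) (\<lambda>_. l) (\<lambda>S. of_bool (\<not> undet (?C j) x S)))" by simp
  qed
  have "(\<lambda>j. renyi_div (real p) (vecs (m j)) (P j) (unif_vec (m j))) \<longlonglongrightarrow> 0"
    if p: "2 \<le> p" "R > 1 - hp (real p) \<delta>" for p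
  proof -
    note lam = ln_psi_hp[OF p(1) \<delta>]
    have "0 \<le> log_moment p (?I j) (?g j)" for j
      using avg_power_ge_1[OF _ g0 g1, of j p] p by (simp add: log_moment_def)
    then have "(\<lambda>j. log_moment p (?I j) (?g j)) \<longlonglongrightarrow> 0"
      using p lam \<delta> by (intro conv[of "1 - hp (real p) \<delta>"] log_moment_step log_moment_le) auto
    then show ?thesis
      unfolding P_def by (simp only: syndrome_code.renyi_div_eq[OF sc p(1)])
  qed
  moreover have "(\<lambda>j. renyi_inf (vecs (m j)) (P j) (unif_vec (m j))) \<longlonglongrightarrow> 0" if "R > 1 - h_inf \<delta>"
  proof -
    note lam = one_plus_abs_h_inf[OF \<delta>]
    have "0 \<le> log_max (?I j) (?g j)" for j
      using Max_ge_1[OF _ g1, of j] by (simp add: log_max_def)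
    then have "(\<lambda>j. log_max (?I j) (?g j)) \<longlonglongrightarrow> 0"
      using that lam \<delta> by (intro conv[of "1 - h_inf \<delta>"] log_max_step log_max_le) auto
    then show ?thesis
      unfolding P_def by (simp only: syndrome_code.renyi_inf_eq[OF sc])
  qed
  moreover have "(\<lambda>j. kl_div (vecs (m j)) (P j) (unif_vec (m j))) \<longlonglongrightarrow> 0" if "R > (1 - 2 * \<delta>)\<^sup>2"
  proof -
    have "(1 - 2 * \<delta>)\<^sup>2 \<le> 1" using \<delta> by (simp add: abs_square_le_1 abs_le_iff)
    then have "(\<lambda>j. log_mean (?I j) (?g j)) \<longlonglongrightarrow> 0"
      using that \<delta> g0 g1
      by (intro conv[of "(1 - 2 * \<delta>)\<^sup>2"] log_mean_step log_mean_le log_mean_nonneg) auto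
    then show ?thesis
      unfolding P_def by (simp only: syndrome_code.kl_div_eq[OF sc])
  qed
  ultimately show ?thesis by blast
qed

end
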